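(* Let $0<s<1$, let $\varphi\in C^3(\mathbb{R}^n)$ be convex with $D^2\varphi>0$ on $\mathbb{R}^n$ and $\mu_\varphi\in(\mathrm{DC})_\varphi$, let $\Phi(x,z):=\varphi(x)+\frac{s^2}{1-s}|z|^{1/s}$ on $\mathbb{R}^n\times\mathbb{R}$, and let $$M_s:=\frac{2^{2+s}(1-s)^s}{s^{2s}}+8,\qquad\beta_s:=4K_s(1+8K_s).$$ There exist geometric constants $\theta_0,\varepsilon_0\in(0,1)$ such that, for every $Q=S_\varphi(p_0,R_0)\times\mathbb{R}$, every section $S_R:=S_\Phi(X_0,R)$ with $S_{\beta_sR}:=S_\Phi(X_0,\beta_sR)\subset Q$ and every $W\in\mathcal{S}(Q)$ with $W\ge0$ and $L_\Phi W\ge0$ pointwise in $Q^+$, the inequalities $$W_{z,0^+}(S_{\beta_sR})\,R^s\le\theta_0\qquad\text{and}\qquad\inf_{S_R}W\le1$$ imply $$\mu_\Phi(\{X\in S_{\beta_sR}:W(X)<M_s\})\ge\varepsilon_0\,\mu_\Phi(S_{\beta_sR}).$$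
   Context: For a differentiable strictly convex function $\phi:\mathbb{R}^N\to\mathbb{R}$: $\delta_\phi(x_0,x):=\phi(x)-\phi(x_0)-\langle\nabla\phi(x_0),x-x_0\rangle$ and $S_\phi(x_0,R):=\{x\in\mathbb{R}^N:\delta_\phi(x_0,x)<R\}$ for $R>0$ (a section). $\mu_\varphi(x):=\det D^2\varphi(x)$ (also the measure with this density). $\mu_\varphi\in(\mathrm{DC})_\varphi$ means: there is $C_d\ge1$ with $\mu_\varphi(S_\varphi(x,t))\le C_d\,\mu_\varphi(\tfrac12S_\varphi(x,t))$ for all $x\in\mathbb{R}^n$, $t>0$, where $\tfrac12S$ is the $\tfrac12$-contraction of $S$ with respect to its (Lebesgue) center of mass. A geometric constant is a constant depending only on $C_d$, $n$, $s$. $h_s(z):=\frac{s^2}{1-s}|z|^{1/s}$, so $\Phi(x,z)=\varphi(x)+h_s(z)$ and $h_s''(z)=|z|^{1/s-2}$ for $z\ne0$. $K_s\ge1$ is a fixed constant depending only on $s$ such that $\delta_{h_s}(z,z')\le K_s\big(\min\{\delta_{h_s}(z,z''),\delta_{h_s}(z'',z)\}+\min\{\delta_{h_s}(z',z''),\delta_{h_s}(z'',z')\}\big)$ for all $z,z',z''\in\mathbb{R}$. $\mu_\Phi$ is the measure with density $\mu_\varphi(x)|z|^{1/s-2}$. For $z\neq0$, $L_\Phi W:=-\mathrm{trace}((D^2\Phi)^{-1}D^2W)=-\mathrm{trace}((D^2\varphi)^{-1}D_x^2W)-|z|^{2-1/s}W_{zz}$, and $\nabla^\Phi W:=((D^2\varphi)^{-1/2}\nabla_xW,\,|z|^{1-\frac1{2s}}W_z)$.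 $Q:=S_\varphi(p_0,R_0)\times\mathbb{R}$ ($p_0\in\mathbb{R}^n$, $R_0>0$), $Q^+:=Q\cap\{z>0\}$, $Z_0:=\{(x,0):x\in\mathbb{R}^n\}$. The class $\mathcal{S}(Q)$ consists of functions $F$ on $Q$ such that: (i) $F(x,z)=F(x,-z)$ on $Q$; (ii) $F\in C(Q)\cap C^2(Q\setminus Z_0)$; (iii) for every section $S_\Phi(X_0,R)$ with $S_\Phi(X_0,2R)\subset\subset Q$, $\nabla^\Phi F\in L^2(S_\Phi(X_0,2R),d\mu_\Phi)$; (iv) for every $x\in S_\varphi(p_0,R_0)$ the limit $F_z(x,0^+):=\lim_{z\to0^+}F_z(x,z)$ exists and $x\mapsto F_z(x,0^+)$ is continuous in $S_\varphi(p_0,R_0)$. For open $\Omega\subset Q$, $F_{z,0^+}(\Omega):=\sup\{|F_z(x,0^+)|:(x,0)\in\Omega\cap Z_0\}$ if $\Omega\cap Z_0\ne\emptyset$, and $F_{z,0^+}(\Omega):=0$ otherwise. *)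

theory Defs
  imports "HOL-Analysis.Analysis"
begin

text \<open>
  \<open>\<real>\<^sup>n\<close> is the type \<open>real ^ 'n\<close>, and \<open>\<real>\<^sup>n \<times> \<real>\<close> is the type \<open>(real ^ 'n) \<times> real\<close>, whose inner product,
  norm and Lebesgue measure are those of \<open>\<real>\<^bsup>n+1\<^esup>\<close>.
\<close>

definition grad :: "('a::real_inner \<Rightarrow> real) \<Rightarrow> 'a \<Rightarrow> 'a" where
  "grad f x = (THE D. GDERIV f x :> D)"

definition hess :: "(real ^ 'n \<Rightarrow> real) \<Rightarrow> real ^ 'n \<Rightarrow> real ^ 'n ^ 'n" where
  "hess f x = jacobian (grad f) (at x)"

text \<open>Class \<open>C\<^sup>k\<close> on an open set \<open>S\<close>, by recursion on the directional derivatives.\<close>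

fun Ck_on :: "nat \<Rightarrow> ('a::euclidean_space) set \<Rightarrow> ('a \<Rightarrow> real) \<Rightarrow> bool" where
  "Ck_on 0 S f \<longleftrightarrow> continuous_on S f"
| "Ck_on (Suc k) S f \<longleftrightarrow>
     (\<forall>x\<in>S. f differentiable (at x)) \<and> (\<forall>v. Ck_on k S (\<lambda>x. frechet_derivative f (at x) v))"

definition pos_def :: "real ^ 'n ^ 'n \<Rightarrow> bool" where
  "pos_def A \<longleftrightarrow> (\<forall>v. v \<noteq> 0 \<longrightarrow> 0 < v \<bullet> (A *v v))"

text \<open>The square root of a symmetric positive definite matrix.\<close>

definition pd_sqrt :: "real ^ 'n ^ 'n \<Rightarrow> real ^ 'n ^ 'n" where
  "pd_sqrt A = (THE B. transpose B = B \<and> pos_def B \<and> B ** B = A)"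

definition bregman :: "('a::real_inner \<Rightarrow> real) \<Rightarrow> 'a \<Rightarrow> 'a \<Rightarrow> real" where
  "bregman \<phi> x0 x = \<phi> x - \<phi> x0 - grad \<phi> x0 \<bullet> (x - x0)"

definition section_of :: "('a::real_inner \<Rightarrow> real) \<Rightarrow> 'a \<Rightarrow> real \<Rightarrow> 'a set" where
  "section_of \<phi> x0 R = {x. bregman \<phi> x0 x < R}"

definition MA_density :: "(real ^ 'n \<Rightarrow> real) \<Rightarrow> real ^ 'n \<Rightarrow> real" where
  "MA_density \<phi> x = det (hess \<phi> x)"

definition MA_measure :: "(real ^ 'n \<Rightarrow> real) \<Rightarrow> (real ^ 'n) measure" where
  "MA_measure \<phi> = density lborel (\<lambda>x. ennreal (MA_density \<phi> x))"

definition center_of_mass :: "'a::euclidean_space set \<Rightarrow> 'a" where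
  "center_of_mass S = (1 / measure lborel S) *\<^sub>R (LINT y:S|lborel. y)"

definition half_contraction :: "'a::euclidean_space set \<Rightarrow> 'a set" where
  "half_contraction S =
     (\<lambda>y. center_of_mass S + (1/2) *\<^sub>R (y - center_of_mass S)) ` S"

text \<open>The doubling condition \<open>(DC)\<^sub>\<phi>\<close>, with its constant as a parameter.\<close>

definition DC :: "real \<Rightarrow> (real ^ 'n \<Rightarrow> real) \<Rightarrow> bool" where
  "DC C \<phi> \<longleftrightarrow> 1 \<le> C \<and> (\<forall>x t. 0 < t \<longrightarrow>
     emeasure (MA_measure \<phi>) (section_of \<phi> x t)
       \<le> ennreal C * emeasure (MA_measure \<phi>) (half_contraction (section_of \<phi> x t)))"

definition h :: "real \<Rightarrow> real \<Rightarrow> real" where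
  "h s z = s\<^sup>2 / (1 - s) * \<bar>z\<bar> powr (1 / s)"

definition h_quasi_triangle :: "real \<Rightarrow> real \<Rightarrow> bool" where
  "h_quasi_triangle s K \<longleftrightarrow> 1 \<le> K \<and> (\<forall>z z' z''.
     bregman (h s) z z' \<le>
       K * (min (bregman (h s) z z'') (bregman (h s) z'' z)
          + min (bregman (h s) z' z'') (bregman (h s) z'' z')))"

definition Phi :: "real \<Rightarrow> (real ^ 'n \<Rightarrow> real) \<Rightarrow> (real ^ 'n) \<times> real \<Rightarrow> real" where
  "Phi s \<phi> = (\<lambda>(x, z). \<phi> x + h s z)"

definition mu_Phi :: "real \<Rightarrow> (real ^ 'n \<Rightarrow> real) \<Rightarrow> ((real ^ 'n) \<times> real) measure" where
  "mu_Phi s \<phi> =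
     density lborel (\<lambda>(x, z). ennreal (MA_density \<phi> x * \<bar>z\<bar> powr (1 / s - 2)))"

definition D_x :: "((real ^ 'n) \<times> real \<Rightarrow> real) \<Rightarrow> real ^ 'n \<Rightarrow> real \<Rightarrow> real ^ 'n" where
  "D_x W x z = grad (\<lambda>y. W (y, z)) x"

definition D_xx :: "((real ^ 'n) \<times> real \<Rightarrow> real) \<Rightarrow> real ^ 'n \<Rightarrow> real \<Rightarrow> real ^ 'n ^ 'n" where
  "D_xx W x z = hess (\<lambda>y. W (y, z)) x"

definition D_z :: "((real ^ 'n) \<times> real \<Rightarrow> real) \<Rightarrow> real ^ 'n \<Rightarrow> real \<Rightarrow> real" where
  "D_z W x z = deriv (\<lambda>t. W (x, t)) z"

definition D_zz :: "((real ^ 'n) \<times> real \<Rightarrow> real) \<Rightarrow> real ^ 'n \<Rightarrow> real \<Rightarrow> real" where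
  "D_zz W x z = deriv (\<lambda>t. D_z W x t) z"

text \<open>
  \<open>L_Phi\<close> and \<open>grad_Phi\<close> are meaningful for \<open>z \<noteq> 0\<close> only. Since \<open>D\<^sup>2\<Phi>\<close> is block diagonal with blocks
  \<open>D\<^sup>2\<phi>\<close> and \<open>\<bar>z\<bar>\<close> to the power \<open>1/s - 2\<close>, the trace of \<open>(D\<^sup>2\<Phi>)\<close> inverse times \<open>D\<^sup>2W\<close> is written blockwise.
\<close>

definition L_Phi :: "real \<Rightarrow> (real ^ 'n \<Rightarrow> real) \<Rightarrow> ((real ^ 'n) \<times> real \<Rightarrow> real)
    \<Rightarrow> (real ^ 'n) \<times> real \<Rightarrow> real" where
  "L_Phi s \<phi> W = (\<lambda>(x, z).
     - trace (matrix_inv (hess \<phi> x) ** D_xx W x z) - \<bar>z\<bar> powr (2 - 1 / s) * D_zz W x z)"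

definition grad_Phi :: "real \<Rightarrow> (real ^ 'n \<Rightarrow> real) \<Rightarrow> ((real ^ 'n) \<times> real \<Rightarrow> real)
    \<Rightarrow> (real ^ 'n) \<times> real \<Rightarrow> (real ^ 'n) \<times> real" where
  "grad_Phi s \<phi> W = (\<lambda>(x, z).
     (pd_sqrt (matrix_inv (hess \<phi> x)) *v D_x W x z, \<bar>z\<bar> powr (1 - 1 / (2 * s)) * D_z W x z))"

definition L2_on :: "'a measure \<Rightarrow> 'a set \<Rightarrow> ('a \<Rightarrow> 'b::euclidean_space) \<Rightarrow> bool" where
  "L2_on M A f \<longleftrightarrow> set_borel_measurable M A f \<and> set_integrable M A (\<lambda>x. (norm (f x))\<^sup>2)"

definition compactly_inside :: "'a::metric_space set \<Rightarrow> 'a set \<Rightarrow> bool" where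
  "compactly_inside A B \<longleftrightarrow> compact (closure A) \<and> closure A \<subseteq> B"

definition Z0 :: "((real ^ 'n) \<times> real) set" where
  "Z0 = UNIV \<times> {0}"

definition cylinder :: "(real ^ 'n \<Rightarrow> real) \<Rightarrow> real ^ 'n \<Rightarrow> real \<Rightarrow> ((real ^ 'n) \<times> real) set" where
  "cylinder \<phi> p0 R0 = section_of \<phi> p0 R0 \<times> UNIV"

definition D_z_0plus :: "((real ^ 'n) \<times> real \<Rightarrow> real) \<Rightarrow> real ^ 'n \<Rightarrow> real" where
  "D_z_0plus F x = Lim (at_right 0) (\<lambda>z. D_z F x z)"

text \<open>
  The class \<open>\<S>(Q)\<close> for \<open>Q = cylinder \<phi> p0 R0\<close>; the values of \<open>F\<close> outside \<open>Q\<close> are irrelevant.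
  The \<open>\<mu>\<^sub>\<Phi>\<close>-null set \<open>Z0\<close>, where \<open>grad_Phi\<close> is not defined, is removed in the \<open>L\<^sup>2\<close> condition.
\<close>

definition class_S :: "real \<Rightarrow> (real ^ 'n \<Rightarrow> real) \<Rightarrow> real ^ 'n \<Rightarrow> real
    \<Rightarrow> ((real ^ 'n) \<times> real \<Rightarrow> real) set" where
  "class_S s \<phi> p0 R0 = {F.
     (\<forall>x z. (x, z) \<in> cylinder \<phi> p0 R0 \<longrightarrow> F (x, z) = F (x, - z)) \<and>
     continuous_on (cylinder \<phi> p0 R0) F \<and>
     Ck_on 2 (cylinder \<phi> p0 R0 - Z0) F \<and>
     (\<forall>X0 R. 0 < R \<longrightarrow>
        compactly_inside (section_of (Phi s \<phi>) X0 (2 * R)) (cylinder \<phi> p0 R0) \<longrightarrow>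
        L2_on (mu_Phi s \<phi>) (section_of (Phi s \<phi>) X0 (2 * R) - Z0) (grad_Phi s \<phi> F)) \<and>
     (\<forall>x\<in>section_of \<phi> p0 R0. \<exists>l. ((\<lambda>z. D_z F x z) \<longlongrightarrow> l) (at_right 0)) \<and>
     continuous_on (section_of \<phi> p0 R0) (D_z_0plus F)}"

text \<open>The supremum is taken in \<open>[0, \<infinity>]\<close>, since it need not be finite.\<close>

definition sup_D_z_0plus ::
    "((real ^ 'n) \<times> real \<Rightarrow> real) \<Rightarrow> ((real ^ 'n) \<times> real) set \<Rightarrow> ennreal" where
  "sup_D_z_0plus F \<Omega> =
     (if \<Omega> \<inter> Z0 \<noteq> {} then (SUP X \<in> \<Omega> \<inter> Z0. ennreal \<bar>D_z_0plus F (fst X)\<bar>) else 0)"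

definition M_const :: "real \<Rightarrow> real" where
  "M_const s = 2 powr (2 + s) * (1 - s) powr s / s powr (2 * s) + 8"

definition beta_const :: "real \<Rightarrow> real" where
  "beta_const K = 4 * K * (1 + 8 * K)"

end

theory Submission
  imports Defs
begin

text \<open>
  The estimate is proved by sliding affine perturbations of \<open>- \<Phi> / R\<close> from below until they touch \<open>W\<close>.
  For a slope \<open>P\<close> consider \<open>g X = R * W X + \<Phi> X - P \<bullet> X\<close>. If \<open>P\<close> differs from \<open>\<nabla>\<Phi>(X0)\<close> by a vector
  whose product with \<open>X - X0\<close> is at most \<open>R\<close> in modulus on the large section, then \<open>g\<close> is, up to an
  affine function bounded by \<open>R\<close> and a constant, \<open>R * W\<close> plus the Bregman divergence from \<open>X0\<close>. On
  the boundary of the section of height \<open>20 R\<close> this exceeds its value at a point of the section of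
  height \<open>R\<close> where \<open>W < 2\<close>. So \<open>g\<close> has an interior minimum, and there \<open>W < 5\<close>. This is where the
  constants \<open>36 \<le> \<beta>\<close> and \<open>8 \<le> M\<close> enter (lemma \<open>contact_point\<close>).

  The minimum lies in \<open>z > 0\<close>. One may assume that \<open>X0\<close> lies in \<open>z \<ge> 0\<close>, by reflection, and only slopes
  with last component \<open>q\<close> larger than \<open>\<theta> R\<^bsup>1-s\<^esup>\<close> are used. Since \<open>W\<close> and \<open>\<Phi>\<close> are even in \<open>z\<close>, reflecting
  a point with \<open>z < 0\<close> lowers \<open>g\<close>; and a minimum at \<open>z = 0\<close> would force \<open>q \<le> R * W\<^sub>z(x,0+)\<close>, against the
  bound on \<open>W\<^sub>z(x,0+)\<close> (lemma \<open>no_contact_on_Z0\<close>).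

  At the minimum \<open>P = R \<nabla>W + \<nabla>\<Phi>\<close> and \<open>R D\<^sup>2W + D\<^sup>2\<Phi>\<close> is positive semidefinite. As \<open>L\<^sub>\<Phi> W \<ge> 0\<close>, the trace of
  \<open>(D\<^sup>2\<Phi>)\<close> inverse times \<open>R D\<^sup>2W\<close> is nonpositive, and the inequality of the arithmetic and geometric
  means gives \<open>det (R D\<^sup>2W + D\<^sup>2\<Phi>) \<le> det D\<^sup>2\<Phi>\<close> (lemma \<open>edet_le_edet_if_trace_nonpos\<close>). By the area
  formula for the map \<open>R \<nabla>W + \<nabla>\<Phi>\<close>, the Lebesgue measure of the set of admissible slopes is at most the
  \<open>\<mu>\<^sub>\<Phi>\<close> measure of the set of contact points, which is contained in \<open>{W < M}\<close> (lemma \<open>slopes_le_mu_Phi\<close>).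

  It remains to bound \<open>\<mu>\<^sub>\<Phi>\<close> of the large section by the measure of the admissible slopes; both are
  compared with products. In \<open>x\<close>, doubling reduces \<open>\<mu>\<^sub>\<phi>(S)\<close> to the measure of the gradient image of the
  half contraction of \<open>S\<close>. Convexity bounds these gradients against \<open>w - c\<close> for \<open>w \<in> S\<close>, with \<open>c\<close> the
  center of mass; as the section is balanced about \<open>c\<close> up to a factor depending on the dimension, a
  multiple of the gradient image lies in the set of admissible slopes
  (lemma \<open>MA_measure_section_le_slope_set\<close>). In \<open>z\<close>, the quasi-triangle inequality bounds the product of
  the length of a section of \<open>h\<^sub>s\<close> and the increment of \<open>h\<^sub>s'\<close> over it (lemma \<open>h_slope_interval\<close>). The
  sections of \<open>\<phi>\<close> thus enter only through measures, which is why \<open>\<beta>\<close> and \<open>M\<close> can depend on \<open>s\<close> alone.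
\<close>

section \<open>Determinants and the area formula on Euclidean spaces\<close>

text \<open>
  The elements of \<open>Basis\<close> as an index type: it identifies an arbitrary Euclidean space with
  \<open>real ^ 'a bidx\<close>, so that determinants and the change of variables become available on
  \<open>(real ^ 'n) \<times> real\<close>. Change of variables requires a well-ordered index type; the order chosen here is
  arbitrary.
\<close>

typedef (overloaded) ('a::euclidean_space) bidx = "Basis :: 'a set"
  using nonempty_Basis by blast

instance bidx :: (euclidean_space) finite
proof
  have "finite (Rep_bidx ` (UNIV :: 'a bidx set))"
    by (metis finite_Basis type_definition.Rep_range type_definition_bidx)
  thus "finite (UNIV :: 'a bidx set)"
    by (rule finite_imageD) (simp add: Rep_bidx_inject inj_on_def)
qed

definition bidx_rank :: "('a::euclidean_space) bidx \<Rightarrow> nat" where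
  "bidx_rank = (SOME f. inj f)"

lemma inj_bidx_rank: "inj (bidx_rank :: 'a::euclidean_space bidx \<Rightarrow> nat)"
proof -
  obtain f :: "'a bidx \<Rightarrow> nat" where "inj f"
    using finite_imp_inj_to_nat_seg[OF finite[of "UNIV :: 'a bidx set"]] by blast
  thus ?thesis unfolding bidx_rank_def by (rule someI[of "\<lambda>f. inj f"])
qed

instantiation bidx :: (euclidean_space) wellorder
begin

definition less_eq_bidx :: "'a bidx \<Rightarrow> 'a bidx \<Rightarrow> bool" where
  "less_eq_bidx i j \<longleftrightarrow> bidx_rank i \<le> bidx_rank j"

definition less_bidx :: "'a bidx \<Rightarrow> 'a bidx \<Rightarrow> bool" where
  "less_bidx i j \<longleftrightarrow> bidx_rank i < bidx_rank j"

instance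
proof
  fix P :: "'a bidx \<Rightarrow> bool" and a
  assume *: "\<And>x. (\<And>y. y < x \<Longrightarrow> P y) \<Longrightarrow> P x"
  show "P a"
  proof (induction a rule: measure_induct_rule[of bidx_rank])
    case (less x)
    show ?case by (rule *) (use less in \<open>auto simp: less_bidx_def\<close>)
  qed
qed (auto simp: less_eq_bidx_def less_bidx_def inj_eq[OF inj_bidx_rank])

end

definition coord :: "'a::euclidean_space \<Rightarrow> real ^ 'a bidx" where
  "coord v = (\<chi> i. v \<bullet> Rep_bidx i)"

definition uncoord :: "real ^ 'a bidx \<Rightarrow> 'a::euclidean_space" where
  "uncoord w = (\<Sum>i\<in>UNIV. w $ i *\<^sub>R Rep_bidx i)"

lemma bij_Rep_bidx: "bij_betw Rep_bidx (UNIV :: 'a bidx set) (Basis :: 'a::euclidean_space set)"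
  unfolding bij_betw_def
  by (metis Rep_bidx_inject injI type_definition.Rep_range type_definition_bidx)

lemma sum_bidx: "(\<Sum>i\<in>UNIV. f (Rep_bidx i)) = (\<Sum>b\<in>Basis. f b)"
  by (rule sum.reindex_bij_betw[OF bij_Rep_bidx])

lemma prod_bidx: "(\<Prod>i\<in>UNIV. f (Rep_bidx i)) = (\<Prod>b\<in>Basis. f b)"
  by (rule prod.reindex_bij_betw[OF bij_Rep_bidx])

lemma inner_Rep_bidx: "Rep_bidx i \<bullet> Rep_bidx j = (if i = j then 1 else 0)"
  by (metis Rep_bidx Rep_bidx_inject inner_Basis)

lemma uncoord_coord [simp]: "uncoord (coord v) = v"
  unfolding uncoord_def coord_def
  by (simp add: sum_bidx[of "\<lambda>b. (v \<bullet> b) *\<^sub>R b"] euclidean_representation)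

lemma coord_uncoord [simp]: "coord (uncoord w) = w"
  by (simp add: uncoord_def coord_def vec_eq_iff inner_sum_left inner_Rep_bidx if_distrib
      cong: if_cong)

lemma linear_coord: "linear coord"
  by (rule linearI) (auto simp: coord_def vec_eq_iff inner_simps)

lemma linear_uncoord: "linear uncoord"
  by (rule linearI) (auto simp: uncoord_def scaleR_left_distrib sum.distrib scaleR_sum_right)

lemma has_derivative_coord: "(coord has_derivative coord) F"
  using linear_coord linear_conv_bounded_linear bounded_linear_imp_has_derivative by blast

lemma has_derivative_uncoord: "(uncoord has_derivative uncoord) F"
  using linear_uncoord linear_conv_bounded_linear bounded_linear_imp_has_derivative by blast

lemma continuous_coord: "continuous_on S coord"
  using linear_coord linear_continuous_on linear_conv_bounded_linear by blast

lemma continuous_uncoord: "continuous_on S uncoord"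
  using linear_uncoord linear_continuous_on linear_conv_bounded_linear by blast

lemma borel_uncoord [measurable]: "uncoord \<in> borel_measurable borel"
  by (rule borel_measurable_continuous_onI[OF continuous_uncoord])

lemma coord_image: "coord ` S = uncoord -` S"
  by (auto simp: image_iff) (metis coord_uncoord)

lemma coord_image_borel: "S \<in> sets borel \<Longrightarrow> coord ` S \<in> sets borel"
  unfolding coord_image using borel_uncoord by (metis borel_uncoord measurable_sets_borel)

text \<open>
  Boxes correspond to boxes with the same side lengths.
\<close>

lemma distr_lborel_uncoord: "distr lborel borel uncoord = (lborel :: 'a::euclidean_space measure)"
proof (rule lborel_eqI[symmetric])
  fix l u :: 'a
  assume le: "\<And>b. b \<in> Basis \<Longrightarrow> l \<bullet> b \<le> u \<bullet> b"
  have eq: "uncoord -` box l u = box (coord l) (coord u)"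
  proof (rule set_eqI)
    fix w :: "real ^ 'a bidx"
    have *: "(\<forall>b\<in>Basis. P b) \<longleftrightarrow> (\<forall>i. P (Rep_bidx i))" for P :: "'a \<Rightarrow> bool"
      by (metis Abs_bidx_inverse Rep_bidx)
    have "uncoord w \<bullet> Rep_bidx i = w $ i" for i
      using coord_uncoord[of w] by (metis coord_def vec_lambda_beta)
    thus "w \<in> uncoord -` box l u \<longleftrightarrow> w \<in> box (coord l) (coord u)"
      by (simp add: box_def * mem_box_cart coord_def) (auto simp: Basis_vec_def inner_axis)
  qed
  have "emeasure (distr lborel borel uncoord) (box l u) = emeasure lborel (box (coord l) (coord u))"
    by (subst emeasure_distr) (auto simp: eq)
  also have "\<dots> = ennreal (\<Prod>b\<in>Basis. (coord u - coord l) \<bullet> b)"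
    by (rule emeasure_lborel_box) (auto simp: Basis_vec_def inner_axis coord_def le Rep_bidx)
  also have "(\<Prod>b\<in>Basis. (coord u - coord l) \<bullet> b) = (\<Prod>i\<in>UNIV. (coord u - coord l) $ i)"
    by (subst prod.reindex_bij_betw[symmetric, of "\<lambda>i. axis i 1" UNIV])
       (auto simp: bij_betw_def inj_on_def axis_eq_axis Basis_vec_def inner_axis)
  also have "\<dots> = (\<Prod>b\<in>Basis. (u - l) \<bullet> b)"
    by (subst prod_bidx[symmetric]) (simp add: coord_def inner_diff_left)
  finally show "emeasure (distr lborel borel uncoord) (box l u) = ennreal (\<Prod>b\<in>Basis. (u - l) \<bullet> b)" .
qed simp

lemma emeasure_coord_image:
  assumes "S \<in> sets borel"
  shows "emeasure lborel (coord ` S) = emeasure lborel S"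
proof -
  have "emeasure lborel S = emeasure (distr lborel borel uncoord) S"
    by (simp add: distr_lborel_uncoord)
  also have "\<dots> = emeasure lborel (coord ` S)"
    using assms by (subst emeasure_distr) (auto simp: coord_image)
  finally show ?thesis by simp
qed

lemma nn_integral_uncoord:
  assumes "f \<in> borel_measurable borel"
  shows "(\<integral>\<^sup>+ w. f (uncoord w) \<partial>lborel) = (\<integral>\<^sup>+ v. f v \<partial>lborel)"
proof -
  have "(\<integral>\<^sup>+ v. f v \<partial>lborel) = (\<integral>\<^sup>+ v. f v \<partial>(distr lborel borel uncoord))"
    by (simp add: distr_lborel_uncoord)
  also have "\<dots> = (\<integral>\<^sup>+ w. f (uncoord w) \<partial>lborel)"
    using assms by (subst nn_integral_distr) auto
  finally show ?thesis by simp
qed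

definition edet :: "('a::euclidean_space \<Rightarrow> 'a) \<Rightarrow> real" where
  "edet f = det (matrix (\<lambda>w. coord (f (uncoord w))))"

lemma linear_conj_coord:
  assumes "linear f"
  shows "linear (\<lambda>w. coord (f (uncoord w)))"
proof -
  have "linear (coord \<circ> (f \<circ> uncoord))"
    by (intro linear_compose linear_uncoord linear_coord assms)
  thus ?thesis by (simp add: o_def)
qed

lemma edet_compose:
  assumes "linear f" "linear g"
  shows "edet (\<lambda>v. f (g v)) = edet f * edet g"
proof -
  have "matrix (\<lambda>w. coord (f (g (uncoord w)))) =
      matrix (\<lambda>w. coord (f (uncoord w))) ** matrix (\<lambda>w. coord (g (uncoord w)))"
    using matrix_compose[OF linear_conj_coord[OF assms(2)] linear_conj_coord[OF assms(1)]]
    by (simp add: o_def)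
  thus ?thesis by (simp add: edet_def det_mul)
qed

lemma edet_nonzero_iff_inj:
  assumes "linear f"
  shows "edet f \<noteq> 0 \<longleftrightarrow> inj f"
proof -
  have "inj (\<lambda>w. coord (f (uncoord w))) \<longleftrightarrow> inj f"
    unfolding inj_def by (metis coord_uncoord uncoord_coord)
  thus ?thesis using det_nz_iff_inj[OF linear_conj_coord[OF assms]] by (simp add: edet_def)
qed

lemma edet_diagonal:
  assumes "linear f" "\<And>b. b \<in> Basis \<Longrightarrow> f b = c b *\<^sub>R b"
  shows "edet f = (\<Prod>b\<in>Basis. c b)"
proof -
  let ?A = "matrix (\<lambda>w. coord (f (uncoord w)))"
  have u: "uncoord (axis j 1) = Rep_bidx j" for j
    by (simp add: uncoord_def axis_def if_distrib[of "\<lambda>t. t *\<^sub>R _"] cong: if_cong)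
  have A: "?A $ i $ j = (if i = j then c (Rep_bidx j) else 0)" for i j
    using Rep_bidx[of j] by (simp add: matrix_def u assms coord_def inner_Rep_bidx)
  have "det ?A = (\<Prod>i\<in>UNIV. ?A $ i $ i)"
    by (rule det_diagonal) (simp add: A)
  also have "\<dots> = (\<Prod>b\<in>Basis. c b)"
    by (simp add: A prod_bidx)
  finally show ?thesis by (simp add: edet_def)
qed

text \<open>
  Conjugation by the bijection matches the permutations of the two index types and preserves signs.
\<close>

lemma det_reindex:
  fixes A :: "real ^ 'n ^ 'n" and g :: "'m::finite \<Rightarrow> 'n"
  assumes g: "bij g"
  shows "det (\<chi> i j. A $ (g i) $ (g j)) = det A"
proof -
  have bg: "bij_betw g UNIV UNIV" and ig: "inj_on g UNIV" using g by (auto simp: bij_def bij_betw_def)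
  let ?m = "map_permutation UNIV g"
  have ap: "?m p (g i) = g (p i)" for p i
    by (rule map_permutation_apply[OF ig]) simp
  have bij: "bij_betw ?m {p. p permutes UNIV} {p. p permutes UNIV}"
  proof (rule bij_betw_imageI)
    show "inj_on ?m {p. p permutes UNIV}"
    proof (rule inj_onI, rule ext)
      fix p q x assume "?m p = ?m q"
      hence "g (p x) = g (q x)" by (metis ap)
      thus "p x = q x" using ig by (simp add: inj_on_def)
    qed
    have "q \<in> ?m ` {p. p permutes UNIV}" if q: "q permutes UNIV" for q
    proof -
      let ?p = "\<lambda>i. inv g (q (g i))"
      have "bij (inv g \<circ> q \<circ> g)"
        by (intro bij_comp g permutes_bij[OF q] bij_imp_bij_inv)
      hence p: "?p permutes UNIV" by (auto simp: o_def intro: bij_imp_permutes)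
      have "?m ?p = q"
      proof
        fix y
        obtain i where y: "y = g i" using g by (meson bij_pointE)
        show "?m ?p y = q y" unfolding y ap using g by (simp add: bij_is_surj surj_f_inv_f)
      qed
      thus ?thesis using p by (metis (mono_tags, lifting) image_eqI mem_Collect_eq)
    qed
    thus "?m ` {p. p permutes UNIV} = {p. p permutes UNIV}"
      using map_permutation_permutes[OF bg] by auto
  qed
  have "det A = (\<Sum>p | p permutes UNIV. of_int (sign (?m p)) * (\<Prod>i\<in>UNIV. A $ i $ (?m p i)))"
    unfolding det_def by (rule sum.reindex_bij_betw[OF bij, symmetric])
  also have "\<dots> = (\<Sum>p | p permutes UNIV. of_int (sign p) * (\<Prod>i\<in>UNIV. A $ (g i) $ (g (p i))))"
  proof (rule sum.cong[OF refl], clarify)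
    fix p :: "'m \<Rightarrow> 'm" assume "p permutes UNIV"
    hence "sign (?m p) = sign p" by (intro sign_map_permutation ig) auto
    moreover have "(\<Prod>i\<in>UNIV. A $ i $ (?m p i)) = (\<Prod>i\<in>UNIV. A $ (g i) $ (?m p (g i)))"
      by (rule prod.reindex_bij_betw[OF bg, symmetric])
    ultimately show "of_int (sign (?m p)) * (\<Prod>i\<in>UNIV. A $ i $ (?m p i)) =
        of_int (sign p) * (\<Prod>i\<in>UNIV. A $ (g i) $ (g (p i)))"
      by (simp add: ap)
  qed
  also have "\<dots> = det (\<chi> i j. A $ (g i) $ (g j))" by (simp add: det_def)
  finally show ?thesis by simp
qed

text \<open>
  The index types \<open>'n\<close> and \<open>(real ^ 'n) bidx\<close> are in bijection through the axis vectors.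
\<close>

lemma edet_matrix:
  fixes A :: "real ^ 'n ^ 'n"
  shows "edet (\<lambda>v. A *v v) = det A"
proof -
  define g :: "(real ^ 'n) bidx \<Rightarrow> 'n" where "g i = (THE k. Rep_bidx i = axis k 1)" for i
  have g: "Rep_bidx i = axis (g i) 1" for i
  proof -
    obtain k where "Rep_bidx i = axis k (1::real)"
      using Rep_bidx[of i] by (auto simp: Basis_vec_def)
    thus ?thesis unfolding g_def by (metis (mono_tags, lifting) axis_eq_axis the_equality zero_neq_one)
  qed
  have "inj g" by (rule injI) (metis Rep_bidx_inject g)
  moreover have "surj g"
  proof (rule surjI)
    fix k show "g (Abs_bidx (axis k 1)) = k"
    proof -
      have "Rep_bidx (Abs_bidx (axis k (1::real))) = axis k 1"
        by (rule Abs_bidx_inverse) (auto simp: Basis_vec_def)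
      thus ?thesis using g[of "Abs_bidx (axis k 1)"] by (simp add: axis_eq_axis)
    qed
  qed
  ultimately have "bij g" by (simp add: bij_def)
  have u: "uncoord (axis j 1) = Rep_bidx j" for j :: "(real ^ 'n) bidx"
    by (simp add: uncoord_def axis_def if_distrib[of "\<lambda>t. t *\<^sub>R _"] cong: if_cong)
  have "matrix (\<lambda>w. coord (A *v (uncoord w))) = (\<chi> i j. A $ (g i) $ (g j))"
    unfolding matrix_def u unfolding coord_def g
    by (simp add: vec_eq_iff inner_axis matrix_vector_mult_basis column_def)
  thus ?thesis using det_reindex[OF \<open>bij g\<close>, of A] by (simp add: edet_def)
qed

text \<open>
  Compactness makes the image a Borel set even if \<open>f\<close> is singular.
\<close>

lemma emeasure_linear_image:
  fixes f :: "'a::euclidean_space \<Rightarrow> 'a"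
  assumes "linear f" "compact S"
  shows "emeasure lborel (f ` S) = ennreal \<bar>edet f\<bar> * emeasure lborel S"
proof -
  let ?g = "\<lambda>w. coord (f (uncoord w))"
  have cf: "compact (f ` S)"
    using assms by (meson compact_continuous_image linear_continuous_on linear_conv_bounded_linear)
  have cS: "compact (coord ` S)" and cfS: "compact (coord ` f ` S)"
    using assms cf by (auto intro!: compact_continuous_image continuous_coord)
  have eq: "?g ` coord ` S = coord ` f ` S" by (auto simp: image_iff)
  have "measure lebesgue (?g ` coord ` S) = \<bar>edet f\<bar> * measure lebesgue (coord ` S)"
    unfolding edet_def
    by (rule measure_linear_image) (auto intro!: linear_conj_coord assms lmeasurable_compact cS)
  hence m: "measure lborel (coord ` f ` S) = \<bar>edet f\<bar> * measure lborel (coord ` S)"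
    using cS cfS unfolding eq by (simp add: compact_imp_closed borel_closed)
  have e: "emeasure lborel K = ennreal (measure lborel K)" if "compact K" for K :: "(real ^ 'a bidx) set"
  proof (rule emeasure_eq_ennreal_measure)
    show "emeasure lborel K \<noteq> top" using emeasure_compact_finite[OF that] by simp
  qed
  have "emeasure lborel (coord ` f ` S) = ennreal \<bar>edet f\<bar> * emeasure lborel (coord ` S)"
    unfolding e[OF cS] e[OF cfS] m by (simp add: ennreal_mult)
  thus ?thesis
    using cf assms(2) by (simp add: emeasure_coord_image borel_compact)
qed

text \<open>
  Both sides are the volume of the image of the unit cube, which is a product set.
\<close>

lemma edet_prod_scale:
  fixes f :: "'a::euclidean_space \<Rightarrow> 'a" and c :: real
  assumes "linear f"
  shows "\<bar>edet (\<lambda>X. (f (fst X), c * snd X))\<bar> = \<bar>edet f\<bar> * \<bar>c\<bar>"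
proof -
  let ?F = "\<lambda>X. (f (fst X), c * snd X)"
  have lF: "linear ?F"
    by (rule linearI) (auto simp: linear_add[OF assms] linear_scale[OF assms] algebra_simps)
  have lc: "linear (\<lambda>t. c * t)" by (rule linearI) (auto simp: algebra_simps)
  let ?K = "cbox 0 One :: 'a set"
  have K1: "emeasure lborel ?K = 1" by (subst emeasure_lborel_cbox) auto
  have cK: "compact (f ` ?K)"
    using assms by (meson compact_cbox compact_continuous_image linear_continuous_on linear_conv_bounded_linear)
  have cI: "compact ((\<lambda>t. c * t) ` {0..1::real})"
    by (intro compact_continuous_image continuous_intros) auto
  have I: "emeasure lborel ((\<lambda>t. c * t) ` {0..1::real}) = ennreal \<bar>c\<bar>"
    by (subst emeasure_linear_image[OF lc]) (auto simp: edet_diagonal[OF lc, of "\<lambda>_. c"])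
  have "?F ` (?K \<times> {0..1}) = f ` ?K \<times> (\<lambda>t. c * t) ` {0..1}"
    by (force simp: image_iff)
  moreover have "emeasure lborel (?F ` (?K \<times> {0..1})) = ennreal \<bar>edet ?F\<bar> * emeasure lborel (?K \<times> {0..1::real})"
    by (rule emeasure_linear_image[OF lF]) (auto intro: compact_Times)
  moreover have "emeasure lborel (?K \<times> {0..1::real}) = 1"
    by (simp add: lborel_prod[symmetric] lborel.emeasure_pair_measure_Times K1)
  moreover have "emeasure lborel (f ` ?K \<times> (\<lambda>t. c * t) ` {0..1::real}) = ennreal \<bar>edet f\<bar> * ennreal \<bar>c\<bar>"
    using cK cI
    by (simp add: lborel_prod[symmetric] lborel.emeasure_pair_measure_Times borel_compact I
        emeasure_linear_image[OF assms] K1)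
  ultimately show ?thesis by (simp flip: ennreal_mult)
qed

lemma has_derivative_conj_coord:
  assumes "(f has_derivative f') (at (uncoord w))"
  shows "((\<lambda>w. coord (f (uncoord w))) has_derivative (\<lambda>v. coord (f' (uncoord v)))) (at w within S)"
proof -
  have "((\<lambda>w. f (uncoord w)) has_derivative (\<lambda>v. f' (uncoord v))) (at w)"
    using has_derivative_compose[OF has_derivative_uncoord assms] .
  from has_derivative_compose[OF this has_derivative_coord]
  show ?thesis by (rule has_derivative_at_withinI)
qed

lemma has_integral_uncoord:
  assumes S: "S \<in> sets borel" and d: "d \<in> borel_measurable borel" "\<And>x. 0 \<le> d x"
    and r: "(\<integral>\<^sup>+ x. ennreal (d x) * indicator S x \<partial>lborel) = ennreal r" "0 \<le> r"
  shows "((\<lambda>w. d (uncoord w)) has_integral r) (coord ` S)"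
proof -
  let ?d = "\<lambda>w. d (uncoord w)"
  have "((\<lambda>w. ?d w * indicator (coord ` S) w) has_integral r) UNIV"
  proof (rule nn_integral_has_integral)
    show "(\<lambda>w. ?d w * indicator (coord ` S) w) \<in> borel_measurable borel"
      using coord_image_borel[OF S] d(1) by measurable
    have "(\<integral>\<^sup>+ w. ennreal (?d w * indicator (coord ` S) w) \<partial>lborel)
        = (\<integral>\<^sup>+ w. ennreal (d (uncoord w)) * indicator S (uncoord w) \<partial>lborel)"
      by (intro nn_integral_cong) (auto simp: coord_image indicator_def)
    also have "\<dots> = (\<integral>\<^sup>+ x. ennreal (d x) * indicator S x \<partial>lborel)"
      using S d(1) by (subst nn_integral_uncoord) auto
    finally show "(\<integral>\<^sup>+ w. ennreal (?d w * indicator (coord ` S) w) \<partial>lborel) = ennreal r"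
      by (simp add: r)
  qed (use d r in auto)
  moreover have "(\<lambda>w. ?d w * indicator (coord ` S) w) = (\<lambda>w. if w \<in> coord ` S then ?d w else 0)"
    by (auto simp: indicator_def)
  ultimately show ?thesis
    by (simp only: has_integral_restrict_UNIV)
qed

lemma emeasure_eq_lmeasure: "S \<in> lmeasurable \<Longrightarrow> emeasure lebesgue S = ennreal (measure lebesgue S)"
  by (rule emeasure_eq_ennreal_measure[OF fmeasurableD2])

text \<open>
  The area formula without injectivity, in a form that avoids the measurability of the image: only the
  subset \<open>P\<close> has to be Borel.
\<close>

lemma area_inequality:
  fixes f :: "'a::euclidean_space \<Rightarrow> 'a"
  assumes S: "S \<in> sets borel"
    and der: "\<And>x. x \<in> S \<Longrightarrow> (f has_derivative f' x) (at x)"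
    and P: "P \<in> sets borel" "P \<subseteq> f ` S"
    and d: "d \<in> borel_measurable borel" "\<And>x. 0 \<le> d x"
      "\<And>x. x \<in> S \<Longrightarrow> \<bar>edet (f' x)\<bar> \<le> d x"
  shows "emeasure lborel P \<le> (\<integral>\<^sup>+ x. ennreal (d x) * indicator S x \<partial>lborel)"
proof (cases "(\<integral>\<^sup>+ x. ennreal (d x) * indicator S x \<partial>lborel) = \<infinity>")
  case False
  let ?g = "\<lambda>w. coord (f (uncoord w))" and ?g' = "\<lambda>w v. coord (f' (uncoord w) (uncoord v))"
  define r where "r = enn2real (\<integral>\<^sup>+ x. ennreal (d x) * indicator S x \<partial>lborel)"
  have r: "(\<integral>\<^sup>+ x. ennreal (d x) * indicator S x \<partial>lborel) = ennreal r" "0 \<le> r"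
    using False by (auto simp: r_def less_top)
  have cS: "coord ` S \<in> sets borel" by (rule coord_image_borel[OF S])
  have der': "(?g has_derivative ?g' w) (at w within coord ` S)" if "w \<in> coord ` S" for w
    using that der by (intro has_derivative_conj_coord) auto
  have int_d: "((\<lambda>w. d (uncoord w)) has_integral r) (coord ` S)"
    by (rule has_integral_uncoord[OF S d(1,2) r])
  have edet_le: "\<bar>det (matrix (?g' w))\<bar> \<le> d (uncoord w)" if "w \<in> coord ` S" for w
    using d(3)[of "uncoord w"] that by (auto simp: edet_def)
  have int: "(\<lambda>w. \<bar>det (matrix (?g' w))\<bar>) integrable_on coord ` S"
  proof (rule measurable_bounded_by_integrable_imp_integrable)
    show "(\<lambda>w. \<bar>det (matrix (?g' w))\<bar>) \<in> borel_measurable (lebesgue_on (coord ` S))"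
      using borel_measurable_det_Jacobian[OF _ der'] cS by (intro borel_measurable_abs) auto
    show "(\<lambda>w. d (uncoord w)) integrable_on coord ` S" using int_d by blast
    show "coord ` S \<in> sets lebesgue" using cS by auto
  qed (use edet_le in auto)
  have *: "?g ` coord ` S \<in> lmeasurable"
    "measure lebesgue (?g ` coord ` S) \<le> integral (coord ` S) (\<lambda>w. \<bar>det (matrix (?g' w))\<bar>)"
    using measurable_differentiable_image[OF _ der' int] measure_differentiable_image[OF _ der' int] cS
    by auto
  have "integral (coord ` S) (\<lambda>w. \<bar>det (matrix (?g' w))\<bar>) \<le> r"
    using int int_d edet_le by (metis (no_types, lifting) has_integral_integrable_integral integral_le)
  with * have m: "measure lebesgue (?g ` coord ` S) \<le> r" by linarith
  have "emeasure lborel P = emeasure lborel (coord ` P)"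
    using P by (simp add: emeasure_coord_image)
  also have "\<dots> = emeasure lebesgue (coord ` P)"
    using coord_image_borel[OF P(1)] by simp
  also have "\<dots> \<le> emeasure lebesgue (?g ` coord ` S)"
    using P *(1) by (intro emeasure_mono) (auto intro!: imageI simp: fmeasurableD image_image)
  also have "\<dots> = ennreal (measure lebesgue (?g ` coord ` S))"
    by (rule emeasure_eq_lmeasure[OF *(1)])
  also have "\<dots> \<le> ennreal r" using m by (rule ennreal_leI)
  finally show ?thesis by (simp add: r)
qed simp

lemma area_formula_injective:
  fixes f :: "'a::euclidean_space \<Rightarrow> 'a"
  assumes S: "S \<in> sets borel"
    and der: "\<And>x. x \<in> S \<Longrightarrow> (f has_derivative f' x) (at x)"
    and inj: "inj_on f S"
    and P: "P \<in> sets borel" "f ` S \<subseteq> P"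
    and d: "d \<in> borel_measurable borel" "\<And>x. 0 \<le> d x"
      "\<And>x. x \<in> S \<Longrightarrow> \<bar>edet (f' x)\<bar> = d x"
    and fin: "(\<integral>\<^sup>+ x. ennreal (d x) * indicator S x \<partial>lborel) < \<infinity>"
  shows "(\<integral>\<^sup>+ x. ennreal (d x) * indicator S x \<partial>lborel) \<le> emeasure lborel P"
proof -
  let ?g = "\<lambda>w. coord (f (uncoord w))" and ?g' = "\<lambda>w v. coord (f' (uncoord w) (uncoord v))"
  define r where "r = enn2real (\<integral>\<^sup>+ x. ennreal (d x) * indicator S x \<partial>lborel)"
  have r: "(\<integral>\<^sup>+ x. ennreal (d x) * indicator S x \<partial>lborel) = ennreal r" "0 \<le> r"
    using fin by (auto simp: r_def less_top)
  have cS: "coord ` S \<in> sets borel" by (rule coord_image_borel[OF S])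
  have der': "(?g has_derivative ?g' w) (at w within coord ` S)" if "w \<in> coord ` S" for w
    using that der by (intro has_derivative_conj_coord) auto
  have int_d: "((\<lambda>w. d (uncoord w)) has_integral r) (coord ` S)"
    by (rule has_integral_uncoord[OF S d(1,2) r])
  have inj': "inj_on ?g (coord ` S)"
  proof (rule inj_onI)
    fix v w assume *: "v \<in> coord ` S" "w \<in> coord ` S" "?g v = ?g w"
    then obtain x y where xy: "x \<in> S" "y \<in> S" "v = coord x" "w = coord y" by blast
    have "uncoord (coord (f x)) = uncoord (coord (f y))" using *(3) xy by simp
    thus "v = w" using inj xy by (auto dest: inj_onD)
  qed
  have "((\<lambda>w. \<bar>det (matrix (?g' w))\<bar>) has_integral r) (coord ` S)"
    using int_d by (rule has_integral_eq[rotated]) (use d(3) in \<open>auto simp: edet_def\<close>)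
  hence *: "?g ` coord ` S \<in> lmeasurable" "measure lebesgue (?g ` coord ` S) = r"
    using has_measure_differentiable_image[OF _ der' inj'] cS by auto
  have "ennreal r = emeasure lebesgue (?g ` coord ` S)"
    by (simp only: emeasure_eq_lmeasure[OF *(1)] *(2))
  also have "\<dots> \<le> emeasure lebesgue (coord ` P)"
    using P coord_image_borel[OF P(1)] by (intro emeasure_mono) auto
  also have "\<dots> = emeasure lborel P"
    using P coord_image_borel[OF P(1)] by (simp add: emeasure_coord_image)
  finally show ?thesis by (simp add: r)
qed

section \<open>A determinant inequality under a trace condition\<close>

text \<open>
  First-order condition at a maximum of a quadratic polynomial.
\<close>

lemma linear_coefficient_zero:
  fixes B C :: real
  assumes "\<And>t. 2 * t * B + t\<^sup>2 * C \<le> 0"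
  shows "B = 0"
proof (rule ccontr)
  assume "B \<noteq> 0"
  define D where "D = \<bar>C\<bar> + 1"
  have D: "0 < D" "C \<le> D" "- D < C" by (auto simp: D_def)
  \<comment> \<open>\<open>t = B / D\<close> with \<open>D > \<bar>C\<bar>\<close> makes the linear term dominate.\<close>
  have "2 * (B / D) * B + (B / D)\<^sup>2 * C = B\<^sup>2 / D * (2 + C / D)"
    using D by (simp add: power2_eq_square field_simps)
  moreover have "0 < 2 + C / D" using D by (simp add: field_simps)
  moreover have "0 < B\<^sup>2 / D" using D \<open>B \<noteq> 0\<close> by simp
  ultimately show False using assms[of "B / D"] by (metis mult_pos_pos not_less)
qed

text \<open>
  The Rayleigh quotient of \<open>M\<close> with respect to \<open>H\<close> attains its maximum on the \<open>H\<close>-orthogonal complement of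
  the eigenvectors found so far, and a maximizer is a further eigenvector.
\<close>

lemma simultaneous_diagonalization:
  fixes H M :: "'a::euclidean_space \<Rightarrow> 'a"
  assumes H: "linear H" "\<And>u v. H u \<bullet> v = u \<bullet> H v" "\<And>v. v \<noteq> 0 \<Longrightarrow> 0 < v \<bullet> H v"
    and M: "linear M" "\<And>u v. M u \<bullet> v = u \<bullet> M v"
    and k: "k \<le> DIM('a)"
  shows "\<exists>B. finite B \<and> card B = k \<and>
      (\<forall>b\<in>B. \<forall>b'\<in>B. b \<bullet> H b' = (if b = b' then 1 else 0)) \<and>
      (\<forall>b\<in>B. \<exists>l. M b = l *\<^sub>R H b)"
  using k
proof (induction k)
  case 0
  show ?case by (intro exI[of _ "{}"]) auto
next
  case (Suc k)
  then obtain B where B: "finite B" "card B = k"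
    "\<And>b b'. b \<in> B \<Longrightarrow> b' \<in> B \<Longrightarrow> b \<bullet> H b' = (if b = b' then 1 else 0)"
    "\<And>b. b \<in> B \<Longrightarrow> \<exists>l. M b = l *\<^sub>R H b"
    by auto
  have cont: "continuous_on X H" "continuous_on X M" for X
    using H(1) M(1) by (simp_all add: linear_continuous_on linear_conv_bounded_linear)
  define V where "V = {v. \<forall>b\<in>B. v \<bullet> H b = 0}"
  have V_lin: "a *\<^sub>R v + c *\<^sub>R w \<in> V" if "v \<in> V" "w \<in> V" for a c v w
    using that by (auto simp: V_def inner_simps)
  have "dim (H ` B) < DIM('a)"
    using dim_le_card'[of "H ` B"] card_image_le[OF B(1), of H] B Suc.prems by simp
  then obtain x where x: "x \<noteq> 0" "\<And>y. y \<in> span (H ` B) \<Longrightarrow> orthogonal x y"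
    using orthogonal_to_subspace_exists by blast
  hence xV: "x \<in> V" by (auto simp: V_def orthogonal_def span_base)
  define K where "K = {v \<in> V. norm v = 1}"
  have cl: "closed V"
  proof -
    have "V = (\<Inter>b\<in>B. {v. v \<bullet> H b = 0})" by (auto simp: V_def)
    thus ?thesis by (auto intro!: closed_INT closed_Collect_eq continuous_intros)
  qed
  have "compact K"
  proof -
    have "K = V \<inter> sphere 0 1" by (auto simp: K_def)
    thus ?thesis using cl by (simp add: closed_Int_compact)
  qed
  moreover have "(1 / norm x) *\<^sub>R x \<in> K"
    using x V_lin[OF xV xV, of "1 / norm x" 0] by (auto simp: K_def)
  moreover have "continuous_on K (\<lambda>v. (v \<bullet> M v) / (v \<bullet> H v))"
    using H(3) by (intro continuous_intros cont) (auto simp: K_def, metis norm_zero zero_neq_one less_irrefl)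
  ultimately obtain v0 where v0: "v0 \<in> K" "\<And>v. v \<in> K \<Longrightarrow> (v \<bullet> M v) / (v \<bullet> H v) \<le> (v0 \<bullet> M v0) / (v0 \<bullet> H v0)"
    using continuous_attains_sup[of K] by blast
  define l where "l = (v0 \<bullet> M v0) / (v0 \<bullet> H v0)"
  have v0': "v0 \<noteq> 0" "v0 \<in> V" using v0(1) by (auto simp: K_def)
  have max: "v \<bullet> M v \<le> l * (v \<bullet> H v)" if "v \<in> V" for v
  proof (cases "v = 0")
    case False
    define w where "w = (1 / norm v) *\<^sub>R v"
    have "w \<in> K" using that False V_lin[of v v "1 / norm v" 0] by (simp add: K_def w_def)
    hence "(w \<bullet> M w) / (w \<bullet> H w) \<le> l" using v0(2) by (simp add: l_def)
    moreover have "(w \<bullet> M w) / (w \<bullet> H w) = (v \<bullet> M v) / (v \<bullet> H v)"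
      using False H(1) M(1) by (simp add: w_def linear_scale)
    ultimately show ?thesis using H(3)[OF False] by (simp add: field_simps)
  qed (simp add: linear_0[OF M(1)] linear_0[OF H(1)])
  \<comment> \<open>\<open>E\<close> is nonpositive on \<open>V\<close> and vanishes at \<open>v0\<close>, so its first variation there vanishes.\<close>
  have eqV: "w \<bullet> (M v0 - l *\<^sub>R H v0) = 0" if w: "w \<in> V" for w
  proof -
    define E where "E = (\<lambda>v. v \<bullet> M v - l * (v \<bullet> H v))"
    have "E v0 = 0" using H(3)[OF v0'(1)] by (simp add: E_def l_def)
    have "2 * t * (w \<bullet> (M v0 - l *\<^sub>R H v0)) + t\<^sup>2 * E w \<le> 0" for t
    proof -
      have "E (v0 + t *\<^sub>R w) \<le> 0"
        using max[of "v0 + t *\<^sub>R w"] V_lin[OF v0'(2) w, of 1 t] by (simp add: E_def)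
      moreover have "M w \<bullet> v0 = w \<bullet> M v0" "H w \<bullet> v0 = w \<bullet> H v0" using H(2) M(2) by auto
      ultimately show ?thesis using \<open>E v0 = 0\<close>
        by (simp add: E_def linear_add[OF H(1)] linear_add[OF M(1)] linear_scale[OF H(1)]
            linear_scale[OF M(1)] inner_simps inner_commute algebra_simps power2_eq_square)
    qed
    thus ?thesis by (rule linear_coefficient_zero)
  qed
  have eqB: "b \<bullet> (M v0 - l *\<^sub>R H v0) = 0" if b: "b \<in> B" for b
  proof -
    obtain m where m: "M b = m *\<^sub>R H b" using B(4)[OF b] by blast
    have "v0 \<bullet> H b = 0" using v0'(2) b by (simp add: V_def)
    moreover have "b \<bullet> M v0 = v0 \<bullet> M b" "b \<bullet> H v0 = v0 \<bullet> H b" using H(2) M(2) by (metis inner_commute)+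
    ultimately show ?thesis by (simp add: inner_simps m)
  qed
  have "w \<bullet> (M v0 - l *\<^sub>R H v0) = 0" for w
  proof -
    define p where "p = (\<Sum>b\<in>B. (w \<bullet> H b) *\<^sub>R b)"
    have "w - p \<in> V"
      unfolding V_def p_def
      by (auto simp: inner_simps inner_sum_left B(1,3) if_distrib cong: if_cong)
    hence "(w - p) \<bullet> (M v0 - l *\<^sub>R H v0) = 0" by (rule eqV)
    moreover have "p \<bullet> (M v0 - l *\<^sub>R H v0) = 0"
      by (simp add: p_def inner_sum_left eqB)
    ultimately show ?thesis by (simp add: inner_diff_left)
  qed
  hence ev: "M v0 = l *\<^sub>R H v0" by (metis eq_iff_diff_eq_0 inner_eq_zero_iff)
  define q where "q = sqrt (v0 \<bullet> H v0)"
  have q: "0 < q" "q * q = v0 \<bullet> H v0" using H(3)[OF v0'(1)] by (auto simp: q_def)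
  define b0 where "b0 = (1 / q) *\<^sub>R v0"
  have b0: "b0 \<bullet> H b0 = 1" "M b0 = l *\<^sub>R H b0" "b0 \<in> V"
    using q ev V_lin[OF v0'(2) v0'(2), of "1 / q" 0]
    by (auto simp: b0_def linear_scale[OF H(1)] linear_scale[OF M(1)] field_simps)
  have orth: "b0 \<bullet> H b = 0" "b \<bullet> H b0 = 0" if "b \<in> B" for b
    using b0(3) that H(2)[of b b0] by (auto simp: V_def inner_commute)
  have "b0 \<notin> B" using orth b0(1) by force
  show ?case
    using B b0 orth \<open>b0 \<notin> B\<close>
    by (intro exI[of _ "insert b0 B"]) auto
qed

definition etrace :: "('a::euclidean_space \<Rightarrow> 'a) \<Rightarrow> real" where
  "etrace f = (\<Sum>b\<in>Basis. f b \<bullet> b)"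

text \<open>
  In a basis that diagonalizes \<open>H\<close> and \<open>D\<close> simultaneously, with generalized eigenvalues \<open>l\<close> of \<open>D\<close>, the
  quotient of the determinants is the product of the numbers \<open>1 + l \<ge> 0\<close>, and the trace is the sum of the
  \<open>l\<close>. The claim follows from \<open>1 + l \<le> exp l\<close>.
\<close>

lemma edet_le_edet_if_trace_nonpos:
  fixes H D :: "'a::euclidean_space \<Rightarrow> 'a"
  assumes H: "linear H" "\<And>u v. H u \<bullet> v = u \<bullet> H v" "\<And>v. v \<noteq> 0 \<Longrightarrow> 0 < v \<bullet> H v"
    and D: "linear D" "\<And>u v. D u \<bullet> v = u \<bullet> D v"
    and psd: "\<And>v. 0 \<le> v \<bullet> (H v + D v)"
    and G: "linear G" "\<And>v. G (H v) = v"
    and tr: "etrace (\<lambda>v. G (D v)) \<le> 0"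
  shows "\<bar>edet (\<lambda>v. H v + D v)\<bar> \<le> \<bar>edet H\<bar>"
proof -
  obtain B where B: "finite B" "card B = DIM('a)"
    "\<And>b b'. b \<in> B \<Longrightarrow> b' \<in> B \<Longrightarrow> b \<bullet> H b' = (if b = b' then 1 else 0)"
    "\<forall>b\<in>B. \<exists>l. D b = l *\<^sub>R H b"
    using simultaneous_diagonalization[OF H D order_refl] by blast
  obtain l where l: "\<And>b. b \<in> B \<Longrightarrow> D b = l b *\<^sub>R H b" using B(4) by metis
  have l_ge: "- 1 \<le> l b" if "b \<in> B" for b
    using psd[of b] that B(3)[OF that that] by (simp add: l inner_simps)
  have expand: "v = (\<Sum>b\<in>B. (v \<bullet> H b) *\<^sub>R b)" for v
  proof -
    have "independent B"
    proof (rule ccontr)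
      assume "\<not> independent B"
      then obtain c where c: "(\<Sum>b\<in>B. c b *\<^sub>R b) = 0" "\<exists>b\<in>B. c b \<noteq> 0"
        using dependent_finite[OF B(1)] by blast
      then obtain b where b: "b \<in> B" "c b \<noteq> 0" by blast
      have "(\<Sum>b\<in>B. c b *\<^sub>R b) \<bullet> H b = c b"
        using b by (simp add: inner_sum_left B(1,3) if_distrib cong: if_cong)
      thus False using b c by simp
    qed
    hence "span B = UNIV"
      using B by (metis card_eq_dim dim_UNIV dim_eq_full dim_span indep_card_eq_dim_span)
    hence "v \<in> span B" by simp
    then obtain c where c: "v = (\<Sum>b\<in>B. c b *\<^sub>R b)" using span_finite[OF B(1)] by auto
    have "v \<bullet> H b = c b" if "b \<in> B" for b
      using that by (simp add: c inner_sum_left B(1,3) if_distrib cong: if_cong)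
    thus ?thesis using c by simp
  qed
  \<comment> \<open>The trace is invariant: the vectors \<open>H b\<close> form the basis dual to \<open>B\<close>.\<close>
  have tr_eq: "etrace (\<lambda>v. G (D v)) = (\<Sum>b\<in>B. l b)"
  proof -
    have GD: "G (D b) = l b *\<^sub>R b" if "b \<in> B" for b
      using that by (simp add: l linear_scale[OF G(1)] G(2))
    have "G (D e) \<bullet> e = (\<Sum>b\<in>B. l b * ((e \<bullet> H b) * (b \<bullet> e)))" for e
    proof -
      have "G (D e) = G (D (\<Sum>b\<in>B. (e \<bullet> H b) *\<^sub>R b))" using expand[of e] by simp
      also have "\<dots> = (\<Sum>b\<in>B. (e \<bullet> H b) *\<^sub>R G (D b))"
        by (simp add: linear_sum[OF D(1)] linear_sum[OF G(1)] linear_scale[OF D(1)] linear_scale[OF G(1)])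
      finally show ?thesis by (simp add: GD inner_sum_left mult_ac)
    qed
    hence "etrace (\<lambda>v. G (D v)) = (\<Sum>e\<in>Basis. \<Sum>b\<in>B. l b * ((e \<bullet> H b) * (b \<bullet> e)))"
      by (simp add: etrace_def)
    also have "\<dots> = (\<Sum>b\<in>B. l b * (\<Sum>e\<in>Basis. (b \<bullet> e) * (H b \<bullet> e)))"
      by (subst sum.swap) (simp add: sum_distrib_left inner_commute mult_ac)
    also have "\<dots> = (\<Sum>b\<in>B. l b)"
      by (simp add: euclidean_inner[symmetric] B(3))
    finally show ?thesis .
  qed
  obtain \<beta> where \<beta>: "bij_betw \<beta> (Basis :: 'a set) B"
    using B finite_same_card_bij by (metis finite_Basis)
  define P where "P v = (\<Sum>e\<in>Basis. (v \<bullet> e) *\<^sub>R \<beta> e)" for v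
  have linP: "linear P"
    by (rule linearI) (auto simp: P_def inner_simps scaleR_left_distrib sum.distrib scaleR_sum_right)
  have P_Basis: "P e = \<beta> e" if "e \<in> Basis" for e
    using that by (simp add: P_def inner_Basis if_distrib[of "\<lambda>t. t *\<^sub>R _"] cong: if_cong)
  have "surj P"
  proof (rule surjI)
    fix v
    show "P (\<Sum>e\<in>Basis. (v \<bullet> H (\<beta> e)) *\<^sub>R e) = v"
      using expand[of v] sum.reindex_bij_betw[OF \<beta>, of "\<lambda>b. (v \<bullet> H b) *\<^sub>R b"]
      by (simp add: linear_sum[OF linP] linear_scale[OF linP] P_Basis)
  qed
  hence "inj P" using linP by (simp add: linear_surjective_imp_injective)
  hence edetP: "edet P \<noteq> 0" using edet_nonzero_iff_inj[OF linP] by simp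
  define N where "N v = (\<Sum>e\<in>Basis. ((1 + l (\<beta> e)) * (v \<bullet> e)) *\<^sub>R e)" for v
  have linN: "linear N"
    by (rule linearI) (auto simp: N_def inner_simps algebra_simps sum.distrib scaleR_sum_right)
  have N_Basis: "N e = (1 + l (\<beta> e)) *\<^sub>R e" if "e \<in> Basis" for e
    using that by (simp add: N_def inner_Basis if_distrib[of "\<lambda>t. (_ * t) *\<^sub>R _"] cong: if_cong)
  have linM: "linear (\<lambda>v. H v + D v)" using H(1) D(1) by (rule linear_compose_add)
  have linHP: "linear (\<lambda>v. H (P v))" using linear_compose[OF linP H(1)] by (simp add: o_def)
  \<comment> \<open>\<open>P\<close> maps the standard basis to the eigenvectors, and \<open>N\<close> is the diagonal map with entries \<open>1 + l\<close>.\<close>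
  have "(\<lambda>v. H (P v) + D (P v)) = (\<lambda>v. H (P (N v)))"
  proof
    fix v
    have L: "linear (\<lambda>v. H (P v) + D (P v))" using linear_compose[OF linP linM] by (simp add: o_def)
    have R: "linear (\<lambda>v. H (P (N v)))" using linear_compose[OF linN linHP] by (simp add: o_def)
    show "H (P v) + D (P v) = H (P (N v))"
    proof (rule linear_eq_stdbasis[OF L R, THEN fun_cong])
      fix e :: 'a assume e: "e \<in> Basis"
      hence "\<beta> e \<in> B" using \<beta> by (auto simp: bij_betw_def)
      thus "H (P e) + D (P e) = H (P (N e))"
        using e by (simp only: P_Basis N_Basis l linear_scale[OF linP] linear_scale[OF H(1)])
          (simp add: scaleR_left_distrib)
    qed
  qed
  hence "edet (\<lambda>v. H v + D v) * edet P = edet H * edet P * edet N"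
    using edet_compose[OF linM linP] edet_compose[OF linHP linN] edet_compose[OF H(1) linP] by auto
  hence eq: "edet (\<lambda>v. H v + D v) = edet H * edet N" using edetP by auto
  have "edet N = (\<Prod>e\<in>Basis. 1 + l (\<beta> e))" by (rule edet_diagonal[OF linN N_Basis])
  also have "\<dots> = (\<Prod>b\<in>B. 1 + l b)" by (rule prod.reindex_bij_betw[OF \<beta>])
  finally have N: "edet N = (\<Prod>b\<in>B. 1 + l b)" .
  have "0 \<le> edet N" unfolding N using l_ge by (intro prod_nonneg) force
  moreover have "edet N \<le> (\<Prod>b\<in>B. exp (l b))"
    unfolding N using l_ge by (intro prod_mono) force
  moreover have "(\<Prod>b\<in>B. exp (l b)) \<le> 1"
    using tr by (simp add: tr_eq exp_sum[OF B(1), symmetric])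
  ultimately have "\<bar>edet N\<bar> \<le> 1" by linarith
  thus ?thesis unfolding eq abs_mult by (simp add: mult_left_le)
qed

section \<open>Gradients and Hessians of C2 functions\<close>

abbreviation fderiv :: "('a::real_normed_vector \<Rightarrow> real) \<Rightarrow> 'a \<Rightarrow> 'a \<Rightarrow> real" where
  "fderiv f v x \<equiv> frechet_derivative f (at x) v"

lemma Ck_on_imp_continuous_on: "Ck_on k S f \<Longrightarrow> continuous_on S f"
  by (cases k) (auto intro!: differentiable_imp_continuous_on differentiable_at_imp_differentiable_on)

lemma Ck_on_SucD: "Ck_on (Suc k) S f \<Longrightarrow> Ck_on k S f"
proof (induction k arbitrary: f)
  case 0
  thus ?case using Ck_on_imp_continuous_on[of "Suc 0"] by simp
qed auto

lemma grad_eqI: "GDERIV f x :> D \<Longrightarrow> grad f x = D"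
proof -
  assume D: "GDERIV f x :> D"
  have "E = D" if E: "GDERIV f x :> E" for E
  proof -
    have "(\<lambda>h. h \<bullet> E) = (\<lambda>h. h \<bullet> D)"
      using D E unfolding gderiv_def by (rule has_derivative_unique[rotated])
    from fun_cong[OF this, of "E - D"] have *: "(E - D) \<bullet> E = (E - D) \<bullet> D" .
    have "(E - D) \<bullet> (E - D) = (E - D) \<bullet> E - (E - D) \<bullet> D" by (rule inner_diff_right)
    also have "\<dots> = 0" using * by (rule right_minus_eq[THEN iffD2])
    finally show ?thesis by (simp only: inner_eq_zero_iff right_minus_eq)
  qed
  thus ?thesis unfolding grad_def by (rule the_equality[of "\<lambda>D. GDERIV f x :> D", OF D])
qed

lemma has_derivative_grad:
  fixes f :: "'a::euclidean_space \<Rightarrow> real"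
  assumes "f differentiable (at x)"
  shows "(f has_derivative (\<lambda>v. grad f x \<bullet> v)) (at x)"
    and "fderiv f v x = grad f x \<bullet> v"
    and "grad f x = (\<Sum>b\<in>Basis. fderiv f b x *\<^sub>R b)"
proof -
  define g where "g = (\<Sum>b\<in>Basis. fderiv f b x *\<^sub>R b)"
  have d: "(f has_derivative frechet_derivative f (at x)) (at x)"
    using assms frechet_derivative_works by blast
  hence lin: "linear (frechet_derivative f (at x))" by (rule has_derivative_linear)
  have eq: "frechet_derivative f (at x) = (\<lambda>v. v \<bullet> g)"
  proof (rule linear_eq_stdbasis[OF lin])
    show "linear (\<lambda>v. v \<bullet> g)" by (simp add: bounded_linear.linear bounded_linear_inner_left)
  qed (simp add: g_def inner_sum_right inner_Basis if_distrib cong: if_cong)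
  have "GDERIV f x :> g" using d unfolding gderiv_def eq .
  from grad_eqI[OF this] have *: "grad f x = g" .
  thus "grad f x = (\<Sum>b\<in>Basis. fderiv f b x *\<^sub>R b)" by (simp only: g_def)
  show "fderiv f v x = grad f x \<bullet> v" unfolding * eq by (rule inner_commute)
  show "(f has_derivative (\<lambda>v. grad f x \<bullet> v)) (at x)"
    using d unfolding * eq by (simp add: inner_commute)
qed

text \<open>
  The second derivative as an endomorphism, the derivative of \<open>grad f\<close>; the matrix \<open>hess f x\<close> represents it
  when the space is \<open>real ^ 'n\<close>.
\<close>

definition D2 :: "('a::euclidean_space \<Rightarrow> real) \<Rightarrow> 'a \<Rightarrow> 'a \<Rightarrow> 'a" where
  "D2 f x v = (\<Sum>b\<in>Basis. fderiv (fderiv f b) v x *\<^sub>R b)"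

lemma has_derivative_grad_D2:
  fixes f :: "'a::euclidean_space \<Rightarrow> real"
  assumes f: "Ck_on 2 S f" "open S" "x \<in> S"
  shows "(grad f has_derivative D2 f x) (at x)"
proof -
  have "((\<lambda>y. \<Sum>b\<in>Basis. fderiv f b y *\<^sub>R b) has_derivative D2 f x) (at x)"
    unfolding D2_def
  proof (intro has_derivative_sum has_derivative_scaleR_left)
    fix b :: 'a
    have "fderiv f b differentiable at x" using f by (auto simp: numeral_2_eq_2)
    thus "(fderiv f b has_derivative (\<lambda>v. fderiv (fderiv f b) v x)) (at x)"
      using frechet_derivative_works by blast
  qed
  thus ?thesis
    by (rule has_derivative_transform_within_open[OF _ f(2,3)])
       (use f in \<open>simp add: numeral_2_eq_2 has_derivative_grad(3)\<close>)
qed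

lemma linear_D2: "Ck_on 2 S f \<Longrightarrow> open S \<Longrightarrow> x \<in> S \<Longrightarrow> linear (D2 f x)"
  using has_derivative_grad_D2 has_derivative_linear by blast

lemma continuous_on_D2:
  fixes f :: "'a::euclidean_space \<Rightarrow> real"
  assumes f: "Ck_on 2 S f"
  shows "continuous_on S (\<lambda>x. D2 f x v)"
  unfolding D2_def
  using f by (intro continuous_intros) (auto simp: numeral_2_eq_2 intro: Ck_on_imp_continuous_on)

text \<open>
  The mean value theorem is applied along \<open>u\<close> to the first difference along \<open>v\<close>, and then along \<open>v\<close>.
\<close>

lemma second_difference_mvt:
  fixes f :: "'a::euclidean_space \<Rightarrow> real"
  assumes f: "Ck_on 2 S f" "open S"
    and ball: "\<And>a b. \<bar>a\<bar> \<le> t \<Longrightarrow> \<bar>b\<bar> \<le> t \<Longrightarrow> x + a *\<^sub>R u + b *\<^sub>R v \<in> S" and t: "0 < t"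
  obtains a b where "0 < a" "a < t" "0 < b" "b < t"
    "f (x + t *\<^sub>R u + t *\<^sub>R v) - f (x + t *\<^sub>R u) - f (x + t *\<^sub>R v) + f x
      = t\<^sup>2 * (D2 f (x + a *\<^sub>R u + b *\<^sub>R v) v \<bullet> u)"
proof -
  have dif: "(f has_derivative (\<lambda>v. grad f y \<bullet> v)) (at y)" if "y \<in> S" for y
    using f that by (intro has_derivative_grad(1)) (auto simp: numeral_2_eq_2)
  define k where "k a = f (x + a *\<^sub>R u + t *\<^sub>R v) - f (x + a *\<^sub>R u)" for a
  have k: "(k has_real_derivative (grad f (x + a *\<^sub>R u + t *\<^sub>R v) - grad f (x + a *\<^sub>R u)) \<bullet> u) (at a)"
    if a: "0 \<le> a" "a \<le> t" for a
  proof -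
    have S1: "x + a *\<^sub>R u + t *\<^sub>R v \<in> S" and S2: "x + a *\<^sub>R u \<in> S"
      using ball[of a t] ball[of a 0] a t by auto
    have "((\<lambda>a. x + a *\<^sub>R u + t *\<^sub>R v) has_derivative (\<lambda>h. h *\<^sub>R u)) (at a)"
      "((\<lambda>a. x + a *\<^sub>R u) has_derivative (\<lambda>h. h *\<^sub>R u)) (at a)"
      by (auto intro!: derivative_eq_intros)
    from has_derivative_diff[OF has_derivative_compose[OF this(1) dif[OF S1]]
        has_derivative_compose[OF this(2) dif[OF S2]]]
    show ?thesis unfolding has_field_derivative_def k_def
      by (rule has_derivative_eq_rhs) (auto simp: inner_simps algebra_simps)
  qed
  obtain a where a: "0 < a" "a < t"
    "k t - k 0 = t * ((grad f (x + a *\<^sub>R u + t *\<^sub>R v) - grad f (x + a *\<^sub>R u)) \<bullet> u)"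
    using MVT2[OF t, of k "\<lambda>a. (grad f (x + a *\<^sub>R u + t *\<^sub>R v) - grad f (x + a *\<^sub>R u)) \<bullet> u"] k by auto
  define m where "m b = grad f (x + a *\<^sub>R u + b *\<^sub>R v) \<bullet> u" for b
  have m: "(m has_real_derivative D2 f (x + a *\<^sub>R u + b *\<^sub>R v) v \<bullet> u) (at b)" if b: "0 \<le> b" "b \<le> t" for b
  proof -
    have S1: "x + a *\<^sub>R u + b *\<^sub>R v \<in> S" using ball[of a b] a b by auto
    have "((\<lambda>b. x + a *\<^sub>R u + b *\<^sub>R v) has_derivative (\<lambda>h. h *\<^sub>R v)) (at b)"
      by (auto intro!: derivative_eq_intros)
    from has_derivative_inner_left[OF has_derivative_compose[OF this has_derivative_grad_D2[OF f S1]], of u]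
    show ?thesis unfolding has_field_derivative_def m_def
      by (rule has_derivative_eq_rhs) (simp add: linear_scale[OF linear_D2[OF f S1]] fun_eq_iff mult.commute)
  qed
  obtain b where b: "0 < b" "b < t" "m t - m 0 = t * (D2 f (x + a *\<^sub>R u + b *\<^sub>R v) v \<bullet> u)"
    using MVT2[OF t, of m "\<lambda>b. D2 f (x + a *\<^sub>R u + b *\<^sub>R v) v \<bullet> u"] m by auto
  show thesis
    using that[OF a(1,2) b(1,2)] a(3) b(3)
    by (simp add: k_def m_def power2_eq_square inner_simps)
qed

text \<open>
  The second difference is symmetric in \<open>u\<close> and \<open>v\<close>, and each order of evaluation identifies its limit with
  one of the mixed derivatives.
\<close>

lemma D2_symmetric:
  fixes f :: "'a::euclidean_space \<Rightarrow> real"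
  assumes f: "Ck_on 2 S f" "open S" and x: "x \<in> S"
  shows "D2 f x u \<bullet> v = u \<bullet> D2 f x v"
proof -
  have lim: "\<exists>\<delta>>0. \<forall>t. 0 < t \<and> t < \<delta> \<longrightarrow> (\<exists>y. dist y x \<le> t * (norm u + norm v) \<and>
      f (x + t *\<^sub>R u + t *\<^sub>R v) - f (x + t *\<^sub>R u) - f (x + t *\<^sub>R v) + f x = t\<^sup>2 * (D2 f y v \<bullet> u))" for u v
  proof -
    obtain e where e: "0 < e" "ball x e \<subseteq> S" using f x openE by blast
    define \<delta> where "\<delta> = e / (norm u + norm v + 1)"
    have \<delta>: "0 < \<delta>" "\<delta> * (norm u + norm v + 1) = e"
      using e by (auto simp: \<delta>_def add_nonneg_pos intro!: divide_pos_pos)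
       (smt (verit) norm_ge_zero)
    have "\<exists>y. dist y x \<le> t * (norm u + norm v) \<and>
      f (x + t *\<^sub>R u + t *\<^sub>R v) - f (x + t *\<^sub>R u) - f (x + t *\<^sub>R v) + f x = t\<^sup>2 * (D2 f y v \<bullet> u)"
      if t: "0 < t" "t < \<delta>" for t
    proof -
      have nb: "norm (a *\<^sub>R u + b *\<^sub>R v) \<le> t * (norm u + norm v)" if "\<bar>a\<bar> \<le> t" "\<bar>b\<bar> \<le> t" for a b
        using norm_triangle_ineq[of "a *\<^sub>R u" "b *\<^sub>R v"] mult_right_mono[OF that(1), of "norm u"]
          mult_right_mono[OF that(2), of "norm v"] by (simp add: algebra_simps)
      have "t * (norm u + norm v) < e"
        using mult_right_mono[of t \<delta> "norm u + norm v"] t \<delta> by (simp add: algebra_simps)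
      hence "x + a *\<^sub>R u + b *\<^sub>R v \<in> S" if "\<bar>a\<bar> \<le> t" "\<bar>b\<bar> \<le> t" for a b
        using nb[OF that] e(2) by (auto simp: dist_norm add.assoc norm_minus_commute subset_iff)
      from second_difference_mvt[OF f this t(1)] obtain a b where
        ab: "0 < a" "a < t" "0 < b" "b < t"
        "f (x + t *\<^sub>R u + t *\<^sub>R v) - f (x + t *\<^sub>R u) - f (x + t *\<^sub>R v) + f x
          = t\<^sup>2 * (D2 f (x + a *\<^sub>R u + b *\<^sub>R v) v \<bullet> u)" by metis
      thus ?thesis using nb[of a b]
        by (intro exI[of _ "x + a *\<^sub>R u + b *\<^sub>R v"]) (auto simp: dist_norm add.assoc)
    qed
    thus ?thesis using \<delta>(1) by blast
  qed
  have close: "\<exists>r>0. \<forall>y. dist y x < r \<longrightarrow> \<bar>D2 f y v \<bullet> u - D2 f x v \<bullet> u\<bar> < e" if "0 < e" for e u v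
  proof -
    have "continuous_on S (\<lambda>y. D2 f y v \<bullet> u)" by (intro continuous_intros continuous_on_D2 f)
    hence "isCont (\<lambda>y. D2 f y v \<bullet> u) x" using f(2) x continuous_on_eq_continuous_at by blast
    thus ?thesis using that unfolding continuous_at_eps_delta by (auto simp: dist_real_def)
  qed
  have "\<bar>D2 f x v \<bullet> u - D2 f x u \<bullet> v\<bar> \<le> e" if e: "0 < e" for e
  proof -
    obtain \<delta>1 where d1: "0 < \<delta>1" "\<And>t. 0 < t \<Longrightarrow> t < \<delta>1 \<Longrightarrow> \<exists>y. dist y x \<le> t * (norm u + norm v) \<and>
      f (x + t *\<^sub>R u + t *\<^sub>R v) - f (x + t *\<^sub>R u) - f (x + t *\<^sub>R v) + f x = t\<^sup>2 * (D2 f y v \<bullet> u)"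
      using lim[of u v] by blast
    obtain \<delta>2 where d2: "0 < \<delta>2" "\<And>t. 0 < t \<Longrightarrow> t < \<delta>2 \<Longrightarrow> \<exists>y. dist y x \<le> t * (norm v + norm u) \<and>
      f (x + t *\<^sub>R v + t *\<^sub>R u) - f (x + t *\<^sub>R v) - f (x + t *\<^sub>R u) + f x = t\<^sup>2 * (D2 f y u \<bullet> v)"
      using lim[of v u] by blast
    obtain r1 where r1: "0 < r1" "\<And>y. dist y x < r1 \<Longrightarrow> \<bar>D2 f y v \<bullet> u - D2 f x v \<bullet> u\<bar> < e / 2"
      using close[of "e / 2"] e by (metis half_gt_zero)
    obtain r2 where r2: "0 < r2" "\<And>y. dist y x < r2 \<Longrightarrow> \<bar>D2 f y u \<bullet> v - D2 f x u \<bullet> v\<bar> < e / 2"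
      using close[of "e / 2"] e by (metis half_gt_zero)
    define N where "N = norm u + norm v + 1"
    have N: "0 < N" by (simp add: N_def add_nonneg_pos)
    have "0 < min r1 r2 / N" using r1(1) r2(1) N by simp
    then obtain t where t: "0 < t" "t < \<delta>1" "t < \<delta>2" "t < min r1 r2 / N"
      using field_lbound_gt_zero[of "min \<delta>1 \<delta>2" "min r1 r2 / N"] d1(1) d2(1) by auto
    have "t * (norm u + norm v) < t * N" using t(1) by (simp add: N_def)
    also have "t * N < min r1 r2" using t(4) N by (simp add: pos_less_divide_eq)
    finally have small: "t * (norm u + norm v) < r1" "t * (norm v + norm u) < r2" by (auto simp: add.commute)
    obtain y where y: "dist y x < r1"
      "f (x + t *\<^sub>R u + t *\<^sub>R v) - f (x + t *\<^sub>R u) - f (x + t *\<^sub>R v) + f x = t\<^sup>2 * (D2 f y v \<bullet> u)"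
      using d1(2)[OF t(1,2)] small by force
    obtain z where z: "dist z x < r2"
      "f (x + t *\<^sub>R v + t *\<^sub>R u) - f (x + t *\<^sub>R v) - f (x + t *\<^sub>R u) + f x = t\<^sup>2 * (D2 f z u \<bullet> v)"
      using d2(2)[OF t(1,3)] small by force
    have "x + t *\<^sub>R u + t *\<^sub>R v = x + t *\<^sub>R v + t *\<^sub>R u" by (simp add: algebra_simps)
    hence "f (x + t *\<^sub>R u + t *\<^sub>R v) = f (x + t *\<^sub>R v + t *\<^sub>R u)" by (simp only:)
    hence "t\<^sup>2 * (D2 f y v \<bullet> u) = t\<^sup>2 * (D2 f z u \<bullet> v)" using y(2) z(2) by linarith
    hence "D2 f y v \<bullet> u = D2 f z u \<bullet> v" using t(1) by simp
    thus ?thesis using r1(2)[OF y(1)] r2(2)[OF z(1)] by linarith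
  qed
  hence "\<bar>D2 f x v \<bullet> u - D2 f x u \<bullet> v\<bar> \<le> 0" by (rule field_le_epsilon[of _ 0, simplified])
  thus ?thesis by (simp add: inner_commute)
qed

text \<open>
  If the second derivative in direction \<open>v\<close> were negative, then \<open>g\<close> would strictly decrease along \<open>v\<close>.
\<close>

lemma local_min_D2_nonneg:
  fixes g :: "'a::euclidean_space \<Rightarrow> real"
  assumes der: "\<And>y. y \<in> S \<Longrightarrow> (g has_derivative (\<lambda>v. G y \<bullet> v)) (at y)"
    and G: "(G has_derivative G') (at x)"
    and S: "open S" "x \<in> S" and min: "\<And>y. y \<in> S \<Longrightarrow> g x \<le> g y"
  shows "G x = 0" and "0 \<le> v \<bullet> G' v"
proof -
  obtain e where e: "0 < e" "ball x e \<subseteq> S" using S openE by blast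
  have "(\<lambda>v. G x \<bullet> v) = (\<lambda>v. 0)"
    using differential_zero_maxmin[OF S(2,1) der[OF S(2)]] min by blast
  thus G0: "G x = 0" by (metis inner_eq_zero_iff)
  show "0 \<le> v \<bullet> G' v"
  proof (rule ccontr)
    assume neg: "\<not> 0 \<le> v \<bullet> G' v"
    hence "v \<noteq> 0" by auto
    define m where "m t = G (x + t *\<^sub>R v) \<bullet> v" for t
    have "((\<lambda>t. x + t *\<^sub>R v) has_derivative (\<lambda>h. h *\<^sub>R v)) (at 0)"
      by (auto intro!: derivative_eq_intros)
    from has_derivative_compose[OF this, of G G'] G
    have "((\<lambda>t. G (x + t *\<^sub>R v)) has_derivative (\<lambda>h. G' (h *\<^sub>R v))) (at 0)" by simp
    from has_derivative_inner_left[OF this, of v]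
    have "(m has_real_derivative v \<bullet> G' v) (at 0)"
      unfolding m_def has_field_derivative_def
      by (rule has_derivative_eq_rhs) (auto simp: linear_scale[OF has_derivative_linear[OF G]] inner_commute)
    then obtain d where d: "0 < d" "\<And>h. 0 < h \<Longrightarrow> h < d \<Longrightarrow> m (0 + h) < m 0"
      using DERIV_neg_dec_right[of m "v \<bullet> G' v" 0] neg by auto
    define t where "t = min d (e / norm v) / 2"
    have t: "0 < t" "t < d" "t * norm v < e"
      using d(1) e(1) \<open>v \<noteq> 0\<close> by (auto simp: t_def min_def field_simps)
    have inS: "x + h *\<^sub>R v \<in> S" if "0 \<le> h" "h \<le> t" for h
    proof -
      have "h * norm v \<le> t * norm v" using that by (simp add: mult_right_mono)
      thus ?thesis using e(2) t(3) that by (auto simp: dist_norm subset_iff)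
    qed
    have "((\<lambda>t. g (x + t *\<^sub>R v)) has_real_derivative m h) (at h)" if "0 \<le> h" "h \<le> t" for h
    proof -
      have "((\<lambda>t. x + t *\<^sub>R v) has_derivative (\<lambda>h. h *\<^sub>R v)) (at h)"
        by (auto intro!: derivative_eq_intros)
      from has_derivative_compose[OF this der[OF inS[OF that]]]
      show ?thesis unfolding has_field_derivative_def m_def
        by (rule has_derivative_eq_rhs) auto
    qed
    then obtain h where h: "0 < h" "h < t" "g (x + t *\<^sub>R v) - g (x + 0 *\<^sub>R v) = (t - 0) * m h"
      using MVT2[OF t(1), of "\<lambda>t. g (x + t *\<^sub>R v)" m] by blast
    have "m h < 0" using d(2)[of h] h t by (simp add: m_def G0)
    hence "g (x + t *\<^sub>R v) < g x" using h(3) mult_pos_neg[OF t(1), of "m h"] by simp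
    thus False using min[OF inS[of t]] t(1) by simp
  qed
qed

section \<open>Bregman divergences and the one-dimensional potential\<close>

lemma bregman_pos_of_strict_monotone_grad:
  fixes f :: "'a::real_inner \<Rightarrow> real"
  assumes der: "\<And>x. (f has_derivative (\<lambda>v. grad f x \<bullet> v)) (at x)"
    and mono: "\<And>x y. x \<noteq> y \<Longrightarrow> 0 < (grad f y - grad f x) \<bullet> (y - x)"
    and ne: "x \<noteq> y"
  shows "0 < bregman f x y"
proof -
  define v where "v = y - x"
  have "((\<lambda>t. f (x + t *\<^sub>R v)) has_real_derivative grad f (x + t *\<^sub>R v) \<bullet> v) (at t)" for t
  proof -
    have "((\<lambda>t. x + t *\<^sub>R v) has_derivative (\<lambda>h. h *\<^sub>R v)) (at t)"
      by (auto intro!: derivative_eq_intros)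
    from has_derivative_compose[OF this der]
    show ?thesis unfolding has_field_derivative_def
      by (rule has_derivative_eq_rhs) auto
  qed
  then obtain t where t: "0 < t" "t < 1"
    "f (x + 1 *\<^sub>R v) - f (x + 0 *\<^sub>R v) = (1 - 0) * (grad f (x + t *\<^sub>R v) \<bullet> v)"
    using MVT2[of 0 1 "\<lambda>t. f (x + t *\<^sub>R v)" "\<lambda>t. grad f (x + t *\<^sub>R v) \<bullet> v"] by auto
  have "0 < (grad f (x + t *\<^sub>R v) - grad f x) \<bullet> (x + t *\<^sub>R v - x)"
    using mono[of x "x + t *\<^sub>R v"] t ne by (simp add: v_def)
  hence "0 < t * ((grad f (x + t *\<^sub>R v) - grad f x) \<bullet> v)" by simp
  hence "0 < (grad f (x + t *\<^sub>R v) - grad f x) \<bullet> v" using t(1) by (simp add: zero_less_mult_iff)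
  thus ?thesis using t(3) by (simp add: bregman_def v_def inner_diff_left)
qed

lemma bregman_self [simp]: "bregman f x x = 0"
  by (simp add: bregman_def)

text \<open>
  This is convexity of the divergence along rays, derived from the two tangent inequalities at \<open>x + u\<close>.
\<close>

lemma bregman_ray:
  fixes f :: "'a::real_inner \<Rightarrow> real"
  assumes nonneg: "\<And>x y. 0 \<le> bregman f x y" and r: "1 \<le> r"
  shows "r * bregman f x (x + u) \<le> bregman f x (x + r *\<^sub>R u)"
proof -
  let ?z = "x + u"
  define q where "q = grad f ?z - grad f x"
  have 1: "bregman f x ?z - q \<bullet> u \<le> 0"
    using nonneg[of ?z x] by (simp add: bregman_def q_def inner_simps)
  have 2: "bregman f x ?z + (r - 1) * (q \<bullet> u) \<le> bregman f x (x + r *\<^sub>R u)"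
    using nonneg[of ?z "x + r *\<^sub>R u"] by (simp add: bregman_def q_def inner_simps algebra_simps)
  have "(r - 1) * bregman f x ?z \<le> (r - 1) * (q \<bullet> u)"
    using 1 r by (intro mult_left_mono) auto
  thus ?thesis using 2 by (simp add: algebra_simps)
qed

lemma continuous_on_bregman:
  "continuous_on S f \<Longrightarrow> continuous_on S (bregman f x)"
  unfolding bregman_def by (intro continuous_intros)

text \<open>
  Growth along rays is at least linear, with a rate given by the minimum of the divergence on the unit
  sphere.
\<close>

lemma compact_bregman_sublevel:
  fixes f :: "'a::euclidean_space \<Rightarrow> real"
  assumes cont: "continuous_on UNIV f" and pos: "\<And>x y. x \<noteq> y \<Longrightarrow> 0 < bregman f x y"
  shows "compact {y. bregman f x y \<le> t}"
proof -
  have nonneg: "0 \<le> bregman f x y" for x y using pos[of x y] by (cases "x = y") auto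
  have c: "continuous_on S (bregman f x)" for S
    using continuous_on_bregman[OF cont] continuous_on_subset by blast
  obtain b :: 'a where b: "b \<in> Basis" using nonempty_Basis by blast
  have "x + b \<in> sphere x 1" using b by (simp add: dist_norm)
  then obtain y0 where y0: "y0 \<in> sphere x 1" "\<And>y. y \<in> sphere x 1 \<Longrightarrow> bregman f x y0 \<le> bregman f x y"
    using continuous_attains_inf[of "sphere x 1" "bregman f x"] c by auto
  define m where "m = bregman f x y0"
  have "y0 \<noteq> x" using y0(1) by auto
  hence m: "0 < m" using pos[of x y0] by (simp add: m_def)
  have "norm (y - x) \<le> max 1 (t / m)" if y: "bregman f x y \<le> t" for y
  proof (cases "norm (y - x) \<le> 1")
    case False
    define u where "u = (1 / norm (y - x)) *\<^sub>R (y - x)"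
    have nz: "norm (y - x) \<noteq> 0" using False by auto
    have "norm u = 1" using nz by (simp add: u_def)
    hence "m \<le> bregman f x (x + u)" unfolding m_def by (intro y0(2)) (simp add: dist_norm)
    hence "norm (y - x) * m \<le> norm (y - x) * bregman f x (x + u)" by (intro mult_left_mono) auto
    also have "\<dots> \<le> bregman f x (x + norm (y - x) *\<^sub>R u)"
      using False by (intro bregman_ray nonneg) auto
    also have "x + norm (y - x) *\<^sub>R u = y" using nz by (simp add: u_def)
    finally have "norm (y - x) * m \<le> t" using y by linarith
    hence "norm (y - x) \<le> t / m" using m by (simp add: pos_le_divide_eq)
    thus ?thesis by simp
  qed auto
  hence "bounded {y. bregman f x y \<le> t}"
    by (intro boundedI[of _ "norm x + max 1 (t / m)"]) (smt (verit) mem_Collect_eq norm_triangle_sub)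
  moreover have "closed {y. bregman f x y \<le> t}"
    using c by (intro closed_Collect_le continuous_intros)
  ultimately show ?thesis by (simp add: compact_eq_bounded_closed)
qed

lemma open_section_of: "continuous_on UNIV f \<Longrightarrow> open (section_of f x t)"
  unfolding section_of_def by (intro open_Collect_less continuous_on_bregman continuous_intros)

text \<open>
  The derivative of \<open>h s\<close>.
\<close>

definition h' :: "real \<Rightarrow> real \<Rightarrow> real" where
  "h' s z = s / (1 - s) * (sgn z * \<bar>z\<bar> powr (1 / s - 1))"

context
  fixes s :: real
  assumes s: "0 < s" "s < 1"
begin

lemma exponent_pos: "0 < 1 / s - 1" using s by simp

lemma h_zero [simp]: "h s 0 = 0" by (simp add: h_def)

lemma h'_zero [simp]: "h' s 0 = 0" by (simp add: h'_def)

lemma h_minus [simp]: "h s (- z) = h s z" by (simp add: h_def)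

lemma h'_minus [simp]: "h' s (- z) = - h' s z" by (simp add: h'_def sgn_minus)

lemma h_coeff: "s\<^sup>2 / (1 - s) * (1 / s) = s / (1 - s)"
  using s by (simp add: power2_eq_square)

lemma h_has_derivative_pos: "0 < z \<Longrightarrow> (h s has_real_derivative h' s z) (at z)"
proof -
  assume z: "0 < z"
  have "((\<lambda>z. s\<^sup>2 / (1 - s) * z powr (1 / s)) has_real_derivative
      s\<^sup>2 / (1 - s) * ((1 / s) * z powr (1 / s - 1))) (at z)"
    using z s by (auto intro!: derivative_eq_intros simp: mult_ac)
  moreover have "s\<^sup>2 / (1 - s) * ((1 / s) * z powr (1 / s - 1)) = h' s z"
    unfolding mult.assoc[symmetric] h_coeff using z by (simp add: h'_def)
  ultimately have "((\<lambda>z. s\<^sup>2 / (1 - s) * z powr (1 / s)) has_real_derivative h' s z) (at z)" by simp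
  thus ?thesis
    by (rule has_field_derivative_transform_within_open[of _ _ _ "{0<..}"]) (use z in \<open>auto simp: h_def\<close>)
qed

lemma h_has_derivative: "(h s has_real_derivative h' s z) (at z)"
proof -
  consider "0 < z" | "z < 0" | "z = 0" by linarith
  thus ?thesis
  proof cases
    case 1 thus ?thesis by (rule h_has_derivative_pos)
  next
    case 2
    hence "(h s has_real_derivative h' s (- z)) (at (- z))" by (intro h_has_derivative_pos) auto
    hence "((\<lambda>z. h s (- z)) has_real_derivative h' s (- z) * (- 1)) (at z)"
      by (rule DERIV_chain2) (auto intro!: derivative_eq_intros)
    thus ?thesis by simp
  next
    case 3
    have "((\<lambda>t. (h s t - h s 0) / (t - 0)) \<longlongrightarrow> 0) (at 0)"
    proof (rule Lim_null_comparison)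
      have "\<bar>t\<bar> powr (1 / s) = \<bar>t\<bar> powr (1 / s - 1) * \<bar>t\<bar>" if "t \<noteq> 0" for t :: real
        using that powr_add[of "\<bar>t\<bar>" "1 / s - 1" 1] by simp
      hence "norm ((h s t - h s 0) / (t - 0)) \<le> s\<^sup>2 / (1 - s) * \<bar>t\<bar> powr (1 / s - 1)" if "t \<noteq> 0" for t
        using s that by (simp add: h_def abs_mult)
      thus "\<forall>\<^sub>F t in at 0. norm ((h s t - h s 0) / (t - 0)) \<le> s\<^sup>2 / (1 - s) * \<bar>t\<bar> powr (1 / s - 1)"
        by (auto simp: eventually_at_filter)
      have "((\<lambda>t. \<bar>t\<bar> powr (1 / s - 1)) \<longlongrightarrow> \<bar>0\<bar> powr (1 / s - 1)) (at (0::real))"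
        using exponent_pos by (intro tendsto_powr' tendsto_intros) auto
      from tendsto_mult_left[OF this, of "s\<^sup>2 / (1 - s)"]
      show "((\<lambda>t. s\<^sup>2 / (1 - s) * \<bar>t\<bar> powr (1 / s - 1)) \<longlongrightarrow> 0) (at 0)" by simp
    qed
    thus ?thesis using 3 by (simp add: has_field_derivative_iff)
  qed
qed

lemma h'_has_derivative:
  assumes "0 < z"
  shows "(h' s has_real_derivative z powr (1 / s - 2)) (at z)"
proof -
  have "((\<lambda>z. s / (1 - s) * z powr (1 / s - 1)) has_real_derivative
      s / (1 - s) * ((1 / s - 1) * z powr (1 / s - 1 - 1))) (at z)"
    using assms s by (auto intro!: derivative_eq_intros simp: mult_ac)
  moreover have "s / (1 - s) * ((1 / s - 1) * z powr (1 / s - 1 - 1)) = z powr (1 / s - 2)"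
  proof -
    have c: "s / (1 - s) * (1 / s - 1) = 1" using s by (simp add: field_simps)
    show ?thesis unfolding mult.assoc[symmetric] c by simp
  qed
  ultimately have "((\<lambda>z. s / (1 - s) * z powr (1 / s - 1)) has_real_derivative z powr (1 / s - 2)) (at z)"
    by simp
  thus ?thesis
    by (rule has_field_derivative_transform_within_open[of _ _ _ "{0<..}"]) (use assms in \<open>auto simp: h'_def\<close>)
qed

lemma h'_strict_mono_nonneg: "0 \<le> x \<Longrightarrow> x < y \<Longrightarrow> h' s x < h' s y"
proof -
  assume xy: "0 \<le> x" "x < y"
  hence "x powr (1 / s - 1) < y powr (1 / s - 1)"
    using exponent_pos by (intro powr_less_mono2) auto
  moreover have "sgn x * \<bar>x\<bar> powr (1 / s - 1) = x powr (1 / s - 1)" using xy by (cases "x = 0") auto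
  ultimately show ?thesis
    using s xy by (auto simp: h'_def intro!: divide_strict_right_mono mult_strict_left_mono)
qed

lemma h'_strict_mono: "x < y \<Longrightarrow> h' s x < h' s y"
proof -
  assume xy: "x < y"
  consider "0 \<le> x" | "y \<le> 0" | "x < 0" "0 < y" by linarith
  thus ?thesis
  proof cases
    case 1 thus ?thesis using h'_strict_mono_nonneg xy by simp
  next
    case 2 thus ?thesis using h'_strict_mono_nonneg[of "- y" "- x"] xy by simp
  next
    case 3 thus ?thesis using h'_strict_mono_nonneg[of 0 "- x"] h'_strict_mono_nonneg[of 0 y] by simp
  qed
qed

lemma grad_h: "grad (h s) z = h' s z"
  using h_has_derivative by (intro grad_eqI) simp

lemma has_derivative_h: "(h s has_derivative (\<lambda>v. grad (h s) z \<bullet> v)) (at z)"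
  using h_has_derivative[of z] by (simp add: grad_h has_field_derivative_def inner_real_def)

lemma continuous_on_h: "continuous_on S (h s)"
  using h_has_derivative by (meson DERIV_continuous continuous_at_imp_continuous_on)

lemma continuous_on_h': "continuous_on S (h' s)"
proof -
  have e: "h' s = (\<lambda>z. s / (1 - s) * (if z \<le> 0 then - ((- z) powr (1 / s - 1)) else z powr (1 / s - 1)))"
    by (auto simp: h'_def fun_eq_iff sgn_if)
  have "continuous_on (T :: real set) (\<lambda>z. if z \<le> 0 then - ((- z) powr (1 / s - 1)) else z powr (1 / s - 1))" if "T = UNIV" for T
    using exponent_pos unfolding that
    by (intro continuous_on_cases_le continuous_intros continuous_on_powr') (auto)
  hence "continuous_on UNIV (h' s)" unfolding e by (intro continuous_intros) auto
  thus ?thesis using continuous_on_subset by blast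
qed

lemma bregman_h: "bregman (h s) x y = h s y - h s x - h' s x * (y - x)"
  by (simp add: bregman_def grad_h)

lemma bregman_h_pos: "x \<noteq> y \<Longrightarrow> 0 < bregman (h s) x y"
proof (rule bregman_pos_of_strict_monotone_grad[OF has_derivative_h])
  fix x y :: real assume "x \<noteq> y"
  thus "0 < (grad (h s) y - grad (h s) x) \<bullet> (y - x)"
    using h'_strict_mono[of x y] h'_strict_mono[of y x]
    by (cases "x < y") (auto simp: grad_h mult_neg_neg)
qed

lemma bregman_h_nonneg: "0 \<le> bregman (h s) x y"
  using bregman_h_pos[of x y] by (cases "x = y") auto

text \<open>
  The weight is singular at \<open>0\<close> if \<open>s > 1/2\<close>, so the fundamental theorem is applied on either side of \<open>0\<close>,
  where \<open>h'\<close> is continuous up to the endpoint.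
\<close>

lemma nn_integral_h'':
  assumes "a \<le> b"
  shows "(\<integral>\<^sup>+ z. ennreal (\<bar>z\<bar> powr (1 / s - 2)) * indicator {a..b} z \<partial>lborel) \<le> ennreal (h' s b - h' s a)"
proof -
  let ?w = "\<lambda>z. ennreal (\<bar>z\<bar> powr (1 / s - 2))"
  have pos: "(\<integral>\<^sup>+ z. ?w z * indicator {a<..b} z \<partial>lborel) \<le> ennreal (h' s b - h' s a)"
    if ab: "0 \<le> a" "a \<le> b" for a b
  proof -
    have I: "((\<lambda>z. \<bar>z\<bar> powr (1 / s - 2)) has_integral (h' s b - h' s a)) {a..b}"
    proof (rule fundamental_theorem_of_calculus_interior[OF ab(2) continuous_on_h'])
      fix x assume "x \<in> {a<..<b}"
      thus "(h' s has_vector_derivative \<bar>x\<bar> powr (1 / s - 2)) (at x)"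
        using h'_has_derivative[of x] ab by (simp add: has_real_derivative_iff_has_vector_derivative)
    qed
    have "(\<integral>\<^sup>+ z. ?w z * indicator {a<..b} z \<partial>lborel)
        \<le> (\<integral>\<^sup>+ z. ennreal (indicator {a..b} z * \<bar>z\<bar> powr (1 / s - 2)) \<partial>lborel)"
      by (intro nn_integral_mono) (auto simp: indicator_def)
    also have "\<dots> = ennreal (h' s b - h' s a)"
      by (rule nn_integral_has_integral_lebesgue[OF _ I]) auto
    finally show ?thesis .
  qed
  have reflect: "(\<integral>\<^sup>+ z. ?w z * indicator {- b..< - a} z \<partial>lborel) = (\<integral>\<^sup>+ z. ?w z * indicator {a<..b} z \<partial>lborel)" for a b
    by (subst nn_integral_real_affine[where c="-1" and t=0]) (auto simp: indicator_def intro!: nn_integral_cong)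
  have single: "(\<integral>\<^sup>+ z. ?w z * indicator {c} z \<partial>lborel) = 0" for c by simp
  show ?thesis
  proof -
    define a1 b1 where "a1 = max 0 a" and "b1 = max 0 b"
    define a2 b2 where "a2 = max 0 (- b)" and "b2 = max 0 (- a)"
    have "(\<integral>\<^sup>+ z. ?w z * indicator {a..b} z \<partial>lborel) \<le>
      (\<integral>\<^sup>+ z. (?w z * indicator {a1<..b1} z + ?w z * indicator {- b2..< - a2} z) + 
       (?w z * indicator {0} z + (?w z * indicator {a} z + ?w z * indicator {b} z)) \<partial>lborel)"
      using assms
      by (intro nn_integral_mono) (auto simp: indicator_def a1_def b1_def a2_def b2_def max_def)
    also have "\<dots> = (\<integral>\<^sup>+ z. ?w z * indicator {a1<..b1} z \<partial>lborel) + (\<integral>\<^sup>+ z. ?w z * indicator {a2<..b2} z \<partial>lborel)"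
      by (simp add: nn_integral_add reflect single)
    also have "\<dots> \<le> ennreal (h' s b1 - h' s a1) + ennreal (h' s b2 - h' s a2)"
      using assms by (intro add_mono pos) (auto simp: a1_def b1_def a2_def b2_def)
    also have "\<dots> = ennreal ((h' s b1 - h' s a1) + (h' s b2 - h' s a2))"
    proof -
      have mono: "h' s x \<le> h' s y" if "x \<le> y" for x y
        using h'_strict_mono[of x y] that by (cases "x = y") auto
      show ?thesis using assms
        by (intro ennreal_plus[symmetric]) (auto simp: a1_def b1_def a2_def b2_def intro!: mono)
    qed
    also have "(h' s b1 - h' s a1) + (h' s b2 - h' s a2) = h' s b - h' s a"
      using assms by (auto simp: a1_def b1_def a2_def b2_def max_def)
    finally show ?thesis .
  qed
qed

end

section \<open>Slopes over a section of a doubling potential\<close>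

lemma hess_mult_vec:
  assumes "(grad f has_derivative G') (at x)"
  shows "hess f x *v v = G' v"
proof -
  have "(grad f has_derivative (\<lambda>v. hess f x *v v)) (at x)"
    unfolding hess_def using assms differentiableI jacobian_works by blast
  from has_derivative_unique[OF this assms] show ?thesis by metis
qed

lemma hess_eq_D2:
  fixes f :: "real ^ 'n \<Rightarrow> real"
  assumes "Ck_on 2 UNIV f"
  shows "hess f x *v v = D2 f x v"
  using hess_mult_vec[OF has_derivative_grad_D2[OF assms open_UNIV UNIV_I]] .

lemma pos_def_imp_inj: "pos_def A \<Longrightarrow> inj ((*v) A)"
  for A :: "real ^ 'n ^ 'n"
  by (rule injI) (metis eq_iff_diff_eq_0 inner_zero_right less_irrefl matrix_vector_mult_diff_distrib pos_def_def)

lemma pos_def_imp_invertible: "pos_def A \<Longrightarrow> invertible A"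
  for A :: "real ^ 'n ^ 'n"
  using pos_def_imp_inj by (simp add: invertible_left_inverse matrix_left_invertible_injective)

lemma matrix_inv_vec:
  fixes A :: "real ^ 'n ^ 'n"
  assumes "pos_def A"
  shows "matrix_inv A *v (A *v v) = v"
proof -
  have "A ** matrix_inv A = mat 1 \<and> matrix_inv A ** A = mat 1"
    unfolding matrix_inv_def
    by (rule someI_ex[of "\<lambda>B. A ** B = mat 1 \<and> B ** A = mat 1"])
       (use pos_def_imp_invertible[OF assms] in \<open>simp only: invertible_def\<close>)
  thus ?thesis by (simp add: matrix_vector_mul_assoc)
qed

text \<open>
  The segment from the identity to \<open>A\<close> consists of positive definite, hence invertible, matrices.
\<close>

lemma det_pos_if_pos_def:
  fixes A :: "real ^ 'n ^ 'n"
  assumes A: "pos_def A"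
  shows "0 < det A"
proof (rule ccontr)
  assume neg: "\<not> 0 < det A"
  define L where "L t = (\<chi> i j. (1 - t) * (mat 1 :: real ^ 'n ^ 'n) $ i $ j + t * A $ i $ j)" for t :: real
  have L: "L t *v v = (1 - t) *\<^sub>R v + t *\<^sub>R (A *v v)" for t v
  proof -
    have "L t = (1 - t) *\<^sub>R mat 1 + t *\<^sub>R A" by (simp add: L_def vec_eq_iff)
    thus ?thesis by (simp add: matrix_vector_mult_add_rdistrib scaleR_matrix_vector_assoc[symmetric])
  qed
  have cont: "continuous_on {0..1} (\<lambda>t. det (L t))"
    unfolding det_def L_def by (auto intro!: continuous_intros)
  have "L 0 = mat 1" "L 1 = A" by (auto simp: L_def vec_eq_iff)
  hence "det (L 1) \<le> 0" "0 \<le> det (L 0)" using neg by auto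
  then obtain t where t: "0 \<le> t" "t \<le> 1" "det (L t) = 0"
    using IVT2'[of "\<lambda>t. det (L t)" 1 0 0] cont by auto
  have "pos_def (L t)"
    unfolding pos_def_def
  proof (intro allI impI)
    fix v :: "real ^ 'n" assume v: "v \<noteq> 0"
    have "0 < v \<bullet> v" "0 < v \<bullet> (A *v v)" using v A by (auto simp: pos_def_def)
    thus "0 < v \<bullet> (L t *v v)"
      using t(1,2) by (cases "t = 0") (auto simp: L inner_simps intro!: add_nonneg_pos)
  qed
  thus False using pos_def_imp_invertible t(3) by (auto simp: invertible_det_nz)
qed

lemma grad_strict_monotone:
  fixes f :: "real ^ 'n \<Rightarrow> real"
  assumes f: "Ck_on 2 UNIV f" and pd: "\<And>x. pos_def (hess f x)" and ne: "x \<noteq> y"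
  shows "0 < (grad f y - grad f x) \<bullet> (y - x)"
proof -
  define v where "v = y - x"
  have "((\<lambda>t. grad f (x + t *\<^sub>R v) \<bullet> v) has_real_derivative D2 f (x + t *\<^sub>R v) v \<bullet> v) (at t)" for t
  proof -
    have "((\<lambda>t. x + t *\<^sub>R v) has_derivative (\<lambda>h. h *\<^sub>R v)) (at t)"
      by (auto intro!: derivative_eq_intros)
    from has_derivative_inner_left[OF has_derivative_compose[OF this has_derivative_grad_D2[OF f open_UNIV UNIV_I]], of v]
    show ?thesis unfolding has_field_derivative_def
      by (rule has_derivative_eq_rhs)
         (simp add: linear_scale[OF linear_D2[OF f open_UNIV UNIV_I]] fun_eq_iff mult.commute)
  qed
  then obtain t where t: "grad f (x + 1 *\<^sub>R v) \<bullet> v - grad f (x + 0 *\<^sub>R v) \<bullet> v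
      = (1 - 0) * (D2 f (x + t *\<^sub>R v) v \<bullet> v)"
    using MVT2[of 0 1 "\<lambda>t. grad f (x + t *\<^sub>R v) \<bullet> v" "\<lambda>t. D2 f (x + t *\<^sub>R v) v \<bullet> v"] by auto
  have "v \<noteq> 0" using ne by (simp add: v_def)
  hence "0 < v \<bullet> (hess f (x + t *\<^sub>R v) *v v)"
    using pd[of "x + t *\<^sub>R v"] unfolding pos_def_def by blast
  hence "0 < D2 f (x + t *\<^sub>R v) v \<bullet> v"
    unfolding hess_eq_D2[OF f] by (simp only: inner_commute)
  thus ?thesis using t by (simp add: v_def inner_diff_left)
qed

lemma has_derivative_grad_C2:
  assumes "Ck_on 2 UNIV f"
  shows "(f has_derivative (\<lambda>v. grad f x \<bullet> v)) (at x)"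
  using assms by (intro has_derivative_grad(1)) (auto simp: numeral_2_eq_2)

lemma bregman_pos_C2:
  fixes f :: "real ^ 'n \<Rightarrow> real"
  assumes f: "Ck_on 2 UNIV f" and pd: "\<And>x. pos_def (hess f x)" and ne: "x \<noteq> y"
  shows "0 < bregman f x y"
  by (rule bregman_pos_of_strict_monotone_grad[OF has_derivative_grad_C2[OF f] grad_strict_monotone[OF f pd] ne])

lemma convex_section_of:
  assumes "convex_on UNIV f"
  shows "convex (section_of f x t)"
proof (rule convexI)
  fix a b :: 'a and u v :: real
  assume ab: "a \<in> section_of f x t" "b \<in> section_of f x t" and uv: "0 \<le> u" "0 \<le> v" "u + v = 1"
  have "f (u *\<^sub>R a + v *\<^sub>R b) \<le> u * f a + v * f b"
    using assms uv by (simp add: convex_on_def)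
  moreover have "u *\<^sub>R a + v *\<^sub>R b - x = u *\<^sub>R (a - x) + v *\<^sub>R (b - x)"
  proof -
    have "x = u *\<^sub>R x + v *\<^sub>R x" using uv by (simp add: scaleR_left_distrib[symmetric])
    thus ?thesis by (simp add: algebra_simps)
  qed
  moreover have "u * f x + v * f x = f x" "u * (grad f x \<bullet> x) + v * (grad f x \<bullet> x) = grad f x \<bullet> x"
    using uv by (simp_all add: distrib_right[symmetric])
  ultimately have "bregman f x (u *\<^sub>R a + v *\<^sub>R b) \<le> u * bregman f x a + v * bregman f x b"
    by (simp add: bregman_def inner_simps algebra_simps)
  also have "\<dots> < t"
    using ab uv by (intro convex_bound_lt) (auto simp: section_of_def)
  finally show "u *\<^sub>R a + v *\<^sub>R b \<in> section_of f x t" by (simp add: section_of_def)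
qed

text \<open>
  A quantitative form of the classical comparison of the two support heights of a convex body about its
  center of mass. If the affine function \<open>p \<bullet> (y - c)\<close> were very negative at \<open>x\<close>, then it would be negative
  on the copy of \<open>S\<close> contracted by \<open>1/2\<close> towards \<open>x\<close>, which has a fixed proportion of the volume, and its
  integral over \<open>S\<close> could not vanish.
\<close>

lemma centroid_balanced:
  fixes S :: "'a::euclidean_space set"
  assumes S: "open S" "bounded S" "convex S" and x: "x \<in> S"
    and M: "\<And>w. w \<in> S \<Longrightarrow> p \<bullet> (w - center_of_mass S) \<le> M"
  shows "p \<bullet> (center_of_mass S - x) \<le> 2 ^ (DIM('a) + 1) * M"
proof -
  define c m where "c = center_of_mass S" and "m = measure lborel S"
  define n where "n = DIM('a)"
  define u where "u y = p \<bullet> (y - c)" for y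
  have Sm: "S \<in> sets lborel" using S(1) by auto
  have fin: "emeasure lborel S < \<infinity>" by (rule emeasure_bounded_finite[OF S(2)])
  have mpos: "0 < m"
  proof -
    have "emeasure lborel S \<noteq> 0"
      using S(1) x open_not_negligible[of S] by (auto simp: negligible_iff_emeasure0 Sm)
    thus ?thesis unfolding m_def using fin
      by (simp add: measure_def enn2real_positive_iff zero_less_iff_neq_zero)
  qed
  obtain R where "\<forall>x\<in>S. norm x \<le> R" using S(2) bounded_iff by blast
  hence R: "S \<subseteq> cball 0 R" by auto
  have int_id: "integrable lborel (\<lambda>y. indicator S y *\<^sub>R y)"
  proof -
    have "set_integrable lborel (cball 0 R) (\<lambda>y::'a. y)"
      unfolding set_integrable_def by (rule borel_integrable_compact) auto
    from set_integrable_subset[OF this Sm R] show ?thesis by (simp add: set_integrable_def)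
  qed
  have int_1: "integrable lborel (indicator S :: 'a \<Rightarrow> real)" using fin Sm by (simp add: less_top)
  have "(\<integral>y. indicator S y *\<^sub>R y \<partial>lborel) = m *\<^sub>R c"
    using mpos by (simp add: c_def center_of_mass_def set_lebesgue_integral_def m_def)
  hence e1: "(\<integral>y. p \<bullet> (indicator S y *\<^sub>R y) \<partial>lborel) = m * (p \<bullet> c)"
    using int_id by (subst integral_inner_right) auto
  have e2: "(\<integral>y. indicator S y * (p \<bullet> c) \<partial>lborel) = m * (p \<bullet> c)"
    by (simp add: m_def)
  have u_eq: "indicator S y * u y = p \<bullet> (indicator S y *\<^sub>R y) - indicator S y * (p \<bullet> c)" for y
    by (simp add: u_def inner_simps algebra_simps)
  have i1: "integrable lborel (\<lambda>y. p \<bullet> (indicator S y *\<^sub>R y))"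
    by (rule integrable_inner_right) (rule int_id)
  have i2: "integrable lborel (\<lambda>y. indicator S y * (p \<bullet> c))"
    by (rule integrable_mult_left) (rule int_1)
  have zero: "(\<integral>y. indicator S y * u y \<partial>lborel) = 0"
    unfolding u_eq Bochner_Integration.integral_diff[OF i1 i2] e1 e2 by simp
  have iu: "integrable lborel (\<lambda>y. indicator S y * u y)"
    unfolding u_eq using i1 i2 by (rule Bochner_Integration.integrable_diff)
  define E where "E = (\<lambda>w. (1/2) *\<^sub>R w + (1/2) *\<^sub>R x) ` S"
  have ES: "E \<subseteq> S"
    unfolding E_def using S(3) x by (auto simp: convex_def)
  have "open E"
    unfolding E_def using open_affinity[OF S(1), of "1/2" "(1/2) *\<^sub>R x"] by (simp add: add.commute)
  hence Em: "E \<in> sets lborel" by auto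
  have mE: "measure lborel E = m / 2 ^ n"
  proof -
    have "measure lebesgue E = \<bar>1/2\<bar> ^ n * measure lebesgue S"
      unfolding E_def n_def by (rule measure_lebesgue_affine)
    thus ?thesis using Em Sm by (simp add: m_def power_divide)
  qed
  have finE: "emeasure lborel E < \<infinity>"
    using emeasure_mono[OF ES Sm] fin by (rule le_less_trans)
  define q where "q = M + p \<bullet> (c - x)"
  have bound: "u y \<le> M" if "y \<in> S" for y using M[OF that] by (simp add: u_def c_def)
  have boundE: "u y \<le> M - q / 2" if yE: "y \<in> E" for y
  proof -
    obtain w where w: "w \<in> S" "y = (1/2) *\<^sub>R w + (1/2) *\<^sub>R x" using yE by (auto simp: E_def)
    have "u y = u w / 2 - (p \<bullet> (c - x)) / 2" by (simp add: u_def w(2) inner_simps field_simps)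
    thus ?thesis using bound[OF w(1)] by (simp add: q_def field_simps)
  qed
  have "(\<integral>y. indicator S y * u y \<partial>lborel) \<le> (\<integral>y. indicator S y * M - indicator E y * (q / 2) \<partial>lborel)"
  proof (rule integral_mono[OF iu])
    show "integrable lborel (\<lambda>y. indicator S y * M - indicator E y * (q / 2))"
      using int_1 Em finE by (auto simp: less_top)
    fix y show "indicator S y * u y \<le> indicator S y * M - indicator E y * (q / 2)"
      using bound boundE ES by (auto simp: indicator_def)
  qed
  also have "\<dots> = m * M - m / 2 ^ n * (q / 2)"
    using int_1 Em finE by (subst Bochner_Integration.integral_diff) (auto simp: less_top m_def mE[unfolded m_def])
  finally have "m * (q / 2 / 2 ^ n) \<le> m * M" using zero by (simp add: field_simps)
  hence "q / 2 / 2 ^ n \<le> M" using mpos by (rule mult_left_le_imp_le)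
  hence q_le: "q \<le> 2 ^ (n + 1) * M" by (simp add: field_simps)
  have "(\<integral>y. indicator S y * u y \<partial>lborel) \<le> (\<integral>y. indicator S y * M \<partial>lborel)"
  proof (rule integral_mono[OF iu])
    show "integrable lborel (\<lambda>y. indicator S y * M)" by (rule integrable_mult_left) (rule int_1)
  qed (use bound in \<open>auto simp: indicator_def\<close>)
  hence "0 \<le> m * M" using zero by (simp add: m_def)
  hence "0 \<le> M" using mpos by (simp add: zero_le_mult_iff)
  thus ?thesis using q_le by (simp add: q_def n_def c_def)
qed

text \<open>
  From a point \<open>y\<close> of the half contraction one can move by \<open>(w - c) / 2\<close> and stay in \<open>S\<close>, where the
  divergence from \<open>x0\<close> lies between \<open>0\<close> and \<open>t\<close>.
\<close>

lemma grad_half_contraction: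
  fixes f :: "'a::euclidean_space \<Rightarrow> real"
  assumes nonneg: "\<And>x y. 0 \<le> bregman f x y"
    and S: "S = section_of f x0 t" "convex S" and y: "y \<in> half_contraction S" and w: "w \<in> S"
  shows "(grad f y - grad f x0) \<bullet> (w - center_of_mass S) \<le> 2 * t"
proof -
  define c where "c = center_of_mass S"
  define v where "v = (1/2) *\<^sub>R (w - c)"
  obtain u where u: "u \<in> S" "y = c + (1/2) *\<^sub>R (u - c)" using y by (auto simp: half_contraction_def c_def)
  have "c + c = 2 *\<^sub>R c" by (simp add: scaleR_2)
  hence "y + v = (1/2) *\<^sub>R u + (1/2) *\<^sub>R w"
    by (simp add: u(2) v_def algebra_simps) (simp add: scaleR_add_left[symmetric])
  hence "y + v \<in> S" using S(2) u(1) w by (simp add: convex_def)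
  hence "bregman f x0 (y + v) < t" by (simp add: S(1) section_of_def)
  moreover have "0 \<le> bregman f x0 y" "0 \<le> bregman f y (y + v)" by (rule nonneg)+
  ultimately have "(grad f y - grad f x0) \<bullet> v < t"
    by (simp add: bregman_def inner_simps)
  thus ?thesis by (simp add: v_def c_def)
qed

lemma continuous_on_MA_density:
  fixes f :: "real ^ 'n \<Rightarrow> real"
  assumes "Ck_on 2 UNIV f"
  shows "continuous_on UNIV (MA_density f)"
proof -
  have h: "hess f x $ i $ j = D2 f x (axis j 1) $ i" for x i j
    using hess_eq_D2[OF assms, of x "axis j 1"] by (metis matrix_vector_mult_basis column_def vec_lambda_beta)
  show ?thesis
    unfolding MA_density_def det_def h by (intro continuous_intros continuous_on_D2[OF assms])
qed

text \<open>
  The gradient at \<open>x0\<close> plus a multiple of the polar of the symmetrized section about \<open>x0\<close>.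
\<close>

definition slope_set :: "('a::euclidean_space \<Rightarrow> real) \<Rightarrow> 'a \<Rightarrow> real \<Rightarrow> real \<Rightarrow> 'a set" where
  "slope_set f x0 t r = {P. \<forall>x \<in> section_of f x0 t. \<bar>(P - grad f x0) \<bullet> (x - x0)\<bar> \<le> r}"

lemma closed_slope_set: "closed (slope_set f x0 t r)"
proof -
  have "slope_set f x0 t r = (\<Inter>x \<in> section_of f x0 t. {P. \<bar>(P - grad f x0) \<bullet> (x - x0)\<bar> \<le> r})"
    by (auto simp: slope_set_def)
  thus ?thesis by (auto intro!: closed_INT closed_Collect_le continuous_intros)
qed

lemma emeasure_slope_set_scale:
  fixes f :: "'a::euclidean_space \<Rightarrow> real"
  assumes l: "0 < l"
  shows "emeasure lborel (slope_set f x0 t (l * r)) = ennreal (l ^ DIM('a)) * emeasure lborel (slope_set f x0 t r)"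
proof -
  define g where "g = grad f x0"
  have "slope_set f x0 t (l * r) = (\<lambda>P. l *\<^sub>R P + (1 - l) *\<^sub>R g) ` slope_set f x0 t r"
  proof (intro equalityI subsetI)
    fix P assume P: "P \<in> slope_set f x0 t (l * r)"
    define P' where "P' = g + (1 / l) *\<^sub>R (P - g)"
    have "P = l *\<^sub>R P' + (1 - l) *\<^sub>R g" using l by (simp add: P'_def algebra_simps)
    moreover have "P' \<in> slope_set f x0 t r"
      using P l by (auto simp: slope_set_def P'_def g_def abs_mult pos_divide_le_eq mult.commute)
    ultimately show "P \<in> (\<lambda>P. l *\<^sub>R P + (1 - l) *\<^sub>R g) ` slope_set f x0 t r" by blast
  next
    fix P assume "P \<in> (\<lambda>P. l *\<^sub>R P + (1 - l) *\<^sub>R g) ` slope_set f x0 t r"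
    then obtain P' where P': "P' \<in> slope_set f x0 t r" "P = l *\<^sub>R P' + (1 - l) *\<^sub>R g" by blast
    have "P - g = l *\<^sub>R (P' - g)" by (simp add: P'(2) algebra_simps)
    thus "P \<in> slope_set f x0 t (l * r)"
      using P'(1) l by (auto simp: slope_set_def g_def[symmetric] abs_mult)
  qed
  hence "emeasure lebesgue (slope_set f x0 t (l * r)) = \<bar>l\<bar> ^ DIM('a) * emeasure lebesgue (slope_set f x0 t r)"
    by (simp only: emeasure_lebesgue_affine)
  thus ?thesis using l closed_slope_set[of f x0 t] by (simp add: borel_closed)
qed

text \<open>
  Doubling is used only here. It replaces the section by its half contraction, whose gradient image lies in
  a dilated slope set; its Lebesgue measure is the Monge-Ampere measure because the gradient is injective.
\<close>

lemma MA_measure_section_le_slope_set: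
  fixes f :: "real ^ 'n \<Rightarrow> real"
  assumes f: "Ck_on 2 UNIV f" "convex_on UNIV f" and pd: "\<And>x. pos_def (hess f x)"
    and DC: "DC C f" and t: "0 < t" and r: "0 < r"
  shows "emeasure (MA_measure f) (section_of f x0 t)
    \<le> ennreal (C * (2 ^ (CARD('n) + 3) * t / r) ^ CARD('n)) * emeasure lborel (slope_set f x0 t r)"
proof -
  define S c n where "S = section_of f x0 t" and "c = center_of_mass S" and "n = CARD('n)"
  define A where "A = half_contraction S"
  have pos: "0 < bregman f x y" if "x \<noteq> y" for x y by (rule bregman_pos_C2[OF f(1) pd that])
  have nonneg: "0 \<le> bregman f x y" for x y using pos[of x y] by (cases "x = y") auto
  have contf: "continuous_on UNIV f" by (rule Ck_on_imp_continuous_on[OF f(1)])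
  have S: "open S" "convex S" "bounded S" "x0 \<in> S"
  proof -
    show "open S" unfolding S_def by (rule open_section_of[OF contf])
    show "convex S" unfolding S_def by (rule convex_section_of[OF f(2)])
    have "S \<subseteq> {y. bregman f x0 y \<le> t}" by (auto simp: S_def section_of_def)
    thus "bounded S" using compact_bregman_sublevel[OF contf pos] compact_imp_bounded bounded_subset by blast
    show "x0 \<in> S" using t by (simp add: S_def section_of_def)
  qed
  have A_eq: "A = (\<lambda>w. (1/2) *\<^sub>R c + (1/2) *\<^sub>R w) ` S"
    unfolding A_def half_contraction_def c_def[symmetric]
  proof (rule image_cong[OF refl])
    fix y show "c + (1/2) *\<^sub>R (y - c) = (1/2) *\<^sub>R c + (1/2) *\<^sub>R y"
      by (simp add: scaleR_diff_right)
  qed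
  have "open A" unfolding A_eq by (rule open_affinity[OF S(1)]) simp
  hence Am: "A \<in> sets borel" by auto
  have "bounded A" unfolding A_eq using bounded_translation[OF bounded_scaling[OF S(3), of "1/2"], of "(1/2) *\<^sub>R c"]
    by (simp add: image_image)
  then obtain k where "\<forall>x\<in>A. norm x \<le> k" using bounded_iff by blast
  hence k: "A \<subseteq> cball 0 k" by auto
  have cMA: "continuous_on UNIV (MA_density f)" by (rule continuous_on_MA_density[OF f(1)])
  hence bMA: "MA_density f \<in> borel_measurable borel" by (rule borel_measurable_continuous_onI)
  \<comment> \<open>The upper bound for \<open>w - c\<close> becomes two-sided by balancedness, and \<open>c\<close> is then replaced by \<open>x0 \<in> S\<close>.\<close>
  have slopes: "grad f y \<in> slope_set f x0 t (2 ^ (n + 3) * t)" if y: "y \<in> A" for y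
  proof -
    define q where "q = grad f y - grad f x0"
    have up: "q \<bullet> (w - c) \<le> 2 * t" if "w \<in> S" for w
      using grad_half_contraction[OF nonneg S_def S(2) _ that, of y] y by (simp add: A_def q_def c_def)
    have lo: "q \<bullet> (c - w) \<le> 2 ^ (n + 1) * (2 * t)" if "w \<in> S" for w
      using centroid_balanced[OF S(1,3,2) that, of q "2 * t"] up by (simp add: c_def n_def)
    have big: "2 * t \<le> 2 ^ (n + 1) * (2 * t)" using t one_le_power[of "2::real" "n + 1"] by simp
    have "\<bar>q \<bullet> (w - x0)\<bar> \<le> 2 ^ (n + 3) * t" if w: "w \<in> S" for w
    proof -
      have "q \<bullet> (w - x0) = q \<bullet> (w - c) + q \<bullet> (c - x0)" "q \<bullet> (w - x0) = - (q \<bullet> (c - w)) - q \<bullet> (x0 - c)"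
        by (simp_all add: inner_simps)
      moreover have "(2::real) ^ (n + 3) * t = 2 ^ (n + 1) * (2 * t) + 2 ^ (n + 1) * (2 * t)"
        by (simp add: power_add)
      ultimately show ?thesis
        using up[OF w] lo[OF w] up[OF S(4)] lo[OF S(4)] big by linarith
    qed
    thus ?thesis by (simp add: slope_set_def S_def q_def)
  qed
  have fin: "(\<integral>\<^sup>+ x. ennreal \<bar>MA_density f x\<bar> * indicator A x \<partial>lborel) < \<infinity>"
  proof -
    have "compact (cball (0 :: real ^ 'n) k)" by simp
    hence "bounded (MA_density f ` cball 0 k)"
      using cMA by (meson compact_continuous_image compact_imp_bounded continuous_on_subset subset_UNIV)
    then obtain b where "\<forall>y \<in> MA_density f ` cball 0 k. norm y \<le> b"
      unfolding bounded_iff by blast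
    hence b: "\<bar>MA_density f x\<bar> \<le> b" if "x \<in> cball 0 k" for x using that by simp
    have "(\<integral>\<^sup>+ x. ennreal \<bar>MA_density f x\<bar> * indicator A x \<partial>lborel) \<le> (\<integral>\<^sup>+ x. ennreal b * indicator A x \<partial>lborel)"
      using b k by (intro nn_integral_mono) (auto simp: indicator_def intro!: ennreal_leI)
    also have "\<dots> = ennreal b * emeasure lborel A" using Am by (simp add: nn_integral_cmult_indicator)
    also have "\<dots> < \<infinity>"
      using emeasure_bounded_finite[OF \<open>bounded A\<close>] by (simp add: ennreal_mult_less_top)
    finally show ?thesis .
  qed
  have D2_eq: "D2 f x = (\<lambda>v. hess f x *v v)" for x using hess_eq_D2[OF f(1)] by auto
  have "emeasure (MA_measure f) S \<le> ennreal C * emeasure (MA_measure f) A"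
    using DC t by (simp add: DC_def S_def A_def)
  also have "emeasure (MA_measure f) A = (\<integral>\<^sup>+ x. ennreal (MA_density f x) * indicator A x \<partial>lborel)"
    unfolding MA_measure_def using bMA Am by (subst emeasure_density) auto
  also have "\<dots> \<le> (\<integral>\<^sup>+ x. ennreal \<bar>MA_density f x\<bar> * indicator A x \<partial>lborel)"
    by (intro nn_integral_mono mult_right_mono ennreal_leI) auto
  also have "\<dots> \<le> emeasure lborel (slope_set f x0 t (2 ^ (n + 3) * t))"
  proof (rule area_formula_injective[OF Am _ _ _ _ _ _ _ fin])
    show "(grad f has_derivative D2 f x) (at x)" for x
      by (rule has_derivative_grad_D2[OF f(1)]) auto
    show "inj_on (grad f) A"
      by (rule inj_onI) (metis grad_strict_monotone[OF f(1) pd] cancel_comm_monoid_add_class.diff_cancel inner_zero_left less_irrefl)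
    show "\<bar>edet (D2 f x)\<bar> = \<bar>MA_density f x\<bar>" for x
      unfolding D2_eq edet_matrix MA_density_def ..
    show "slope_set f x0 t (2 ^ (n + 3) * t) \<in> sets borel" by (rule borel_closed[OF closed_slope_set])
    show "(\<lambda>x. \<bar>MA_density f x\<bar>) \<in> borel_measurable borel" using bMA by (rule borel_measurable_abs)
  qed (use slopes in auto)
  also have "emeasure lborel (slope_set f x0 t (2 ^ (n + 3) * t)) =
      ennreal ((2 ^ (n + 3) * t / r) ^ n) * emeasure lborel (slope_set f x0 t r)"
    using emeasure_slope_set_scale[of "2 ^ (n + 3) * t / r" f x0 t r] t r by (simp add: n_def)
  finally show ?thesis
    using DC t r by (simp add: S_def n_def DC_def ennreal_mult mult.assoc mult_left_mono)
qed

section \<open>Slopes over a section of the one-dimensional potential\<close>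

text \<open>
  A section of \<open>h s\<close> is an interval with endpoints \<open>a\<close>, \<open>b\<close>, and the symmetrized divergence
  \<open>(h' b - h' a) (b - a)\<close> is at most a multiple of \<open>R\<close> by the quasi-triangle inequality through \<open>z0\<close>. So the
  interval from \<open>h' z0 + R / (4 d)\<close> to \<open>h' z0 + R / (2 d)\<close>, where \<open>d = b - a\<close>, has length at least a
  multiple of \<open>h' b - h' a\<close>. Its elements exceed \<open>\<theta> R\<^bsup>1-s\<^esup>\<close>: either \<open>z0 \<ge> R\<^bsup>s\<^esup>\<close> and \<open>h' z0\<close> is large, or the section has length at
  most a multiple of \<open>R\<^bsup>s\<^esup>\<close>.
\<close>

lemma h_slope_interval:
  fixes s K \<beta> \<theta> R z0 :: real
  assumes s: "0 < s" "s < 1" and K: "h_quasi_triangle s K" and \<beta>: "1 \<le> \<beta>" and R: "0 < R" and z0: "0 \<le> z0"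
    and \<theta>: "0 < \<theta>" "\<theta> < s / (1 - s)"
      "\<theta> < 1 / (8 * ((1 - s) / s\<^sup>2 * (K * (s\<^sup>2 / (1 - s) + \<beta>))) powr s)"
  obtains lo hi where "lo \<le> hi"
    "\<And>q z. q \<in> {lo..hi} \<Longrightarrow> z \<in> section_of (h s) z0 (\<beta> * R) \<Longrightarrow> \<bar>(q - h' s z0) * (z - z0)\<bar> \<le> R / 2"
    "\<theta> * R powr (1 - s) < lo"
    "(\<integral>\<^sup>+ z. ennreal (\<bar>z\<bar> powr (1 / s - 2)) * indicator (section_of (h s) z0 (\<beta> * R)) z \<partial>lborel)
      \<le> ennreal (16 * K * \<beta> * (hi - lo))"
proof -
  define B where "B = (1 - s) / s\<^sup>2 * (K * (s\<^sup>2 / (1 - s) + \<beta>))"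
  define J where "J = {z. bregman (h s) z0 z \<le> \<beta> * R}"
  have K1: "1 \<le> K" and qt: "bregman (h s) z z' \<le> K * (min (bregman (h s) z z'') (bregman (h s) z'' z)
      + min (bregman (h s) z' z'') (bregman (h s) z'' z'))" for z z' z''
    using K by (auto simp: h_quasi_triangle_def)
  have \<beta>R: "0 < \<beta> * R" using \<beta> R by simp
  have cJ: "compact J"
    unfolding J_def by (rule compact_bregman_sublevel[OF continuous_on_h[OF s] bregman_h_pos[OF s]])
  have z0J: "z0 \<in> J" using \<beta>R by (simp add: J_def)
  obtain a where a: "a \<in> J" "\<And>z. z \<in> J \<Longrightarrow> a \<le> z" using compact_attains_inf[OF cJ] z0J by blast
  obtain b where b: "b \<in> J" "\<And>z. z \<in> J \<Longrightarrow> z \<le> b" using compact_attains_sup[OF cJ] z0J by blast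
  have sec: "section_of (h s) z0 (\<beta> * R) \<subseteq> J" by (auto simp: section_of_def J_def)
  have "\<exists>z \<in> J. z \<noteq> z0"
  proof -
    have "open (section_of (h s) z0 (\<beta> * R))" by (rule open_section_of[OF continuous_on_h[OF s]])
    moreover have "z0 \<in> section_of (h s) z0 (\<beta> * R)" using \<beta>R by (simp add: section_of_def)
    ultimately obtain e where "0 < e" "ball z0 e \<subseteq> section_of (h s) z0 (\<beta> * R)" using openE by blast
    moreover have "z0 + e / 2 \<in> ball z0 e" using \<open>0 < e\<close> by (simp add: dist_real_def)
    ultimately show ?thesis using sec by (intro bexI[of _ "z0 + e / 2"]) auto
  qed
  hence ab: "a < b" using a(2) b(2) z0J by (metis antisym_conv2 order_trans not_le)
  define d where "d = b - a"
  have d: "0 < d" using ab by (simp add: d_def)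
  have pair: "bregman (h s) x y \<le> 2 * K * \<beta> * R" if "x \<in> J" "y \<in> J" for x y
  proof -
    have "bregman (h s) x y \<le> K * (\<beta> * R + \<beta> * R)"
      using qt[of x y z0] that K1 by (smt (verit, best) J_def mem_Collect_eq mult_left_mono)
    thus ?thesis by (simp add: algebra_simps)
  qed
  have "(h' s b - h' s a) * d \<le> 4 * K * \<beta> * R"
    using pair[OF a(1) b(1)] pair[OF b(1) a(1)] by (simp add: bregman_h[OF s] d_def algebra_simps)
  hence hab: "h' s b - h' s a \<le> 16 * K * \<beta> * (R / (4 * d))"
    using d by (simp add: field_simps)
  define lo hi where "lo = h' s z0 + R / (4 * d)" and "hi = h' s z0 + R / (2 * d)"
  have hl: "hi - lo = R / (4 * d)" by (simp add: lo_def hi_def field_simps)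
  have lohi: "0 < R / (4 * d)" using R d by simp
  have h'0: "0 \<le> h' s z0" using h'_strict_mono_nonneg[OF s, of 0 z0] z0 h'_zero[OF s] by (cases "z0 = 0") auto
  have "\<theta> * R powr (1 - s) < lo"
  proof (cases "R powr s \<le> z0")
    case True
    have "s * (1 / s - 1) = 1 - s" using s by (simp add: field_simps)
    hence "R powr (1 - s) = (R powr s) powr (1 / s - 1)" by (simp only: powr_powr)
    also have "\<dots> \<le> z0 powr (1 / s - 1)" using True exponent_pos[OF s] by (intro powr_mono2) auto
    finally have "s / (1 - s) * R powr (1 - s) \<le> s / (1 - s) * z0 powr (1 / s - 1)"
      using s by (intro mult_left_mono) auto
    also have "\<dots> = h' s z0"
    proof -
      have "0 < R powr s" using R by simp
      hence "0 < z0" using True by linarith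
      thus ?thesis by (simp add: h'_def)
    qed
    finally have "s / (1 - s) * R powr (1 - s) \<le> h' s z0" .
    moreover have "\<theta> * R powr (1 - s) < s / (1 - s) * R powr (1 - s)"
      using \<theta>(2) R by (intro mult_strict_right_mono) auto
    ultimately show ?thesis using lohi by (simp add: lo_def)
  next
    case False
    have A: "0 < s\<^sup>2 / (1 - s)" using s by simp
    have hz0: "h s z0 \<le> s\<^sup>2 / (1 - s) * R"
    proof -
      have "z0 powr (1 / s) \<le> (R powr s) powr (1 / s)" using False z0 s by (intro powr_mono2) auto
      also have "\<dots> = R" using s R by (simp add: powr_powr)
      finally show ?thesis unfolding h_def using z0 A by (intro mult_left_mono) auto
    qed
    have Bpos: "0 < B" using s K1 \<beta> A by (auto simp: B_def intro!: mult_pos_pos divide_pos_pos add_pos_pos)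
    have abs: "\<bar>z\<bar> \<le> B powr s * R powr s" if z: "z \<in> J" for z
    proof -
      \<comment> \<open>The divergence from \<open>0\<close> is \<open>h\<close> itself, so this bounds the size of \<open>z\<close>.\<close>
      have "bregman (h s) 0 z \<le> K * (bregman (h s) 0 z0 + bregman (h s) z0 z)"
        using qt[of 0 z z0] K1 by (smt (verit, best) mult_left_mono)
      also have "\<dots> \<le> K * (s\<^sup>2 / (1 - s) * R + \<beta> * R)"
        using z hz0 K1 by (intro mult_left_mono add_mono) (auto simp: J_def bregman_h[OF s] h_zero[OF s] h'_zero[OF s])
      finally have "s\<^sup>2 / (1 - s) * \<bar>z\<bar> powr (1 / s) \<le> K * (s\<^sup>2 / (1 - s) * R + \<beta> * R)"
        by (simp add: bregman_h[OF s] h_def h'_zero[OF s])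
      hence "\<bar>z\<bar> powr (1 / s) \<le> B * R"
        using s A by (simp add: B_def field_simps)
      hence "(\<bar>z\<bar> powr (1 / s)) powr s \<le> (B * R) powr s" using s by (intro powr_mono2) auto
      thus ?thesis using s Bpos R by (simp add: powr_powr powr_mult)
    qed
    have "d \<le> 2 * (B powr s * R powr s)" using abs[OF a(1)] abs[OF b(1)] by (simp add: d_def)
    hence "R / (4 * (2 * (B powr s * R powr s))) \<le> R / (4 * d)"
      using d R by (intro divide_left_mono) auto
    moreover have "\<theta> * R powr (1 - s) < R / (4 * (2 * (B powr s * R powr s)))"
    proof -
      have "\<theta> * R powr (1 - s) < 1 / (8 * B powr s) * R powr (1 - s)"
        using \<theta>(3) R by (intro mult_strict_right_mono) (auto simp: B_def)
      also have "\<dots> = R / (4 * (2 * (B powr s * R powr s)))"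
        using R by (simp add: powr_diff field_simps)
      finally show ?thesis .
    qed
    ultimately show ?thesis using h'0 by (simp add: lo_def)
  qed
  moreover have "\<bar>(q - h' s z0) * (z - z0)\<bar> \<le> R / 2" if q: "q \<in> {lo..hi}" and z: "z \<in> section_of (h s) z0 (\<beta> * R)" for q z
  proof -
    have "z \<in> J" using z sec by blast
    hence "\<bar>z - z0\<bar> \<le> d" using a(2)[of z] b(2)[of z] a(2)[OF z0J] b(2)[OF z0J] by (simp add: d_def)
    moreover have "\<bar>q - h' s z0\<bar> \<le> R / (2 * d)" using q lohi by (auto simp: lo_def hi_def)
    ultimately have "\<bar>q - h' s z0\<bar> * \<bar>z - z0\<bar> \<le> R / (2 * d) * d"
      using R d by (intro mult_mono) auto
    thus ?thesis using d by (simp add: abs_mult)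
  qed
  moreover have "(\<integral>\<^sup>+ z. ennreal (\<bar>z\<bar> powr (1 / s - 2)) * indicator (section_of (h s) z0 (\<beta> * R)) z \<partial>lborel)
      \<le> ennreal (16 * K * \<beta> * (hi - lo))"
  proof -
    have "(\<integral>\<^sup>+ z. ennreal (\<bar>z\<bar> powr (1 / s - 2)) * indicator (section_of (h s) z0 (\<beta> * R)) z \<partial>lborel)
        \<le> (\<integral>\<^sup>+ z. ennreal (\<bar>z\<bar> powr (1 / s - 2)) * indicator {a..b} z \<partial>lborel)"
      using sec a(2) b(2) by (intro nn_integral_mono) (auto simp: indicator_def subset_iff)
    also have "\<dots> \<le> ennreal (h' s b - h' s a)" using ab by (intro nn_integral_h''[OF s]) simp
    also have "\<dots> \<le> ennreal (16 * K * \<beta> * (hi - lo))" using hab by (intro ennreal_leI) (simp add: hl)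
    finally show ?thesis .
  qed
  moreover have "lo \<le> hi" using hl lohi by simp
  ultimately show thesis by (intro that[of lo hi])
qed

section \<open>The linearized operator at a contact point\<close>

lemma cylinder_iff: "(x, z) \<in> cylinder \<phi> p0 R0 \<longleftrightarrow> x \<in> section_of \<phi> p0 R0"
  by (simp add: cylinder_def)

lemma class_SD:
  assumes "W \<in> class_S s \<phi> p0 R0"
  shows "(x, z) \<in> cylinder \<phi> p0 R0 \<Longrightarrow> W (x, - z) = W (x, z)"
    and "continuous_on (cylinder \<phi> p0 R0) W"
    and "Ck_on 2 (cylinder \<phi> p0 R0 - Z0) W"
    and "x \<in> section_of \<phi> p0 R0 \<Longrightarrow> ((\<lambda>z. D_z W x z) \<longlongrightarrow> D_z_0plus W x) (at_right 0)"
proof -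
  show "(x, z) \<in> cylinder \<phi> p0 R0 \<Longrightarrow> W (x, - z) = W (x, z)"
    "continuous_on (cylinder \<phi> p0 R0) W" "Ck_on 2 (cylinder \<phi> p0 R0 - Z0) W"
    using assms by (auto simp: class_S_def)
  assume "x \<in> section_of \<phi> p0 R0"
  then obtain l where "((\<lambda>z. D_z W x z) \<longlongrightarrow> l) (at_right 0)" using assms by (auto simp: class_S_def)
  moreover from this have "D_z_0plus W x = l"
    unfolding D_z_0plus_def by (intro tendsto_Lim) auto
  ultimately show "((\<lambda>z. D_z W x z) \<longlongrightarrow> D_z_0plus W x) (at_right 0)" by simp
qed

text \<open>
  By evenness for \<open>z < 0\<close> and by continuity for \<open>z = 0\<close>.
\<close>

lemma nonneg_on_cylinder:
  assumes W: "W \<in> class_S s \<phi> p0 R0"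
    and pos: "\<And>X. X \<in> cylinder \<phi> p0 R0 \<Longrightarrow> 0 < snd X \<Longrightarrow> 0 \<le> W X"
    and X: "X \<in> cylinder \<phi> p0 R0"
  shows "0 \<le> W X"
proof -
  obtain x z where Xe: "X = (x, z)" by (cases X)
  have cyl: "(x, t) \<in> cylinder \<phi> p0 R0" for t using X by (simp add: Xe cylinder_iff)
  consider "0 < z" | "z < 0" | "z = 0" by linarith
  thus ?thesis
  proof cases
    case 1 thus ?thesis using pos X by (simp add: Xe)
  next
    case 2 thus ?thesis using pos[OF cyl[of "- z"]] class_SD(1)[OF W cyl[of z]] by (simp add: Xe)
  next
    case 3
    have "continuous_on UNIV (\<lambda>t. W (x, t))"
      by (rule continuous_on_compose2[OF class_SD(2)[OF W]]) (auto intro!: continuous_intros cyl)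
    hence "((\<lambda>t. W (x, t)) \<longlongrightarrow> W (x, 0)) (at_right 0)"
      by (auto simp: continuous_on_eq_continuous_within continuous_within intro: tendsto_within_subset)
    moreover have "\<forall>\<^sub>F t in at_right 0. 0 \<le> W (x, t)"
      using pos[OF cyl] by (auto simp: eventually_at_filter)
    ultimately show ?thesis using 3 Xe by (metis tendsto_lowerbound trivial_limit_at_right_real)
  qed
qed

lemma grad_prod:
  fixes F :: "('a::euclidean_space \<times> real) \<Rightarrow> real"
  assumes F: "(F has_derivative (\<lambda>v. G \<bullet> v)) (at (x, z))"
  shows "grad (\<lambda>y. F (y, z)) x = fst G" and "((\<lambda>t. F (x, t)) has_real_derivative snd G) (at z)"
proof -
  have "((\<lambda>y. (y, z)) has_derivative (\<lambda>v. (v, 0))) (at x)" by (auto intro!: derivative_eq_intros)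
  from has_derivative_compose[OF this F]
  have "((\<lambda>y. F (y, z)) has_derivative (\<lambda>v. v \<bullet> fst G)) (at x)"
    by (rule has_derivative_eq_rhs) (auto simp: inner_prod_def inner_commute)
  thus "grad (\<lambda>y. F (y, z)) x = fst G" by (intro grad_eqI) (simp add: gderiv_def)
  have "((\<lambda>t. (x, t)) has_derivative (\<lambda>h. (0, h))) (at z)" by (auto intro!: derivative_eq_intros)
  from has_derivative_compose[OF this F]
  show "((\<lambda>t. F (x, t)) has_real_derivative snd G) (at z)"
    unfolding has_field_derivative_def
    by (rule has_derivative_eq_rhs) (auto simp: inner_prod_def)
qed

lemma slice_derivatives:
  fixes W :: "(real ^ 'n) \<times> real \<Rightarrow> real"
  assumes W: "Ck_on 2 U W" "open U" and X: "(x, z) \<in> U"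
  shows "D_z W x z = snd (grad W (x, z))"
    and "D_xx W x z *v v = fst (D2 W (x, z) (v, 0))"
    and "D_zz W x z = snd (D2 W (x, z) (0, 1))"
    and "((\<lambda>t. W (x, t)) has_real_derivative D_z W x z) (at z)"
proof -
  have dif: "(W has_derivative (\<lambda>v. grad W Y \<bullet> v)) (at Y)" if "Y \<in> U" for Y
    using W that by (intro has_derivative_grad(1)) (auto simp: numeral_2_eq_2)
  have Dz: "D_z W x t = snd (grad W (x, t))" if "(x, t) \<in> U" for t
    unfolding D_z_def by (rule DERIV_imp_deriv[OF grad_prod(2)[OF dif[OF that]]])
  show "D_z W x z = snd (grad W (x, z))" by (rule Dz[OF X])
  show "((\<lambda>t. W (x, t)) has_real_derivative D_z W x z) (at z)"
    unfolding Dz[OF X] by (rule grad_prod(2)[OF dif[OF X]])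
  have d2: "(grad W has_derivative D2 W (x, z)) (at (x, z))" by (rule has_derivative_grad_D2[OF W X])
  have op: "open {y. (y, z) \<in> U}" "open {t. (x, t) \<in> U}"
  proof -
    have "{y. (y, z) \<in> U} = (\<lambda>y. (y, z)) -` U" "{t. (x, t) \<in> U} = (\<lambda>t. (x, t)) -` U" by auto
    thus "open {y. (y, z) \<in> U}" "open {t. (x, t) \<in> U}"
      using W(2) by (auto intro!: open_vimage continuous_intros)
  qed
  have "((\<lambda>y. (y, z)) has_derivative (\<lambda>v. (v, 0))) (at x)" by (auto intro!: derivative_eq_intros)
  from has_derivative_fst[OF has_derivative_compose[OF this d2]]
  have "(grad (\<lambda>y. W (y, z)) has_derivative (\<lambda>v. fst (D2 W (x, z) (v, 0)))) (at x)"
    by (rule has_derivative_transform_within_open[OF _ op(1)]) (use X grad_prod(1)[OF dif] in auto)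
  thus "D_xx W x z *v v = fst (D2 W (x, z) (v, 0))" unfolding D_xx_def by (rule hess_mult_vec)
  have "((\<lambda>t. (x, t)) has_derivative (\<lambda>h. (0, h))) (at z)" by (auto intro!: derivative_eq_intros)
  from has_derivative_snd[OF has_derivative_compose[OF this d2]]
  have "(D_z W x has_derivative (\<lambda>h. snd (D2 W (x, z) (0, h)))) (at z)"
    by (rule has_derivative_transform_within_open[OF _ op(2)]) (use X Dz in auto)
  moreover have "(\<lambda>h. snd (D2 W (x, z) (0, h))) = (*) (snd (D2 W (x, z) (0, 1)))"
  proof
    fix h :: real
    have "D2 W (x, z) (h *\<^sub>R (0, 1)) = h *\<^sub>R D2 W (x, z) (0, 1)"
      by (rule linear_scale[OF linear_D2[OF W X]])
    thus "snd (D2 W (x, z) (0, h)) = snd (D2 W (x, z) (0, 1)) * h" by (simp add: mult.commute)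
  qed
  ultimately show "D_zz W x z = snd (D2 W (x, z) (0, 1))"
    unfolding D_zz_def by (intro DERIV_imp_deriv) (simp add: has_field_derivative_def)
qed

text \<open>
  The block diagonal Hessian of \<open>Phi s \<phi>\<close> at a point with \<open>z \<noteq> 0\<close>.
\<close>

definition hess_Phi :: "real \<Rightarrow> (real ^ 'n \<Rightarrow> real) \<Rightarrow> (real ^ 'n) \<times> real \<Rightarrow> (real ^ 'n) \<times> real \<Rightarrow> (real ^ 'n) \<times> real" where
  "hess_Phi s \<phi> X v = (hess \<phi> (fst X) *v fst v, \<bar>snd X\<bar> powr (1 / s - 2) * snd v)"

text \<open>
  The sign condition on \<open>L_Phi\<close> is the trace condition of the determinant inequality. The mixed derivatives
  of \<open>W\<close> in \<open>x\<close> and \<open>z\<close> do not contribute to the trace since the Hessian of \<open>\<Phi>\<close> is block diagonal.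
\<close>

lemma edet_perturbed_hess_Phi_le:
  fixes \<phi> :: "real ^ 'n \<Rightarrow> real"
  assumes \<phi>: "Ck_on 2 UNIV \<phi>" and pd: "\<And>x. pos_def (hess \<phi> x)"
    and W: "Ck_on 2 U W" "open U" and X: "X \<in> U" "0 < snd X"
    and L: "0 \<le> L_Phi s \<phi> W X" and R: "0 < R"
    and psd: "\<And>v. 0 \<le> v \<bullet> (hess_Phi s \<phi> X v + R *\<^sub>R D2 W X v)"
  shows "\<bar>edet (\<lambda>v. hess_Phi s \<phi> X v + R *\<^sub>R D2 W X v)\<bar> \<le> MA_density \<phi> (fst X) * \<bar>snd X\<bar> powr (1 / s - 2)"
proof -
  obtain x z where Xe: "X = (x, z)" by (cases X)
  have z: "0 < z" using X(2) by (simp add: Xe)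
  define H where "H = hess \<phi> x"
  define w where "w = z powr (1 / s - 2)"
  have w: "0 < w" using z by (simp add: w_def)
  have Hs: "(H *v u) \<bullet> v = u \<bullet> (H *v v)" for u v
    unfolding H_def hess_eq_D2[OF \<phi>] by (rule D2_symmetric[OF \<phi> open_UNIV UNIV_I])
  have hP: "hess_Phi s \<phi> X = (\<lambda>v. (H *v fst v, w * snd v))"
    using z by (auto simp: hess_Phi_def Xe H_def w_def)
  have lin: "linear (hess_Phi s \<phi> X)"
    unfolding hP by (rule linearI) (auto simp: matrix_vector_right_distrib matrix_vector_mult_scaleR algebra_simps)
  define G where "G v = (matrix_inv H *v fst v, (1 / w) * snd v)" for v :: "(real ^ 'n) \<times> real"
  have linG: "linear G"
    unfolding G_def by (rule linearI) (auto simp: matrix_vector_right_distrib matrix_vector_mult_scaleR algebra_simps add_divide_distrib)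
  have linD: "linear (D2 W X)" by (rule linear_D2[OF W X(1)])
  have tr: "etrace (\<lambda>v. G (R *\<^sub>R D2 W X v)) = - R * L_Phi s \<phi> W X"
  proof -
    have Basis: "etrace F = (\<Sum>b\<in>Basis. fst (F (b, 0)) \<bullet> b) + snd (F (0, 1))" for F :: "(real ^ 'n) \<times> real \<Rightarrow> (real ^ 'n) \<times> real"
    proof -
      have "(\<Sum>b\<in>(\<lambda>u. (u, 0 :: real)) ` (Basis :: (real ^ 'n) set) \<union> (\<lambda>u. (0, u)) ` Basis. F b \<bullet> b)
          = (\<Sum>b\<in>(\<lambda>u. (u, 0 :: real)) ` (Basis :: (real ^ 'n) set). F b \<bullet> b) + (\<Sum>b\<in>(\<lambda>u. (0, u)) ` (Basis :: real set). F b \<bullet> b)"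
        by (rule sum.union_disjoint) auto
      also have "\<dots> = (\<Sum>b\<in>Basis. fst (F (b, 0)) \<bullet> b) + snd (F (0, 1))"
        by (subst (1 2) sum.reindex) (auto simp: inj_on_def inner_prod_def)
      finally show ?thesis by (simp add: etrace_def Basis_prod_def)
    qed
    have "(\<Sum>b\<in>Basis. (matrix_inv H *v (D_xx W x z *v b)) \<bullet> b) = trace (matrix_inv H ** D_xx W x z)"
    proof -
      have "(\<Sum>b\<in>Basis. (matrix_inv H *v (D_xx W x z *v b)) \<bullet> b) =
          (\<Sum>i\<in>UNIV. ((matrix_inv H ** D_xx W x z) *v axis i 1) \<bullet> axis i 1)"
        by (subst sum.reindex_bij_betw[symmetric, of "\<lambda>i. axis i 1" UNIV])
           (auto simp: bij_betw_def inj_on_def axis_eq_axis Basis_vec_def matrix_vector_mul_assoc)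
      also have "\<dots> = trace (matrix_inv H ** D_xx W x z)"
        by (simp add: trace_def matrix_vector_mult_basis column_def inner_axis)
      finally show ?thesis .
    qed
    moreover have "z powr (2 - 1 / s) = 1 / w" using z by (simp add: w_def powr_diff)
    moreover have "(\<Sum>b\<in>Basis. fst (G (R *\<^sub>R D2 W X (b, 0))) \<bullet> b) = R * (\<Sum>b\<in>Basis. (matrix_inv H *v (D_xx W x z *v b)) \<bullet> b)"
      using X(1) by (simp add: G_def Xe slice_derivatives(2)[OF W] sum_distrib_left matrix_vector_mult_scaleR)
    ultimately show ?thesis
      using X(1) z by (simp add: Basis L_Phi_def Xe H_def[symmetric] G_def slice_derivatives(3)[OF W] algebra_simps)
  qed
  have "\<bar>edet (\<lambda>v. hess_Phi s \<phi> X v + R *\<^sub>R D2 W X v)\<bar> \<le> \<bar>edet (hess_Phi s \<phi> X)\<bar>"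
  proof (rule edet_le_edet_if_trace_nonpos[OF lin _ _ _ _ psd linG])
    show "hess_Phi s \<phi> X u \<bullet> v = u \<bullet> hess_Phi s \<phi> X v" for u v
      by (simp add: hP inner_prod_def Hs)
    fix v :: "(real ^ 'n) \<times> real" assume v: "v \<noteq> 0"
    have *: "0 < u \<bullet> (H *v u)" if "u \<noteq> 0" for u using pd[of x] that by (simp add: pos_def_def H_def)
    have "0 < fst v \<bullet> (H *v fst v) + snd v * (w * snd v)"
    proof (cases "fst v = 0")
      case True
      hence "snd v \<noteq> 0" using v by (simp add: prod_eq_iff)
      hence "0 < w * (snd v * snd v)" using w by (simp add: mult_pos_pos zero_less_mult_iff) (metis linorder_neqE_linordered_idom)
      thus ?thesis using True by (simp add: mult_ac)
    next
      case False
      have "0 \<le> w * (snd v * snd v)" using w by simp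
      hence "0 \<le> snd v * (w * snd v)" by (simp only: mult_ac)
      thus ?thesis using *[OF False] by linarith
    qed
    thus "0 < v \<bullet> hess_Phi s \<phi> X v" by (simp add: hP inner_prod_def)
  next
    show "linear (\<lambda>v. R *\<^sub>R D2 W X v)" using linear_compose_scale_right[OF linD] .
    show "(R *\<^sub>R D2 W X u) \<bullet> v = u \<bullet> (R *\<^sub>R D2 W X v)" for u v
      using D2_symmetric[OF W X(1), of u v] by simp
    show "G (hess_Phi s \<phi> X v) = v" for v
      using w by (simp add: G_def hP matrix_inv_vec[OF pd, of x, folded H_def])
    show "etrace (\<lambda>v. G (R *\<^sub>R D2 W X v)) \<le> 0"
      unfolding tr using L R by simp
  qed
  also have "\<bar>edet (hess_Phi s \<phi> X)\<bar> = \<bar>det H\<bar> * \<bar>w\<bar>"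
    unfolding hP by (subst edet_prod_scale) (auto simp: edet_matrix matrix_vector_mul_linear)
  also have "\<dots> = MA_density \<phi> (fst X) * \<bar>snd X\<bar> powr (1 / s - 2)"
    using det_pos_if_pos_def[OF pd, of x] w z by (simp add: MA_density_def H_def Xe w_def)
  finally show ?thesis .
qed

section \<open>Contact points\<close>

lemma grad_Phi_eq:
  fixes \<phi> :: "real ^ 'n \<Rightarrow> real"
  assumes s: "0 < s" "s < 1" and \<phi>: "Ck_on 2 UNIV \<phi>"
  shows "(Phi s \<phi> has_derivative (\<lambda>v. (grad \<phi> (fst X), h' s (snd X)) \<bullet> v)) (at X)"
    and "grad (Phi s \<phi>) X = (grad \<phi> (fst X), h' s (snd X))"
proof -
  have "((\<lambda>X. \<phi> (fst X) + h s (snd X)) has_derivative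
      (\<lambda>v. grad \<phi> (fst X) \<bullet> fst v + grad (h s) (snd X) \<bullet> snd v)) (at X)"
    by (intro has_derivative_add has_derivative_compose[OF has_derivative_fst[OF has_derivative_ident] has_derivative_grad_C2[OF \<phi>]]
        has_derivative_compose[OF has_derivative_snd[OF has_derivative_ident] has_derivative_h[OF s]])
  moreover have "Phi s \<phi> = (\<lambda>X. \<phi> (fst X) + h s (snd X))" by (auto simp: Phi_def)
  ultimately show *: "(Phi s \<phi> has_derivative (\<lambda>v. (grad \<phi> (fst X), h' s (snd X)) \<bullet> v)) (at X)"
    by (simp add: inner_prod_def grad_h[OF s])
  show "grad (Phi s \<phi>) X = (grad \<phi> (fst X), h' s (snd X))"
    using * by (intro grad_eqI) (simp add: gderiv_def inner_commute)
qed

lemma bregman_Phi: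
  fixes \<phi> :: "real ^ 'n \<Rightarrow> real"
  assumes s: "0 < s" "s < 1" and \<phi>: "Ck_on 2 UNIV \<phi>"
  shows "bregman (Phi s \<phi>) X Y = bregman \<phi> (fst X) (fst Y) + bregman (h s) (snd X) (snd Y)"
  unfolding bregman_def grad_Phi_eq(2)[OF s \<phi>] grad_h[OF s]
  by (simp add: Phi_def case_prod_beta inner_prod_def)

lemma bregman_Phi_pos:
  fixes \<phi> :: "real ^ 'n \<Rightarrow> real"
  assumes s: "0 < s" "s < 1" and \<phi>: "Ck_on 2 UNIV \<phi>" and pd: "\<And>x. pos_def (hess \<phi> x)"
  shows "X \<noteq> Y \<Longrightarrow> 0 < bregman (Phi s \<phi>) X Y"
proof -
  assume "X \<noteq> Y"
  have nonneg: "0 \<le> bregman \<phi> x y" for x y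
    using bregman_pos_C2[OF \<phi> pd, of x y] by (cases "x = y") auto
  show ?thesis
  proof (cases "fst X = fst Y")
    case True
    hence "snd X \<noteq> snd Y" using \<open>X \<noteq> Y\<close> by (simp add: prod_eq_iff)
    thus ?thesis unfolding bregman_Phi[OF s \<phi>]
      using bregman_h_pos[OF s] nonneg by (simp add: add_nonneg_pos)
  next
    case False
    thus ?thesis unfolding bregman_Phi[OF s \<phi>]
      using bregman_pos_C2[OF \<phi> pd] bregman_h_nonneg[OF s] by (simp add: add_pos_nonneg)
  qed
qed

lemma section_Phi_subset_Times:
  fixes \<phi> :: "real ^ 'n \<Rightarrow> real"
  assumes s: "0 < s" "s < 1" and \<phi>: "Ck_on 2 UNIV \<phi>" and pd: "\<And>x. pos_def (hess \<phi> x)"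
  shows "section_of (Phi s \<phi>) X0 t \<subseteq> section_of \<phi> (fst X0) t \<times> section_of (h s) (snd X0) t"
proof
  fix X assume "X \<in> section_of (Phi s \<phi>) X0 t"
  moreover have "0 \<le> bregman \<phi> (fst X0) (fst X)"
    using bregman_pos_C2[OF \<phi> pd, of "fst X0" "fst X"] by (cases "fst X0 = fst X") auto
  ultimately show "X \<in> section_of \<phi> (fst X0) t \<times> section_of (h s) (snd X0) t"
    using bregman_h_nonneg[OF s, of "snd X0" "snd X"]
    by (auto simp: section_of_def bregman_Phi[OF s \<phi>] mem_Times_iff)
qed

lemma continuous_on_Phi:
  fixes \<phi> :: "real ^ 'n \<Rightarrow> real"
  assumes s: "0 < s" "s < 1" and \<phi>: "Ck_on 2 UNIV \<phi>"
  shows "continuous_on S (Phi s \<phi>)"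
  using grad_Phi_eq(1)[OF s \<phi>] by (meson continuous_at_imp_continuous_on has_derivative_continuous)

text \<open>
  The slope \<open>P\<close> for which \<open>X\<close> is a critical point of \<open>R * W + \<Phi> - P \<bullet> X\<close>.
\<close>

definition touching_slope :: "real \<Rightarrow> (real ^ 'n \<Rightarrow> real) \<Rightarrow> real \<Rightarrow> ((real ^ 'n) \<times> real \<Rightarrow> real) \<Rightarrow> (real ^ 'n) \<times> real \<Rightarrow> (real ^ 'n) \<times> real" where
  "touching_slope s \<phi> R W X = R *\<^sub>R grad W X + (grad \<phi> (fst X), h' s (snd X))"

lemma has_derivative_touching_slope:
  fixes \<phi> :: "real ^ 'n \<Rightarrow> real"
  assumes s: "0 < s" "s < 1" and \<phi>: "Ck_on 2 UNIV \<phi>"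
    and W: "Ck_on 2 U W" "open U" and X: "X \<in> U" "0 < snd X"
  shows "(touching_slope s \<phi> R W has_derivative (\<lambda>v. hess_Phi s \<phi> X v + R *\<^sub>R D2 W X v)) (at X)"
proof -
  have "((\<lambda>Y. grad \<phi> (fst Y)) has_derivative (\<lambda>v. D2 \<phi> (fst X) (fst v))) (at X)"
    by (rule has_derivative_compose[OF has_derivative_fst[OF has_derivative_ident]
          has_derivative_grad_D2[OF \<phi> open_UNIV UNIV_I]])
  moreover have "((\<lambda>Y. h' s (snd Y)) has_derivative (\<lambda>v. snd v * snd X powr (1 / s - 2))) (at X)"
  proof -
    have "(h' s has_derivative (\<lambda>v. v * snd X powr (1 / s - 2))) (at (snd X))"
      using h'_has_derivative[OF s X(2)] unfolding has_field_derivative_def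
      by (rule has_derivative_eq_rhs) (simp add: fun_eq_iff)
    from has_derivative_compose[OF has_derivative_snd[OF has_derivative_ident] this] show ?thesis .
  qed
  moreover have "(grad W has_derivative D2 W X) (at X)"
    by (rule has_derivative_grad_D2[OF W X(1)])
  ultimately have "((\<lambda>Y. R *\<^sub>R grad W Y + (grad \<phi> (fst Y), h' s (snd Y))) has_derivative
      (\<lambda>v. R *\<^sub>R D2 W X v + (D2 \<phi> (fst X) (fst v), snd v * snd X powr (1 / s - 2)))) (at X)"
    by (intro has_derivative_add has_derivative_Pair has_derivative_scaleR_right)
  thus ?thesis unfolding touching_slope_def[abs_def]
    by (rule has_derivative_eq_rhs) (use X(2) in \<open>auto simp: hess_Phi_def hess_eq_D2[OF \<phi>] fun_eq_iff\<close>)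
qed

text \<open>
  Otherwise the one-sided derivative in \<open>z\<close> at \<open>0\<close>, which is \<open>R * W\<^sub>z(x,0+) - q\<close> as \<open>h'\<close> vanishes at \<open>0\<close>, is
  negative, and the function decreases on leaving \<open>z = 0\<close>.
\<close>

lemma no_contact_on_Z0:
  fixes W :: "(real ^ 'n) \<times> real \<Rightarrow> real"
  assumes s: "0 < s" "s < 1" and R: "0 < R"
    and W: "W \<in> class_S s \<phi> p0 R0" and op: "open (cylinder \<phi> p0 R0)" and x: "(x, 0) \<in> cylinder \<phi> p0 R0"
    and t0: "0 < t0" and min: "\<And>t. 0 < t \<Longrightarrow> t < t0 \<Longrightarrow> R * W (x, 0) \<le> R * W (x, t) + h s t - q * t"
  shows "q \<le> R * D_z_0plus W x"
proof (rule ccontr)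
  assume neg: "\<not> q \<le> R * D_z_0plus W x"
  have cyl: "(x, t) \<in> cylinder \<phi> p0 R0" for t using x by (simp add: cylinder_iff)
  define k where "k t = R * W (x, t) + h s t - q * t" for t
  define k' where "k' t = R * D_z W x t + h' s t - q" for t
  have contk: "continuous_on UNIV k"
    unfolding k_def
    by (intro continuous_intros continuous_on_h[OF s] continuous_on_compose2[OF class_SD(2)[OF W]]) (auto simp: cyl)
  have opU: "open (cylinder \<phi> p0 R0 - Z0)"
    by (intro open_Diff op) (simp add: Z0_def closed_Times)
  have derk: "(k has_real_derivative k' t) (at t)" if "0 < t" for t
  proof -
    have "(x, t) \<in> cylinder \<phi> p0 R0 - Z0" using that cyl by (simp add: Z0_def)
    note slice_derivatives(4)[OF class_SD(3)[OF W] opU this]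
    thus ?thesis unfolding k_def k'_def using h_has_derivative[OF s, of t]
      by (auto intro!: derivative_eq_intros)
  qed
  have "((\<lambda>t. h' s t) \<longlongrightarrow> h' s 0) (at_right 0)"
    using continuous_on_h'[OF s, of UNIV]
    by (auto simp: continuous_on_eq_continuous_within continuous_within intro: tendsto_within_subset)
  moreover have "((\<lambda>t. D_z W x t) \<longlongrightarrow> D_z_0plus W x) (at_right 0)"
    by (rule class_SD(4)[OF W]) (use x in \<open>simp add: cylinder_iff\<close>)
  ultimately have "(k' \<longlongrightarrow> R * D_z_0plus W x + h' s 0 - q) (at_right 0)"
    unfolding k'_def by (intro tendsto_intros)
  moreover have "R * D_z_0plus W x + h' s 0 - q < 0" using neg h'_zero[OF s] by simp
  ultimately have "\<forall>\<^sub>F t in at_right 0. k' t < 0" by (rule order_tendstoD(2))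
  then obtain e where e: "0 < e" "\<And>t. 0 < t \<Longrightarrow> t < e \<Longrightarrow> k' t < 0"
    by (auto simp: eventually_at_right_field)
  define t where "t = min e t0 / 2"
  have t: "0 < t" "t < e" "t < t0" using e(1) t0 by (auto simp: t_def)
  obtain l z where lz: "0 < z" "z < t" "(k has_real_derivative l) (at z)" "k t - k 0 = (t - 0) * l"
    using MVT[OF t(1), of k] derk contk continuous_on_subset[OF contk, of "{0..t}"]
    by (metis real_differentiable_def subset_UNIV)
  have "l = k' z" using DERIV_unique[OF lz(3) derk[OF lz(1)]] .
  hence "l < 0" using e(2)[of z] lz(1,2) t by simp
  hence "k t < k 0" using lz(4) mult_pos_neg[OF t(1), of l] by simp
  thus False using min[OF t(1,3)] h_zero[OF s] by (simp add: k_def)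
qed

text \<open>
  The minimizer is sought in the compact section of height \<open>20 R\<close>, which lies inside the section where \<open>W\<close>
  is known.
\<close>

lemma contact_point:
  fixes \<phi> :: "real ^ 'n \<Rightarrow> real" and W :: "(real ^ 'n) \<times> real \<Rightarrow> real"
  assumes s: "0 < s" "s < 1" and \<phi>: "Ck_on 2 UNIV \<phi>" and pd: "\<And>x. pos_def (hess \<phi> x)"
    and R: "0 < R" and T: "36 * R \<le> T"
    and sub: "section_of (Phi s \<phi>) X0 T \<subseteq> cylinder \<phi> p0 R0" (is "?S \<subseteq> _")
    and z0: "0 \<le> snd X0"
    and W: "W \<in> class_S s \<phi> p0 R0"
    and pos: "\<And>X. X \<in> cylinder \<phi> p0 R0 \<Longrightarrow> 0 < snd X \<Longrightarrow> 0 \<le> W X"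
    and X1: "X1 \<in> section_of (Phi s \<phi>) X0 R" "W X1 < 2"
    and small: "\<And>x. (x, 0) \<in> section_of (Phi s \<phi>) X0 T \<Longrightarrow> R * \<bar>D_z_0plus W x\<bar> \<le> \<kappa>" and \<kappa>: "0 \<le> \<kappa>" "\<kappa> < q"
    and Px: "Px \<in> slope_set \<phi> (fst X0) T (R / 2)"
    and q: "\<And>z. z \<in> section_of (h s) (snd X0) T \<Longrightarrow> \<bar>(q - h' s (snd X0)) * (z - snd X0)\<bar> \<le> R / 2"
  obtains X where "X \<in> section_of (Phi s \<phi>) X0 T" "0 < snd X" "W X < 8"
    "touching_slope s \<phi> R W X = (Px, q)"
    "\<And>v. 0 \<le> v \<bullet> (hess_Phi s \<phi> X v + R *\<^sub>R D2 W X v)"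
proof -
  let ?Q = "cylinder \<phi> p0 R0"
  define \<delta> where "\<delta> = bregman (Phi s \<phi>) X0"
  define P where "P = (Px, q)"
  define g where "g X = R * W X + Phi s \<phi> X - P \<bullet> X" for X
  define B where "B = {X. \<delta> X \<le> 20 * R}"
  have nonneg: "0 \<le> W X" if "X \<in> ?Q" for X by (rule nonneg_on_cylinder[OF W pos that])
  have BS: "B \<subseteq> ?S" using T R by (auto simp: B_def section_of_def \<delta>_def)
  have cphi: "continuous_on UNIV \<phi>" by (rule Ck_on_imp_continuous_on[OF \<phi>])
  have cPhi: "continuous_on A (Phi s \<phi>)" for A by (rule continuous_on_Phi[OF s \<phi>])
  have c\<delta>: "continuous_on A \<delta>" for A unfolding \<delta>_def by (rule continuous_on_bregman[OF cPhi])
  have opQ: "open ?Q" unfolding cylinder_def by (intro open_Times open_section_of[OF cphi] open_UNIV)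
  have cW: "continuous_on A W" if "A \<subseteq> ?Q" for A using class_SD(2)[OF W] that continuous_on_subset by blast
  have cg: "continuous_on B g"
    unfolding g_def using BS sub by (intro continuous_intros cW cPhi) auto
  have cB: "compact B"
    unfolding B_def \<delta>_def by (rule compact_bregman_sublevel[OF cPhi bregman_Phi_pos[OF s \<phi> pd]])
  have X1B: "X1 \<in> B" using X1 R by (auto simp: B_def section_of_def \<delta>_def)
  obtain X where X: "X \<in> B" "\<And>Y. Y \<in> B \<Longrightarrow> g X \<le> g Y"
    using continuous_attains_inf[OF cB _ cg] X1B by blast
  have XS: "X \<in> ?S" using X(1) BS by blast
  have XQ: "X \<in> ?Q" using XS sub by blast
  have slope: "\<bar>(grad (Phi s \<phi>) X0 - P) \<bullet> (Y - X0)\<bar> \<le> R" if Y: "Y \<in> ?S" for Y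
  proof -
    have Y': "fst Y \<in> section_of \<phi> (fst X0) T" "snd Y \<in> section_of (h s) (snd X0) T"
      using subsetD[OF section_Phi_subset_Times[OF s \<phi> pd] Y] by (auto simp: mem_Times_iff)
    have "\<bar>(Px - grad \<phi> (fst X0)) \<bullet> (fst Y - fst X0)\<bar> \<le> R / 2" using Px Y'(1) by (simp add: slope_set_def)
    moreover have "\<bar>(q - h' s (snd X0)) * (snd Y - snd X0)\<bar> \<le> R / 2" by (rule q[OF Y'(2)])
    moreover have "(grad (Phi s \<phi>) X0 - P) \<bullet> (Y - X0) =
        - ((Px - grad \<phi> (fst X0)) \<bullet> (fst Y - fst X0)) - (q - h' s (snd X0)) * (snd Y - snd X0)"
      by (simp add: grad_Phi_eq(2)[OF s \<phi>] P_def inner_prod_def inner_diff_left algebra_simps)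
    ultimately show ?thesis by linarith
  qed
  have g_diff: "g Y - g X1 = R * W Y - R * W X1 + \<delta> Y - \<delta> X1
      + (grad (Phi s \<phi>) X0 - P) \<bullet> (Y - X0) - (grad (Phi s \<phi>) X0 - P) \<bullet> (X1 - X0)" for Y
    by (simp add: g_def \<delta>_def bregman_def inner_simps)
  have X1': "\<delta> X1 < R" "R * W X1 < R * 2" using X1 R by (auto simp: section_of_def \<delta>_def)
  have "g X - g X1 \<le> 0" using X(2)[OF X1B] by simp
  \<comment> \<open>The losses are \<open>2 R\<close> from \<open>W X1\<close>, \<open>R\<close> from the divergence of \<open>X1\<close>, and \<open>R\<close> from the slope at each of
    \<open>X\<close> and \<open>X1\<close>. Both the bound on \<open>W X\<close> and the interiority of \<open>X\<close> follow.\<close>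
  hence key: "R * W X + \<delta> X < 5 * R"
    using g_diff[of X] X1' slope[OF XS] slope[OF subsetD[OF BS X1B]] by linarith
  have "0 \<le> \<delta> X"
    unfolding \<delta>_def using bregman_Phi_pos[OF s \<phi> pd, of X0 X] by (cases "X0 = X") auto
  hence "R * W X < R * 5" using key by linarith
  hence W5: "W X < 5" using R by simp
  have "0 \<le> R * W X" using nonneg[OF XQ] R by simp
  hence \<delta>5: "\<delta> X < 20 * R" using key R by linarith
  define O' where "O' = {Y. \<delta> Y < 20 * R}"
  have opO: "open O'" unfolding O'_def by (intro open_Collect_less c\<delta> continuous_intros)
  have OB: "O' \<subseteq> B" by (auto simp: O'_def B_def)
  obtain x z where Xe: "X = (x, z)" by (cases X)
  have "0 < z"
  proof (rule ccontr)
    assume "\<not> 0 < z"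
    then consider "z < 0" | "z = 0" by linarith
    thus False
    proof cases
      case 1
      have "\<delta> (x, - z) = \<delta> X + 2 * (h' s (snd X0) * z)"
        using h_minus[OF s, of z]
        by (simp add: \<delta>_def bregman_Phi[OF s \<phi>] bregman_h[OF s] Xe algebra_simps)
      moreover have "h' s (snd X0) * z \<le> 0"
      proof -
        have "0 \<le> h' s (snd X0)"
          using h'_strict_mono_nonneg[OF s, of 0 "snd X0"] z0 h'_zero[OF s] by (cases "snd X0 = 0") auto
        thus ?thesis using 1 by (simp add: mult_nonneg_nonpos)
      qed
      ultimately have "(x, - z) \<in> B" using X(1) by (simp add: B_def)
      hence "g X \<le> g (x, - z)" by (rule X(2))
      moreover have "g (x, - z) = g X + 2 * (q * z)"
        using class_SD(1)[OF W, of x z] XQ h_minus[OF s, of z] by (simp add: g_def Xe Phi_def P_def)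
      moreover have "q * z < 0" using 1 \<kappa> by (simp add: mult_pos_neg)
      ultimately show False by linarith
    next
      case 2
      have "(x, 0) \<in> O'" using \<delta>5 by (simp add: O'_def Xe 2)
      moreover have "open ((\<lambda>t. (x, t)) -` O')" by (intro open_vimage opO continuous_intros)
      ultimately obtain t0 where t0: "0 < t0" "ball 0 t0 \<subseteq> (\<lambda>t. (x, t)) -` O'"
        by (metis openE vimageI2)
      have "q \<le> R * D_z_0plus W x"
      proof (rule no_contact_on_Z0[OF s R W opQ _ t0(1)])
        show "(x, 0) \<in> ?Q" using XQ by (simp add: Xe 2)
        fix t assume t: "0 < t" "t < t0"
        hence "(x, t) \<in> B" using t0(2) OB by (auto simp: subset_iff)
        hence "g X \<le> g (x, t)" by (rule X(2))
        thus "R * W (x, 0) \<le> R * W (x, t) + h s t - q * t"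
          using h_zero[OF s] by (simp add: g_def Xe 2 Phi_def P_def inner_prod_def)
      qed
      also have "\<dots> \<le> R * \<bar>D_z_0plus W x\<bar>" using R by (intro mult_left_mono) auto
      also have "\<dots> \<le> \<kappa>" using small XS by (simp add: Xe 2)
      finally show False using \<kappa>(2) by simp
    qed
  qed
  hence z: "0 < snd X" by (simp add: Xe)
  define U where "U = ?Q - Z0"
  have opU: "open U" unfolding U_def by (intro open_Diff opQ) (simp add: Z0_def closed_Times)
  have WU: "Ck_on 2 U W" unfolding U_def by (rule class_SD(3)[OF W])
  define V where "V = O' \<inter> {Y. 0 < snd Y}"
  have opV: "open V" unfolding V_def by (intro open_Int opO open_Collect_less continuous_intros)
  have VU: "V \<subseteq> U" using OB BS sub by (auto simp: V_def U_def Z0_def)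
  have XV: "X \<in> V" using z \<delta>5 by (simp add: V_def O'_def)
  define G where "G Y = touching_slope s \<phi> R W Y - P" for Y
  have der: "(g has_derivative (\<lambda>v. G Y \<bullet> v)) (at Y)" if Y: "Y \<in> V" for Y
  proof -
    have "(W has_derivative (\<lambda>v. grad W Y \<bullet> v)) (at Y)"
      using WU Y VU by (intro has_derivative_grad(1)) (auto simp: numeral_2_eq_2)
    from has_derivative_diff[OF has_derivative_add[OF has_derivative_mult_right[OF this, of R]
          grad_Phi_eq(1)[OF s \<phi>, of Y]] has_derivative_inner_right[OF has_derivative_ident, of P]]
    show ?thesis unfolding g_def G_def touching_slope_def
      by (rule has_derivative_eq_rhs) (auto simp: inner_simps fun_eq_iff)
  qed
  have XU: "X \<in> U" using XV VU by blast
  have derG: "(G has_derivative (\<lambda>v. hess_Phi s \<phi> X v + R *\<^sub>R D2 W X v)) (at X)"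
    unfolding G_def[abs_def]
    using has_derivative_diff[OF has_derivative_touching_slope[OF s \<phi> WU opU XU z] has_derivative_const] by simp
  have "V \<subseteq> B" using OB by (auto simp: V_def)
  hence minV: "g X \<le> g Y" if "Y \<in> V" for Y using X(2)[of Y] that by blast
  have "G X = 0" by (rule local_min_D2_nonneg(1)[OF der derG opV XV minV])
  moreover have "0 \<le> v \<bullet> (hess_Phi s \<phi> X v + R *\<^sub>R D2 W X v)" for v
    by (rule local_min_D2_nonneg(2)[OF der derG opV XV minV])
  ultimately show thesis using XS z W5 by (intro that[of X]) (auto simp: G_def P_def)
qed

lemma mu_Phi_Times:
  fixes \<phi> :: "real ^ 'n \<Rightarrow> real"
  assumes \<phi>: "Ck_on 2 UNIV \<phi>" and pd: "\<And>x. pos_def (hess \<phi> x)"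
    and A: "A \<in> sets borel" and B: "B \<in> sets borel"
  shows "emeasure (mu_Phi s \<phi>) (A \<times> B) =
    emeasure (MA_measure \<phi>) A * (\<integral>\<^sup>+ z. ennreal (\<bar>z\<bar> powr (1 / s - 2)) * indicator B z \<partial>lborel)"
proof -
  have m [measurable]: "MA_density \<phi> \<in> borel_measurable borel"
    by (rule borel_measurable_continuous_onI[OF continuous_on_MA_density[OF \<phi>]])
  note A [measurable] B [measurable]
  have AB: "A \<times> B \<in> sets lborel" by (simp add: borel_prod[symmetric])
  have nn: "0 \<le> MA_density \<phi> x" for x
    unfolding MA_density_def using det_pos_if_pos_def[OF pd] by (rule less_imp_le)
  have dens: "(\<lambda>(x, z). ennreal (MA_density \<phi> x * \<bar>z\<bar> powr (1 / s - 2))) \<in> borel_measurable (lborel \<Otimes>\<^sub>M lborel)"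
    by measurable
  have "emeasure (mu_Phi s \<phi>) (A \<times> B) =
      (\<integral>\<^sup>+ X. (case X of (x, z) \<Rightarrow> ennreal (MA_density \<phi> x * \<bar>z\<bar> powr (1 / s - 2))) * indicator (A \<times> B) X \<partial>lborel)"
    unfolding mu_Phi_def using dens AB by (subst emeasure_density) (auto simp: lborel_prod)
  also have "\<dots> = (\<integral>\<^sup>+ X. (case X of (x, z) \<Rightarrow> ennreal (MA_density \<phi> x) * indicator A x * (ennreal (\<bar>z\<bar> powr (1 / s - 2)) * indicator B z))
      \<partial>(lborel \<Otimes>\<^sub>M lborel))"
    unfolding lborel_prod
    by (intro nn_integral_cong) (auto simp: indicator_def ennreal_mult nn)
  also have "\<dots> = (\<integral>\<^sup>+ x. (\<integral>\<^sup>+ z. ennreal (MA_density \<phi> x) * indicator A x * (ennreal (\<bar>z\<bar> powr (1 / s - 2)) * indicator B z) \<partial>lborel) \<partial>lborel)"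
    by (subst lborel.nn_integral_fst[symmetric]) (auto simp: case_prod_beta)
  also have "\<dots> = (\<integral>\<^sup>+ x. ennreal (MA_density \<phi> x) * indicator A x \<partial>lborel) *
      (\<integral>\<^sup>+ z. ennreal (\<bar>z\<bar> powr (1 / s - 2)) * indicator B z \<partial>lborel)"
    by (simp add: nn_integral_cmult nn_integral_multc)
  also have "(\<integral>\<^sup>+ x. ennreal (MA_density \<phi> x) * indicator A x \<partial>lborel) = emeasure (MA_measure \<phi>) A"
    unfolding MA_measure_def by (subst emeasure_density) auto
  finally show ?thesis .
qed

text \<open>
  Every admissible slope is attained by \<open>touching_slope\<close> at a contact point, and the Jacobian there is at
  most the density of \<open>mu_Phi\<close>.
\<close>

lemma slopes_le_mu_Phi:
  fixes \<phi> :: "real ^ 'n \<Rightarrow> real" and W :: "(real ^ 'n) \<times> real \<Rightarrow> real"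
  assumes s: "0 < s" "s < 1" and \<phi>: "Ck_on 2 UNIV \<phi>" and pd: "\<And>x. pos_def (hess \<phi> x)"
    and R: "0 < R" and T: "36 * R \<le> T"
    and sub: "section_of (Phi s \<phi>) X0 T \<subseteq> cylinder \<phi> p0 R0" (is "?S \<subseteq> _")
    and z0: "0 \<le> snd X0"
    and W: "W \<in> class_S s \<phi> p0 R0"
    and pos: "\<And>X. X \<in> cylinder \<phi> p0 R0 \<Longrightarrow> 0 < snd X \<Longrightarrow> 0 \<le> W X \<and> 0 \<le> L_Phi s \<phi> W X"
    and X1: "X1 \<in> section_of (Phi s \<phi>) X0 R" "W X1 < 2"
    and small: "\<And>x. (x, 0) \<in> section_of (Phi s \<phi>) X0 T \<Longrightarrow> R * \<bar>D_z_0plus W x\<bar> \<le> \<kappa>" and \<kappa>: "0 \<le> \<kappa>" "\<kappa> < lo"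
    and q: "\<And>q z. q \<in> {lo..hi} \<Longrightarrow> z \<in> section_of (h s) (snd X0) T \<Longrightarrow> \<bar>(q - h' s (snd X0)) * (z - snd X0)\<bar> \<le> R / 2"
    and M: "8 \<le> M"
  shows "emeasure lborel (slope_set \<phi> (fst X0) T (R / 2) \<times> {lo..hi})
    \<le> emeasure (mu_Phi s \<phi>) {X \<in> section_of (Phi s \<phi>) X0 T. W X < M}"
proof -
  let ?Q = "cylinder \<phi> p0 R0"
  define F where "F = touching_slope s \<phi> R W"
  define F' where "F' X v = hess_Phi s \<phi> X v + R *\<^sub>R D2 W X v" for X v
  define d where "d X = MA_density \<phi> (fst X) * \<bar>snd X\<bar> powr (1 / s - 2)" for X :: "(real ^ 'n) \<times> real"
  have cphi: "continuous_on UNIV \<phi>" by (rule Ck_on_imp_continuous_on[OF \<phi>])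
  have opQ: "open ?Q" unfolding cylinder_def by (intro open_Times open_section_of[OF cphi] open_UNIV)
  have opS: "open ?S" by (rule open_section_of[OF continuous_on_Phi[OF s \<phi>]])
  define U where "U = ?Q - Z0"
  have opU: "open U" unfolding U_def by (intro open_Diff opQ) (simp add: Z0_def closed_Times)
  have WU: "Ck_on 2 U W" unfolding U_def by (rule class_SD(3)[OF W])
  define V where "V = ?S \<inter> {X. 0 < snd X}"
  have opV: "open V" unfolding V_def by (intro open_Int opS open_Collect_less continuous_intros)
  have VU: "V \<subseteq> U" using sub by (auto simp: V_def U_def Z0_def)
  have cW: "continuous_on V W" using Ck_on_imp_continuous_on[OF WU] VU continuous_on_subset by blast
  \<comment> \<open>\<open>A\<close> is defined by pointwise conditions rather than as the set of contact points, which makes it Borel.\<close>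
  define A where "A = {X \<in> V. W X < 8} \<inter> {X \<in> V. \<forall>v. 0 \<le> v \<bullet> F' X v}"
  have "A \<in> sets borel"
    unfolding A_def
  proof (rule sets.Int)
    have "{X \<in> V. W X < 8} = V \<inter> W -` {..<8}" by auto
    thus "{X \<in> V. W X < 8} \<in> sets borel" using continuous_open_preimage[OF cW opV, of "{..<8}"] by auto
    have cF: "continuous_on V (\<lambda>X. v \<bullet> F' X v)" for v
    proof -
      have "continuous_on V (\<lambda>X. D2 \<phi> (fst X) (fst v))"
        by (rule continuous_on_compose2[OF continuous_on_D2[OF \<phi>]]) (auto intro: continuous_intros)
      moreover have "continuous_on V (\<lambda>X. D2 W X v)"
        using continuous_on_D2[OF WU] VU continuous_on_subset by blast
      moreover have "continuous_on V (\<lambda>X. \<bar>snd X\<bar> powr (1 / s - 2))"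
        by (intro continuous_intros) (auto simp: V_def)
      ultimately show ?thesis unfolding F'_def hess_Phi_def hess_eq_D2[OF \<phi>]
        by (intro continuous_intros) (auto simp: V_def)
    qed
    have "closedin (top_of_set V) (\<Inter>v. V \<inter> (\<lambda>X. v \<bullet> F' X v) -` {0..})"
      by (intro closedin_INT continuous_closedin_preimage[OF cF]) auto
    moreover have "{X \<in> V. \<forall>v. 0 \<le> v \<bullet> F' X v} = (\<Inter>v. V \<inter> (\<lambda>X. v \<bullet> F' X v) -` {0..})" by auto
    ultimately have "closedin (top_of_set V) {X \<in> V. \<forall>v. 0 \<le> v \<bullet> F' X v}" by simp
    then obtain C where C: "closed C" "{X \<in> V. \<forall>v. 0 \<le> v \<bullet> F' X v} = V \<inter> C"
      unfolding closedin_closed by blast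
    show "{X \<in> V. \<forall>v. 0 \<le> v \<bullet> F' X v} \<in> sets borel"
      unfolding C(2) by (rule sets.Int[OF borel_open[OF opV] borel_closed[OF C(1)]])
  qed
  have m [measurable]: "MA_density \<phi> \<in> borel_measurable borel"
    by (rule borel_measurable_continuous_onI[OF continuous_on_MA_density[OF \<phi>]])
  have dm: "d \<in> borel_measurable borel" unfolding d_def borel_prod[symmetric] by measurable
  have d0: "0 \<le> d X" for X
    unfolding d_def MA_density_def using det_pos_if_pos_def[OF pd, of "fst X"] by simp
  have "emeasure lborel (slope_set \<phi> (fst X0) T (R / 2) \<times> {lo..hi}) \<le> (\<integral>\<^sup>+ X. ennreal (d X) * indicator A X \<partial>lborel)"
  proof (rule area_inequality[where f=F and f'=F', OF \<open>A \<in> sets borel\<close> _ _ _ dm d0])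
    fix X assume XA: "X \<in> A"
    hence XV: "X \<in> V" and XU: "X \<in> U" and z: "0 < snd X" using VU by (auto simp: A_def V_def)
    show "(F has_derivative F' X) (at X)"
      unfolding F_def F'_def[abs_def] by (rule has_derivative_touching_slope[OF s \<phi> WU opU XU z])
    have psd: "0 \<le> v \<bullet> (hess_Phi s \<phi> X v + R *\<^sub>R D2 W X v)" for v
      using XA unfolding A_def F'_def by blast
    have "X \<in> ?Q" using XU by (simp add: U_def)
    hence "0 \<le> L_Phi s \<phi> W X" using pos z by blast
    thus "\<bar>edet (F' X)\<bar> \<le> d X"
      unfolding F'_def[abs_def] d_def
      by (rule edet_perturbed_hess_Phi_le[OF \<phi> pd WU opU XU z _ R psd])
  next
    have "slope_set \<phi> (fst X0) T (R / 2) \<times> {lo..hi} \<in> sets (borel \<Otimes>\<^sub>M borel)"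
      by (intro pair_measureI borel_closed closed_slope_set) auto
    thus "slope_set \<phi> (fst X0) T (R / 2) \<times> {lo..hi} \<in> sets borel" unfolding borel_prod .
    show "slope_set \<phi> (fst X0) T (R / 2) \<times> {lo..hi} \<subseteq> F ` A"
    proof clarify
      fix Px qq assume Px: "Px \<in> slope_set \<phi> (fst X0) T (R / 2)" and qq: "qq \<in> {lo..hi}"
      have "\<kappa> < qq" using \<kappa>(2) qq by simp
      obtain X where "X \<in> ?S" "0 < snd X" "W X < 8"
          "touching_slope s \<phi> R W X = (Px, qq)"
          "\<And>v. 0 \<le> v \<bullet> (hess_Phi s \<phi> X v + R *\<^sub>R D2 W X v)"
        by (rule contact_point[OF s \<phi> pd R T sub z0 W _ X1 small \<kappa>(1) \<open>\<kappa> < qq\<close> Px q[OF qq]]) (use pos in blast)+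
      hence "X \<in> A" "F X = (Px, qq)" by (auto simp: A_def V_def F'_def F_def)
      thus "(Px, qq) \<in> F ` A" by (metis image_eqI)
    qed
  qed
  also have "\<dots> = emeasure (mu_Phi s \<phi>) A"
  proof -
    have "(\<lambda>(x, z). ennreal (MA_density \<phi> x * \<bar>z\<bar> powr (1 / s - 2))) = (\<lambda>X. ennreal (d X))"
      by (auto simp: d_def)
    thus ?thesis
      unfolding mu_Phi_def using dm \<open>A \<in> sets borel\<close> by (simp add: emeasure_density)
  qed
  also have "\<dots> \<le> emeasure (mu_Phi s \<phi>) {X \<in> ?S. W X < M}"
  proof (rule emeasure_mono)
    show "A \<subseteq> {X \<in> ?S. W X < M}" using M by (auto simp: A_def V_def)
    have "{X \<in> ?S. W X < M} = ?S \<inter> W -` {..<M}" by auto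
    moreover have "continuous_on ?S W" using class_SD(2)[OF W] sub continuous_on_subset by blast
    ultimately have "open {X \<in> ?S. W X < M}" using continuous_open_preimage[OF _ opS, of W "{..<M}"] by simp
    thus "{X \<in> ?S. W X < M} \<in> sets (mu_Phi s \<phi>)" by (simp add: mu_Phi_def)
  qed
  finally show ?thesis .
qed

section \<open>Critical density\<close>

definition reflect_z :: "'a \<times> real \<Rightarrow> 'a \<times> real" where
  "reflect_z X = (fst X, - snd X)"

lemma reflect_z_reflect_z [simp]: "reflect_z (reflect_z X) = X"
  by (simp add: reflect_z_def)

lemma emeasure_mu_Phi_reflect:
  fixes \<phi> :: "real ^ 'n \<Rightarrow> real"
  assumes \<phi>: "Ck_on 2 UNIV \<phi>" and A: "A \<in> sets borel"
  shows "emeasure (mu_Phi s \<phi>) (reflect_z -` A) = emeasure (mu_Phi s \<phi>) A"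
proof -
  have m [measurable]: "MA_density \<phi> \<in> borel_measurable borel"
    by (rule borel_measurable_continuous_onI[OF continuous_on_MA_density[OF \<phi>]])
  define d where "d = (\<lambda>(x, z). ennreal (MA_density \<phi> x * \<bar>z\<bar> powr (1 / s - 2)))"
  have A' [measurable]: "A \<in> sets (borel \<Otimes>\<^sub>M borel)" using A unfolding borel_prod .
  have "continuous_on UNIV (reflect_z :: (real ^ 'n) \<times> real \<Rightarrow> _)"
    unfolding reflect_z_def by (intro continuous_intros)
  hence r: "reflect_z \<in> borel_measurable (borel :: ((real ^ 'n) \<times> real) measure)"
    by (rule borel_measurable_continuous_onI)
  have rA: "reflect_z -` A \<in> sets borel" using r A by (metis measurable_sets_borel)
  hence rA' [measurable]: "reflect_z -` A \<in> sets (borel \<Otimes>\<^sub>M borel)" unfolding borel_prod .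
  have dm [measurable]: "d \<in> borel_measurable (borel \<Otimes>\<^sub>M borel)" unfolding d_def by measurable
  have dm': "d \<in> borel_measurable lborel" using dm unfolding borel_prod by simp
  have e: "emeasure (mu_Phi s \<phi>) B = (\<integral>\<^sup>+ x. (\<integral>\<^sup>+ z. d (x, z) * indicator B (x, z) \<partial>lborel) \<partial>lborel)"
    if B: "B \<in> sets borel" for B
  proof -
    have [measurable]: "B \<in> sets (borel \<Otimes>\<^sub>M borel)" using B unfolding borel_prod .
    have "emeasure (mu_Phi s \<phi>) B = (\<integral>\<^sup>+ X. d X * indicator B X \<partial>lborel)"
      unfolding mu_Phi_def d_def[symmetric] using dm' B by (subst emeasure_density) auto
    also have "\<dots> = (\<integral>\<^sup>+ x. (\<integral>\<^sup>+ z. d (x, z) * indicator B (x, z) \<partial>lborel) \<partial>lborel)"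
      unfolding lborel_prod[symmetric] by (subst lborel.nn_integral_fst[symmetric]) auto
    finally show ?thesis .
  qed
  have "(\<integral>\<^sup>+ z. d (x, z) * indicator (reflect_z -` A) (x, z) \<partial>lborel) = (\<integral>\<^sup>+ z. d (x, z) * indicator A (x, z) \<partial>lborel)" for x
    by (subst nn_integral_real_affine[where c="-1" and t=0])
       (auto simp: indicator_def reflect_z_def d_def intro!: nn_integral_cong)
  thus ?thesis unfolding e[OF rA] e[OF A] by simp
qed

text \<open>
  The estimate with explicit constants; the case of a center with \<open>z < 0\<close> reduces to the other one by
  reflection.
\<close>

lemma critical_density:
  fixes \<phi> :: "real ^ 'n \<Rightarrow> real" and W :: "(real ^ 'n) \<times> real \<Rightarrow> real"
  assumes s: "0 < s" "s < 1" and K: "h_quasi_triangle s K" and \<beta>: "36 \<le> \<beta>"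
    and \<theta>: "0 < \<theta>" "\<theta> < s / (1 - s)"
      "\<theta> < 1 / (8 * ((1 - s) / s\<^sup>2 * (K * (s\<^sup>2 / (1 - s) + \<beta>))) powr s)"
    and \<phi>: "Ck_on 2 UNIV \<phi>" "convex_on UNIV \<phi>" and pd: "\<And>x. pos_def (hess \<phi> x)" and DC: "DC C \<phi>"
    and R: "0 < R"
    and sub: "section_of (Phi s \<phi>) X0 (\<beta> * R) \<subseteq> cylinder \<phi> p0 R0"
    and W: "W \<in> class_S s \<phi> p0 R0"
    and pos: "\<And>X. X \<in> cylinder \<phi> p0 R0 \<Longrightarrow> 0 < snd X \<Longrightarrow> 0 \<le> W X \<and> 0 \<le> L_Phi s \<phi> W X"
    and X1: "X1 \<in> section_of (Phi s \<phi>) X0 R" "W X1 < 2"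
    and small: "\<And>x. (x, 0) \<in> section_of (Phi s \<phi>) X0 (\<beta> * R) \<Longrightarrow> R * \<bar>D_z_0plus W x\<bar> \<le> \<theta> * R powr (1 - s)"
    and M: "8 \<le> M"
  shows "emeasure (mu_Phi s \<phi>) (section_of (Phi s \<phi>) X0 (\<beta> * R))
    \<le> ennreal (C * (2 ^ (CARD('n) + 4) * \<beta>) ^ CARD('n) * (16 * K * \<beta>))
      * emeasure (mu_Phi s \<phi>) {X \<in> section_of (Phi s \<phi>) X0 (\<beta> * R). W X < M}"
proof -
  have upper_half: "emeasure (mu_Phi s \<phi>) (section_of (Phi s \<phi>) X0 (\<beta> * R))
      \<le> ennreal (C * (2 ^ (CARD('n) + 4) * \<beta>) ^ CARD('n) * (16 * K * \<beta>))
        * emeasure (mu_Phi s \<phi>) {X \<in> section_of (Phi s \<phi>) X0 (\<beta> * R). W X < M}"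
    if z0: "0 \<le> snd X0"
      and sub: "section_of (Phi s \<phi>) X0 (\<beta> * R) \<subseteq> cylinder \<phi> p0 R0"
      and X1: "X1 \<in> section_of (Phi s \<phi>) X0 R" "W X1 < 2"
      and small: "\<And>x. (x, 0) \<in> section_of (Phi s \<phi>) X0 (\<beta> * R) \<Longrightarrow> R * \<bar>D_z_0plus W x\<bar> \<le> \<theta> * R powr (1 - s)"
    for X0 X1
  proof -
    let ?S = "section_of (Phi s \<phi>) X0 (\<beta> * R)"
    let ?Sx = "section_of \<phi> (fst X0) (\<beta> * R)" and ?Sz = "section_of (h s) (snd X0) (\<beta> * R)"
    let ?P = "slope_set \<phi> (fst X0) (\<beta> * R) (R / 2)"
    define c1 c2 where "c1 = C * (2 ^ (CARD('n) + 4) * \<beta>) ^ CARD('n)" and "c2 = 16 * K * \<beta>"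
    have "1 \<le> \<beta>" using \<beta> by simp
    obtain lo hi where I: "lo \<le> hi"
      "\<And>q z. q \<in> {lo..hi} \<Longrightarrow> z \<in> ?Sz \<Longrightarrow> \<bar>(q - h' s (snd X0)) * (z - snd X0)\<bar> \<le> R / 2"
      "\<theta> * R powr (1 - s) < lo"
      "(\<integral>\<^sup>+ z. ennreal (\<bar>z\<bar> powr (1 / s - 2)) * indicator ?Sz z \<partial>lborel) \<le> ennreal (16 * K * \<beta> * (hi - lo))"
      using h_slope_interval[OF s K \<open>1 \<le> \<beta>\<close> R z0 \<theta>] by blast
    have \<beta>R: "0 < \<beta> * R" "36 * R \<le> \<beta> * R" using \<beta> R by auto
    have "0 \<le> \<theta> * R powr (1 - s)" using \<theta>(1) by simp
    have C: "1 \<le> C" "1 \<le> K" using DC K by (auto simp: DC_def h_quasi_triangle_def)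
    have opx: "open ?Sx" and opz: "open ?Sz"
      using open_section_of[OF Ck_on_imp_continuous_on[OF \<phi>(1)]] open_section_of[OF continuous_on_h[OF s]] by auto
    have "emeasure (mu_Phi s \<phi>) ?S \<le> emeasure (mu_Phi s \<phi>) (?Sx \<times> ?Sz)"
      using section_Phi_subset_Times[OF s \<phi>(1) pd] open_Times[OF opx opz]
      by (intro emeasure_mono) (auto simp: mu_Phi_def)
    also have "\<dots> = emeasure (MA_measure \<phi>) ?Sx *
        (\<integral>\<^sup>+ z. ennreal (\<bar>z\<bar> powr (1 / s - 2)) * indicator ?Sz z \<partial>lborel)"
      using opx opz by (intro mu_Phi_Times[OF \<phi>(1) pd]) auto
    also have "\<dots> \<le> (ennreal c1 * emeasure lborel ?P) * ennreal (c2 * (hi - lo))"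
    proof (intro mult_mono)
      have "(2::real) ^ (CARD('n) + 4) = 2 ^ (CARD('n) + 3) * 2" by (simp add: power_add)
      hence eq: "2 ^ (CARD('n) + 3) * (\<beta> * R) / (R / 2) = 2 ^ (CARD('n) + 4) * \<beta>"
        using R by simp
      have "0 < R / 2" using R by simp
      from MA_measure_section_le_slope_set[OF \<phi> pd DC \<beta>R(1) this, of "fst X0"]
      show "emeasure (MA_measure \<phi>) ?Sx \<le> ennreal c1 * emeasure lborel ?P"
        unfolding eq c1_def .
    qed (use I(4) in \<open>auto simp: c2_def\<close>)
    also have "\<dots> = ennreal (c1 * c2) * (emeasure lborel ?P * emeasure lborel {lo..hi})"
    proof -
      have "0 \<le> c1" "0 \<le> c2" using C \<beta> by (auto simp: c1_def c2_def)
      thus ?thesis using I(1) by (simp add: ennreal_mult mult_ac)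
    qed
    also have "emeasure lborel ?P * emeasure lborel {lo..hi} = emeasure lborel (?P \<times> {lo..hi})"
      unfolding lborel_prod[symmetric]
      by (rule lborel.emeasure_pair_measure_Times[symmetric]) (auto intro: borel_closed closed_slope_set)
    also have "\<dots> \<le> emeasure (mu_Phi s \<phi>) {X \<in> ?S. W X < M}"
      by (rule slopes_le_mu_Phi[OF s \<phi>(1) pd R \<beta>R(2) sub z0 W pos X1 small \<open>0 \<le> \<theta> * R powr (1 - s)\<close> I(3) I(2) M])
    finally show ?thesis by (simp add: c1_def c2_def mult_left_mono)
  qed
  show ?thesis
  proof (cases "0 \<le> snd X0")
    case True
    thus ?thesis by (rule upper_half) (fact sub X1 small)+
  next
    case False
    define Y0 where "Y0 = reflect_z X0"
    let ?S = "section_of (Phi s \<phi>) X0 (\<beta> * R)" and ?S' = "section_of (Phi s \<phi>) Y0 (\<beta> * R)"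
    have refl: "X \<in> section_of (Phi s \<phi>) Y0 t \<longleftrightarrow> reflect_z X \<in> section_of (Phi s \<phi>) X0 t" for X t
      using h_minus[OF s] h'_minus[OF s]
      by (simp add: section_of_def Y0_def bregman_Phi[OF s \<phi>(1)] bregman_h[OF s] reflect_z_def algebra_simps)
    have Wr: "W (reflect_z X) = W X" if "X \<in> cylinder \<phi> p0 R0" for X
      using class_SD(1)[OF W, of "fst X" "snd X"] that by (simp add: reflect_z_def)
    have cyl: "reflect_z X \<in> cylinder \<phi> p0 R0 \<longleftrightarrow> X \<in> cylinder \<phi> p0 R0" for X
      by (simp add: cylinder_def reflect_z_def mem_Times_iff)
    have sub': "?S' \<subseteq> cylinder \<phi> p0 R0" using sub refl cyl by blast
    have op: "open ?S" by (rule open_section_of[OF continuous_on_Phi[OF s \<phi>(1)]])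
    have "continuous_on ?S W" using class_SD(2)[OF W] sub continuous_on_subset by blast
    moreover have "{X \<in> ?S. W X < M} = ?S \<inter> W -` {..<M}" by auto
    ultimately have op2: "open {X \<in> ?S. W X < M}" using continuous_open_preimage[OF _ op, of W "{..<M}"] by simp
    have X1S: "X1 \<in> ?S"
    proof -
      have "R \<le> \<beta> * R" using \<beta> R by simp
      thus ?thesis using X1(1) by (simp add: section_of_def)
    qed
    have "emeasure (mu_Phi s \<phi>) ?S'
      \<le> ennreal (C * (2 ^ (CARD('n) + 4) * \<beta>) ^ CARD('n) * (16 * K * \<beta>))
        * emeasure (mu_Phi s \<phi>) {X \<in> ?S'. W X < M}"
    proof (rule upper_half)
      show "0 \<le> snd Y0" using False by (simp add: Y0_def reflect_z_def)
      show "?S' \<subseteq> cylinder \<phi> p0 R0" by (rule sub')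
      show "reflect_z X1 \<in> section_of (Phi s \<phi>) Y0 R" using X1 by (simp add: refl)
      show "W (reflect_z X1) < 2" using X1(2) by (simp add: Wr[OF subsetD[OF sub X1S]])
      fix x assume "(x, 0) \<in> ?S'"
      hence "(x, 0) \<in> ?S" by (simp add: refl) (simp add: reflect_z_def)
      thus "R * \<bar>D_z_0plus W x\<bar> \<le> \<theta> * R powr (1 - s)" by (rule small)
    qed
    moreover have "?S' = reflect_z -` ?S" using refl by auto
    hence "emeasure (mu_Phi s \<phi>) ?S' = emeasure (mu_Phi s \<phi>) ?S"
      using emeasure_mu_Phi_reflect[OF \<phi>(1) borel_open[OF op]] by simp
    moreover have "{X \<in> ?S'. W X < M} = reflect_z -` {X \<in> ?S. W X < M}"
      using refl sub' Wr by (auto simp: subset_iff)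
    hence "emeasure (mu_Phi s \<phi>) {X \<in> ?S'. W X < M} = emeasure (mu_Phi s \<phi>) {X \<in> ?S. W X < M}"
      using emeasure_mu_Phi_reflect[OF \<phi>(1) borel_open[OF op2]] by simp
    ultimately show ?thesis by simp
  qed
qed

theorem theorem10p1:
  fixes s K C\<^sub>d :: real
  assumes "0 < s" and "s < 1"
    and "h_quasi_triangle s K"
    and "1 \<le> C\<^sub>d"
  shows "\<exists>\<theta>\<^sub>0 \<epsilon>\<^sub>0 :: real. 0 < \<theta>\<^sub>0 \<and> \<theta>\<^sub>0 < 1 \<and> 0 < \<epsilon>\<^sub>0 \<and> \<epsilon>\<^sub>0 < 1 \<and>
    (\<forall>\<phi> :: real ^ 'n \<Rightarrow> real.
       Ck_on 3 UNIV \<phi> \<longrightarrow> convex_on UNIV \<phi> \<longrightarrow> (\<forall>x. pos_def (hess \<phi> x)) \<longrightarrow> DC C\<^sub>d \<phi> \<longrightarrow>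
       (\<forall>p0 R0 X0 R W.
          0 < R0 \<longrightarrow> 0 < R \<longrightarrow>
          section_of (Phi s \<phi>) X0 (beta_const K * R) \<subseteq> cylinder \<phi> p0 R0 \<longrightarrow>
          W \<in> class_S s \<phi> p0 R0 \<longrightarrow>
          (\<forall>X \<in> cylinder \<phi> p0 R0. 0 < snd X \<longrightarrow> 0 \<le> W X \<and> 0 \<le> L_Phi s \<phi> W X) \<longrightarrow>
          sup_D_z_0plus W (section_of (Phi s \<phi>) X0 (beta_const K * R)) * ennreal (R powr s)
            \<le> ennreal \<theta>\<^sub>0 \<longrightarrow>
          (INF X \<in> section_of (Phi s \<phi>) X0 R. W X) \<le> 1 \<longrightarrow>
          emeasure (mu_Phi s \<phi>)
              {X \<in> section_of (Phi s \<phi>) X0 (beta_const K * R). W X < M_const s}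
            \<ge> ennreal \<epsilon>\<^sub>0 * emeasure (mu_Phi s \<phi>) (section_of (Phi s \<phi>) X0 (beta_const K * R))))"
proof -
  note s = assms(1,2) and K = assms(3)
  have K1: "1 \<le> K" using K by (simp add: h_quasi_triangle_def)
  define \<beta> where "\<beta> = beta_const K"
  have \<beta>: "36 \<le> \<beta>"
  proof -
    have "4 * 1 * (1 + 8 * 1) \<le> 4 * K * (1 + 8 * K)" using K1 by (intro mult_mono) auto
    thus ?thesis by (simp add: \<beta>_def beta_const_def)
  qed
  define B where "B = ((1 - s) / s\<^sup>2 * (K * (s\<^sup>2 / (1 - s) + \<beta>))) powr s"
  define N where "N = C\<^sub>d * (2 ^ (CARD('n) + 4) * \<beta>) ^ CARD('n) * (16 * K * \<beta>)"
  have Bpos: "0 < B"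
  proof -
    have "0 < s\<^sup>2 / (1 - s) + \<beta>" using s \<beta> by (intro add_pos_pos) auto
    thus ?thesis using s K1 by (simp add: B_def)
  qed
  have N1: "1 < N"
  proof -
    have "1 \<le> 2 ^ (CARD('n) + 4) * \<beta>"
      using \<beta> mult_mono[of 1 "2 ^ (CARD('n) + 4)" 1 \<beta>] one_le_power[of "2::real" "CARD('n) + 4"] by simp
    hence "1 \<le> (2 ^ (CARD('n) + 4) * \<beta>) ^ CARD('n)" by (rule one_le_power)
    hence "1 * 1 \<le> C\<^sub>d * (2 ^ (CARD('n) + 4) * \<beta>) ^ CARD('n)" using assms(4) by (intro mult_mono) auto
    moreover have "1 * 36 \<le> K * \<beta>" using K1 \<beta> by (intro mult_mono) auto
    ultimately have "1 * 2 \<le> N" unfolding N_def by (intro mult_mono) auto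
    thus ?thesis by simp
  qed
  obtain \<theta> where \<theta>: "0 < \<theta>" "\<theta> < 1" "\<theta> < s / (1 - s)" "\<theta> < 1 / (8 * B)"
    using field_lbound_gt_zero[of "min 1 (s / (1 - s))" "1 / (8 * B)"] s Bpos by auto
  show ?thesis
  proof (rule exI[of _ \<theta>], rule exI[of _ "1 / N"], intro conjI allI impI)
    show "0 < \<theta>" "\<theta> < 1" "0 < 1 / N" "1 / N < 1" using \<theta> N1 by auto
  next
    fix \<phi> :: "real ^ 'n \<Rightarrow> real" and p0 R0 X0 R W
    let ?S = "section_of (Phi s \<phi>) X0 (beta_const K * R)"
    assume \<phi>: "Ck_on 3 UNIV \<phi>" "convex_on UNIV \<phi>" and pd: "\<forall>x. pos_def (hess \<phi> x)" and DC: "DC C\<^sub>d \<phi>"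
      and R: "0 < (R :: real)" and sub: "?S \<subseteq> cylinder \<phi> p0 R0" and W: "W \<in> class_S s \<phi> p0 R0"
      and pos: "\<forall>X \<in> cylinder \<phi> p0 R0. 0 < snd X \<longrightarrow> 0 \<le> W X \<and> 0 \<le> L_Phi s \<phi> W X"
      and small: "sup_D_z_0plus W ?S * ennreal (R powr s) \<le> ennreal \<theta>"
      and inf: "(INF X \<in> section_of (Phi s \<phi>) X0 R. W X) \<le> 1"
    have \<phi>2: "Ck_on 2 UNIV \<phi>" using Ck_on_SucD[of 2 UNIV \<phi>] \<phi>(1) by (simp add: eval_nat_numeral)
    have RS: "section_of (Phi s \<phi>) X0 R \<subseteq> ?S"
    proof -
      have "R \<le> beta_const K * R" using \<beta> R by (simp add: \<beta>_def)
      thus ?thesis by (auto simp: section_of_def)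
    qed
    have "X0 \<in> section_of (Phi s \<phi>) X0 R" using R by (simp add: section_of_def)
    moreover have "bdd_below (W ` section_of (Phi s \<phi>) X0 R)"
    proof (rule bdd_belowI2)
      fix X assume "X \<in> section_of (Phi s \<phi>) X0 R"
      hence "X \<in> cylinder \<phi> p0 R0" using RS sub by blast
      thus "0 \<le> W X" by (rule nonneg_on_cylinder[OF W, rotated]) (use pos in blast)
    qed
    moreover have "(INF X \<in> section_of (Phi s \<phi>) X0 R. W X) < 2" using inf by simp
    ultimately obtain X1 where X1: "X1 \<in> section_of (Phi s \<phi>) X0 R" "W X1 < 2"
      by (subst (asm) cINF_less_iff) auto
    have small': "R * \<bar>D_z_0plus W x\<bar> \<le> \<theta> * R powr (1 - s)" if x: "(x, 0) \<in> ?S" for x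
    proof -
      have xZ: "(x, 0) \<in> ?S \<inter> Z0" using x by (simp add: Z0_def)
      hence "ennreal \<bar>D_z_0plus W (fst (x, 0 :: real))\<bar> \<le> sup_D_z_0plus W ?S"
        unfolding sup_D_z_0plus_def by (auto intro!: SUP_upper2)
      hence "ennreal \<bar>D_z_0plus W x\<bar> * ennreal (R powr s) \<le> ennreal \<theta>"
        using small by (metis dual_order.trans fst_conv mult_right_mono zero_le)
      hence "\<bar>D_z_0plus W x\<bar> * R powr s \<le> \<theta>" using \<theta>(1) by (simp add: ennreal_mult[symmetric])
      hence "(\<bar>D_z_0plus W x\<bar> * R powr s) * R powr (1 - s) \<le> \<theta> * R powr (1 - s)"
        by (rule mult_right_mono) simp
      moreover have "R powr s * R powr (1 - s) = R" using R by (simp add: powr_add[symmetric])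
      hence "(\<bar>D_z_0plus W x\<bar> * R powr s) * R powr (1 - s) = R * \<bar>D_z_0plus W x\<bar>"
        by (metis mult.assoc mult.commute)
      ultimately show ?thesis by simp
    qed
    have M: "8 \<le> M_const s" using s by (simp add: M_const_def)
    have main: "emeasure (mu_Phi s \<phi>) ?S \<le> ennreal N * emeasure (mu_Phi s \<phi>) {X \<in> ?S. W X < M_const s}"
      unfolding N_def \<beta>_def
      by (rule critical_density[OF s K \<beta>[unfolded \<beta>_def] \<theta>(1,3) \<theta>(4)[unfolded B_def \<beta>_def] \<phi>2 \<phi>(2) _ DC R sub W _ X1 small' M])
         (use pd pos in auto)
    have "ennreal (1 / N) * emeasure (mu_Phi s \<phi>) ?S
        \<le> ennreal (1 / N) * (ennreal N * emeasure (mu_Phi s \<phi>) {X \<in> ?S. W X < M_const s})"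
      by (intro mult_left_mono main) simp
    also have "\<dots> = emeasure (mu_Phi s \<phi>) {X \<in> ?S. W X < M_const s}"
      using N1 by (simp add: mult.assoc[symmetric] ennreal_mult[symmetric])
    finally show "ennreal (1 / N) * emeasure (mu_Phi s \<phi>) ?S \<le> emeasure (mu_Phi s \<phi>) {X \<in> ?S. W X < M_const s}" .
  qed
qed

end
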